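(* Suppose $N\ge 3$ and $d\ge 3$. Let $\rho=\rho(r)\,dr\,d\theta$ be a radially symmetric probability measure on $\mathbb{R}^d$, and let $\mu=\rho(r)\,dr$ on $[0,\infty)$. Assume that for some minimizer $\gamma$ of $\int_{\mathbb{R}^N} h\,d\gamma$ among measures on $\mathbb{R}^N$ with all $N$ one-dimensional marginals equal to $\mu$, the following holds: for all $r$ in some subset $I\subseteq(0,\infty)$ of positive measure, there is at least one point $\vec r=(r_1,r_2,\dots,r_N)\in\operatorname{spt}(\gamma)$ with $r_1=r$ for which there exist $(x_1(\vec r),\dots,x_N(\vec r))$ attaining the infimum defining $h(\vec r)$ such that $x_1(\vec r)$ and $x_i(\vec r)$ are not co-linear for some $i$. Then there exists a minimizer $\rho_N$ of $C_N$ over $\Pi(\rho)$ whose support is at least $(2d-2)$-dimensional.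
   Context: For a probability measure $\rho$ on $\mathbb{R}^d$, $\Pi(\rho)$ is the set of probability measures on $(\mathbb{R}^{d})^N$ all of whose $N$ marginals on $\mathbb{R}^d$ equal $\rho$. For $\rho_N\in\Pi(\rho)$, $$C_N(\rho_N)=\int_{\mathbb{R}^{dN}}\sum_{i\ne j}\frac{1}{|x_i-x_j|}\,d\rho_N,$$ where the integrand is $+\infty$ when $x_i=x_j$ for some $i\neq j$. Polar coordinates identify $\mathbb{R}^d$ with $[0,\infty)\times\mathbb{S}^{d-1}$, $d\theta$ is the uniform measure on $\mathbb{S}^{d-1}$ (normalized, so that $\mu$ is a probability measure), and radial symmetry of $\rho=\rho(r,\theta)\,dr\,d\theta$ means that the density $\rho(r,\theta)=\rho(r)$ is independent of $\theta$. The reduced cost is $$h(r_1,\dots,r_N)=\inf_{|x_1|=r_1,\dots,|x_N|=r_N}\ \sum_{i\ne j}\frac1{|x_i-x_j|},\qquad x_i\in\mathbb{R}^d .$$ Vectors are co-linear if they lie on a common line through the origin. $\operatorname{spt}$ denotes the support of a measure. *)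

theory Defs
  imports "HOL-Probability.Probability"
begin

definition couplings :: "'a::topological_space measure \<Rightarrow> ('a ^ 'n::finite) measure set" where
  "couplings \<rho> =
     {P. prob_space P \<and> sets P = sets borel \<and> (\<forall>i. distr P borel (\<lambda>x. x $ i) = \<rho>)}"

(* In ennreal, 1 / 0 = \<infinity>, so the cost is infinite as soon as two of the points coincide. *)
definition coulomb_cost :: "(real ^ 'd::finite) ^ 'n::finite \<Rightarrow> ennreal" where
  "coulomb_cost x = (\<Sum>(i, j) \<in> {(i, j). i \<noteq> j}. 1 / ennreal (norm (x $ i - x $ j)))"

definition coulomb_functional :: "((real ^ 'd::finite) ^ 'n::finite) measure \<Rightarrow> ennreal" where
  "coulomb_functional P = (\<integral>\<^sup>+ x. coulomb_cost x \<partial>P)"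

(* The infimum depends on the dimension of the ambient space of the x_i, which cannot be
   recovered from the radii; the type argument supplies it. *)
definition reduced_cost :: "'d::finite itself \<Rightarrow> real ^ 'n::finite \<Rightarrow> ennreal" where
  "reduced_cost _ r =
     (INF x \<in> {x :: (real ^ 'd) ^ 'n. \<forall>i. norm (x $ i) = r $ i}. coulomb_cost x)"

definition reduced_functional :: "'d::finite itself \<Rightarrow> (real ^ 'n::finite) measure \<Rightarrow> ennreal" where
  "reduced_functional d \<gamma> = (\<integral>\<^sup>+ r. reduced_cost d r \<partial>\<gamma>)"

definition attains_reduced_cost ::
    "real ^ 'n::finite \<Rightarrow> (real ^ 'd::finite) ^ 'n \<Rightarrow> bool" where
  "attains_reduced_cost r x \<longleftrightarrow>
     (\<forall>i. norm (x $ i) = r $ i) \<and> coulomb_cost x = reduced_cost TYPE('d) r"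

(* The measure \<rho>(r) dr on [0, \<infinity>), regarded as a measure on the real line. *)
definition radial_marginal :: "(real \<Rightarrow> real) \<Rightarrow> real measure" where
  "radial_marginal \<rho> = density lborel (\<lambda>r. indicator {0..} r * ennreal (\<rho> r))"

(* The normalised surface measure of the unit sphere, obtained as the law of x / |x| for x
   uniformly distributed in the unit ball. *)
definition uniform_sphere :: "(real ^ 'd::finite) measure" where
  "uniform_sphere = distr (uniform_measure lborel (ball 0 1)) borel (\<lambda>x. x /\<^sub>R norm x)"

(* The measure \<rho>(r) dr d\<theta>; there is no Jacobian factor r^(d-1). *)
definition radial_measure :: "(real \<Rightarrow> real) \<Rightarrow> (real ^ 'd::finite) measure" where
  "radial_measure \<rho> =
     distr (radial_marginal \<rho> \<Otimes>\<^sub>M uniform_sphere) borel (\<lambda>(r, \<theta>). r *\<^sub>R \<theta>)"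

definition measure_support :: "'a::topological_space measure \<Rightarrow> 'a set" where
  "measure_support M = {x. \<forall>U. open U \<longrightarrow> x \<in> U \<longrightarrow> emeasure M U > 0}"

(* The covering sets must be required to be bounded because diameter is not meaningful
   otherwise. *)
definition hausdorff_content :: "real \<Rightarrow> real \<Rightarrow> 'a::metric_space set \<Rightarrow> ennreal" where
  "hausdorff_content \<delta> s A =
     (INF U \<in> {U :: nat \<Rightarrow> 'a set. A \<subseteq> (\<Union>i. U i) \<and> (\<forall>i. bounded (U i) \<and> diameter (U i) \<le> \<delta>)}.
        \<Sum>i. ennreal (diameter (U i) powr s))"

definition hausdorff_measure :: "real \<Rightarrow> 'a::metric_space set \<Rightarrow> ennreal" where
  "hausdorff_measure s A = (SUP \<delta> \<in> {0<..}. hausdorff_content \<delta> s A)"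

(* Only s > 0 is used: since 0 powr 0 = 0, hausdorff_measure 0 is not the counting measure. *)
definition hausdorff_dim :: "'a::metric_space set \<Rightarrow> ereal" where
  "hausdorff_dim A = (INF s \<in> {s. s > 0 \<and> hausdorff_measure s A = 0}. ereal s)"

end

theory Submission
  imports Defs
begin

text \<open>Choose an optimal configuration \<open>x(r)\<close> measurably and let \<open>P\<close> be the law of
  \<open>(A x\<^sub>1(r), \<dots>, A x\<^sub>N(r))\<close>, where \<open>r\<close> has law \<open>\<gamma>\<close> and \<open>A\<close> is an independent orthogonal matrix
  with a left-invariant law. Then \<open>P\<close> is optimal, its support is invariant under rotations, and by
  closedness of the set of optimal configurations it contains some optimizer over each point of
  \<open>spt \<gamma>\<close>.

  The optimizer found in the support need not be the non-collinear one of the hypothesis. However,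
  if a collinear optimizer exists then all optimizers are collinear: second-order optimality of a
  collinear configuration against perturbations orthogonal to its line says that its Gram matrix
  minimizes the cost, a strictly convex function of Gram matrices, even without the rank
  constraint. This needs the cost to be finite on \<open>spt \<gamma>\<close>, which follows by rearranging \<open>\<gamma>\<close> near a
  point of infinite cost.

  The support thus contains, for every \<open>r\<close> in \<open>I\<close>, the rotation orbit of a non-collinear
  configuration with \<open>|x\<^sub>1| = r\<close>. The maps \<open>(x, p, s, t) \<mapsto> (|x\<^sub>1|, p x\<^sub>1, s x\<^sub>i + t x\<^sub>1)\<close> spread
  three parameters over it and cover \<open>I\<close> times all linearly independent pairs, up to a decomposition
  of \<open>I\<close> over \<open>i\<close>; this set is not negligible in dimension \<open>2d + 1\<close>, so the support has dimension
  at least \<open>2d - 2\<close>.\<close>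

section \<open>Measurable selections and linear isometries\<close>

text \<open>The value 2d - 2 counts one dimension for the radius and (d - 1) + (d - 2) for the
  orthonormal pairs in the rotation orbit of two non-collinear vectors; the three spread parameters
  account for the length of the first target vector and the two coordinates of the second in its
  frame. Nothing is known about how the configurations vary with \<open>r\<close>, so the lower
  bound relies on outer measure, null sets and Fubini instead of a parametrization.

  Rigidity perturbs along a single direction orthogonal to the line, with an arbitrary amplitude for
  each point. Taking each coordinate of a competing optimizer in turn as amplitudes and adding up
  gives the first-order inequality towards the Gram matrix of that optimizer, whatever its rank.

  Finiteness matters because, where the reduced cost is infinite, every configuration with the given
  radii attains it, collinear or not. For d at least 2 and nonnegative radii this happens only if
  two radii vanish, which is why the rearrangement keeps small coordinates apart.\<close>

lemma borel_measurable_vecI: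
  fixes f :: "'a \<Rightarrow> 'b::euclidean_space ^ 'n::finite"
  assumes "\<And>i. (\<lambda>x. f x $ i) \<in> borel_measurable M"
  shows "f \<in> borel_measurable M"
proof (subst borel_measurable_euclidean_space, intro ballI)
  fix b :: "'b ^ 'n" assume "b \<in> Basis"
  then obtain i u where b: "b = axis i u" by (auto simp: Basis_vec_def)
  show "(\<lambda>x. f x \<bullet> b) \<in> borel_measurable M"
    unfolding b inner_axis using assms[of i] by measurable
qed

lemma borel_measurable_vec_nth [measurable]:
  "(\<lambda>x :: 'b::euclidean_space ^ 'n::finite. x $ i) \<in> borel_measurable borel"
  by (intro borel_measurable_continuous_onI continuous_intros)

text \<open>The selected point is a lexicographic minimum: the induction over \<open>Basis\<close>
  shrinks each fibre to its minimizers of one more coordinate, until only one point is left.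
  Measurability is carried along as measurability of the sets where a fibre meets a given closed
  set.\<close>

lemma measurable_selection_compact:
  fixes \<Phi> :: "'a \<Rightarrow> 'b::euclidean_space set"
  assumes cpt: "\<And>w. w \<in> space M \<Longrightarrow> compact (\<Phi> w)"
    and ne: "\<And>w. w \<in> space M \<Longrightarrow> \<Phi> w \<noteq> {}"
    and meas: "\<And>K. closed K \<Longrightarrow> {w \<in> space M. \<Phi> w \<inter> K \<noteq> {}} \<in> sets M"
  obtains f where "f \<in> borel_measurable M" "\<And>w. w \<in> space M \<Longrightarrow> f w \<in> \<Phi> w"
proof -
  have "\<exists>\<Psi>. (\<forall>w\<in>space M. compact (\<Psi> w) \<and> \<Psi> w \<noteq> {} \<and> \<Psi> w \<subseteq> \<Phi> w \<and>
                 (\<forall>x\<in>\<Psi> w. \<forall>y\<in>\<Psi> w. \<forall>b\<in>B. x \<bullet> b = y \<bullet> b)) \<and>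
             (\<forall>K. closed K \<longrightarrow> {w \<in> space M. \<Psi> w \<inter> K \<noteq> {}} \<in> sets M)"
    if "finite B" "B \<subseteq> Basis" for B
    using that
  proof (induction B rule: finite_induct)
    case empty
    show ?case by (rule exI[of _ \<Phi>]) (use assms in auto)
  next
    case (insert b B)
    then obtain \<Psi> where \<Psi>0: "\<forall>w\<in>space M. compact (\<Psi> w) \<and> \<Psi> w \<noteq> {} \<and> \<Psi> w \<subseteq> \<Phi> w \<and>
                 (\<forall>x\<in>\<Psi> w. \<forall>y\<in>\<Psi> w. \<forall>b\<in>B. x \<bullet> b = y \<bullet> b)"
      and \<Psi>m: "\<And>K. closed K \<Longrightarrow> {w \<in> space M. \<Psi> w \<inter> K \<noteq> {}} \<in> sets M"
      by blast
    have \<Psi>: "\<And>w. w \<in> space M \<Longrightarrow> compact (\<Psi> w)"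
        "\<And>w. w \<in> space M \<Longrightarrow> \<Psi> w \<noteq> {}" "\<And>w. w \<in> space M \<Longrightarrow> \<Psi> w \<subseteq> \<Phi> w"
        "\<And>w x y b. w \<in> space M \<Longrightarrow> x \<in> \<Psi> w \<Longrightarrow> y \<in> \<Psi> w \<Longrightarrow> b \<in> B \<Longrightarrow> x \<bullet> b = y \<bullet> b"
      using \<Psi>0 by blast+
    have attain: "\<exists>x\<in>\<Psi> w \<inter> K. \<forall>y\<in>\<Psi> w \<inter> K. x \<bullet> b \<le> y \<bullet> b"
      if "w \<in> space M" "closed K" "\<Psi> w \<inter> K \<noteq> {}" for w K
      using that \<Psi>(1)
      by (intro continuous_attains_inf compact_Int_closed continuous_intros) auto
    define m where "m w = (INF x\<in>\<Psi> w. x \<bullet> b)" for w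
    have m: "\<exists>x\<in>\<Psi> w. x \<bullet> b = m w" "\<And>x. x \<in> \<Psi> w \<Longrightarrow> m w \<le> x \<bullet> b" if w: "w \<in> space M" for w
    proof -
      obtain x where x: "x \<in> \<Psi> w" "\<And>y. y \<in> \<Psi> w \<Longrightarrow> x \<bullet> b \<le> y \<bullet> b"
        using attain[of w UNIV] \<Psi>(2)[OF w] w by auto
      have "m w = x \<bullet> b" unfolding m_def using x
        by (intro cInf_eq_minimum) auto
      with x show "\<exists>x\<in>\<Psi> w. x \<bullet> b = m w" "\<And>x. x \<in> \<Psi> w \<Longrightarrow> m w \<le> x \<bullet> b" by auto
    qed
    have cl: "closed {x :: 'b. x \<bullet> b \<le> a}" for a
      using closed_halfspace_le[of b a] by (simp add: inner_commute)
    have m_meas[measurable]: "m \<in> borel_measurable M"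
    proof (rule borel_measurable_iff_le[THEN iffD2], rule allI)
      fix a
      have "{w \<in> space M. m w \<le> a} = {w \<in> space M. \<Psi> w \<inter> {x. x \<bullet> b \<le> a} \<noteq> {}}"
        using m by (fastforce intro: order_trans)
      then show "{w \<in> space M. m w \<le> a} \<in> sets M" using \<Psi>m[OF cl] by simp
    qed
    define \<Psi>' where "\<Psi>' w = \<Psi> w \<inter> {x. x \<bullet> b \<le> m w}" for w
    have \<Psi>'m: "{w \<in> space M. \<Psi>' w \<inter> K \<noteq> {}} \<in> sets M" if K: "closed K" for K
    proof -
      \<comment> \<open>By compactness the minimum of \<open>x \<bullet> b\<close> over
        \<open>\<Psi> w \<inter> K\<close> is attained, so it suffices to go below every rational
        above \<open>m w\<close>; this leaves a countable intersection.\<close>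
      have "{w \<in> space M. \<Psi>' w \<inter> K \<noteq> {}} =
          {w \<in> space M. \<forall>q::rat. m w < of_rat q \<longrightarrow> w \<in> {w \<in> space M. \<Psi> w \<inter> (K \<inter> {x. x \<bullet> b \<le> of_rat q}) \<noteq> {}}}"
        (is "?L = ?R")
      proof (intro set_eqI iffI)
        fix w assume "w \<in> ?L"
        then show "w \<in> ?R" by (fastforce simp: \<Psi>'_def)
      next
        fix w assume w: "w \<in> ?R"
        then have ws: "w \<in> space M" by simp
        obtain q :: rat where "m w < of_rat q"
          using of_rat_dense[of "m w" "m w + 1"] by auto
        with w have "\<Psi> w \<inter> K \<noteq> {}" by blast
        then obtain x where x: "x \<in> \<Psi> w \<inter> K" "\<And>y. y \<in> \<Psi> w \<inter> K \<Longrightarrow> x \<bullet> b \<le> y \<bullet> b"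
          using attain[OF ws K] by auto
        have "x \<bullet> b \<le> m w"
        proof (rule ccontr)
          assume "\<not> x \<bullet> b \<le> m w"
          then obtain q :: rat where q: "m w < of_rat q" "of_rat q < x \<bullet> b"
            using of_rat_dense[of "m w" "x \<bullet> b"] by auto
          with w obtain y where "y \<in> \<Psi> w" "y \<in> K" "y \<bullet> b \<le> of_rat q" by blast
          with x(2)[of y] q show False by auto
        qed
        with x ws show "w \<in> ?L" by (auto simp: \<Psi>'_def)
      qed
      moreover have "?R \<in> sets M"
        using \<Psi>m[OF closed_Int[OF K cl]]
        by (intro sets.sets_Collect_countable_All sets.sets_Collect_imp) auto
      ultimately show ?thesis by simp
    qed
    have \<Psi>'c: "compact (\<Psi>' w) \<and> \<Psi>' w \<noteq> {} \<and> \<Psi>' w \<subseteq> \<Phi> w \<and>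
                 (\<forall>x\<in>\<Psi>' w. \<forall>y\<in>\<Psi>' w. \<forall>c\<in>insert b B. x \<bullet> c = y \<bullet> c)" if w: "w \<in> space M" for w
    proof (intro conjI)
      show "compact (\<Psi>' w)" using \<Psi>(1)[OF w] cl unfolding \<Psi>'_def by (intro compact_Int_closed)
      show "\<Psi>' w \<noteq> {}" using m(1)[OF w] by (auto simp: \<Psi>'_def)
      show "\<Psi>' w \<subseteq> \<Phi> w" using \<Psi>(3)[OF w] by (auto simp: \<Psi>'_def)
      show "\<forall>x\<in>\<Psi>' w. \<forall>y\<in>\<Psi>' w. \<forall>c\<in>insert b B. x \<bullet> c = y \<bullet> c"
      proof (intro ballI)
        fix x y c assume xy: "x \<in> \<Psi>' w" "y \<in> \<Psi>' w" and c: "c \<in> insert b B"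
        then have xy': "x \<in> \<Psi> w" "y \<in> \<Psi> w" "x \<bullet> b \<le> m w" "y \<bullet> b \<le> m w" by (auto simp: \<Psi>'_def)
        show "x \<bullet> c = y \<bullet> c"
        proof (cases "c = b")
          case True
          then show ?thesis using xy' m(2)[OF w xy'(1)] m(2)[OF w xy'(2)] by simp
        next
          case False
          with c show ?thesis using \<Psi>(4)[OF w] xy' by blast
        qed
      qed
    qed
    show ?case
    proof (intro exI[of _ \<Psi>'] conjI ballI)
      show "\<forall>K. closed K \<longrightarrow> {w \<in> space M. \<Psi>' w \<inter> K \<noteq> {}} \<in> sets M" using \<Psi>'m by blast
    qed (use \<Psi>'c in blast)+
  qed
  from this[OF finite_Basis subset_refl] obtain \<Psi> where
      \<Psi>0: "\<forall>w\<in>space M. compact (\<Psi> w) \<and> \<Psi> w \<noteq> {} \<and> \<Psi> w \<subseteq> \<Phi> w \<and>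
                 (\<forall>x\<in>\<Psi> w. \<forall>y\<in>\<Psi> w. \<forall>b\<in>Basis. x \<bullet> b = y \<bullet> b)"
      and \<Psi>m: "\<forall>K. closed K \<longrightarrow> {w \<in> space M. \<Psi> w \<inter> K \<noteq> {}} \<in> sets M"
    by (elim exE conjE)
  have \<Psi>: "\<And>w. w \<in> space M \<Longrightarrow> \<Psi> w \<noteq> {}"
        "\<And>w. w \<in> space M \<Longrightarrow> \<Psi> w \<subseteq> \<Phi> w"
        "\<And>w x y. w \<in> space M \<Longrightarrow> x \<in> \<Psi> w \<Longrightarrow> y \<in> \<Psi> w \<Longrightarrow> x = y"
    using \<Psi>0 by (blast, blast, blast intro: euclidean_eqI)
  define f where "f w = (SOME x. x \<in> \<Psi> w)" for w
  have f: "f w \<in> \<Psi> w" if "w \<in> space M" for w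
    unfolding f_def using \<Psi>(1)[OF that] by (simp add: some_in_eq)
  have "f \<in> borel_measurable M"
    unfolding borel_def
  proof (rule measurable_measure_of)
    show "f \<in> space M \<rightarrow> UNIV" by simp
    fix U :: "'b set" assume U: "U \<in> {S. open S}"
    have "f -` (- U) \<inter> space M = {w \<in> space M. \<Psi> w \<inter> - U \<noteq> {}}"

    proof (intro set_eqI iffI)
      fix w assume "w \<in> {w \<in> space M. \<Psi> w \<inter> - U \<noteq> {}}"
      then obtain x where "w \<in> space M" "x \<in> \<Psi> w" "x \<notin> U" by blast
      with f[of w] \<Psi>(3)[of w x "f w"] show "w \<in> f -` (- U) \<inter> space M" by simp
    qed (use f in blast)
    then have "f -` (- U) \<inter> space M \<in> sets M" using \<Psi>m[rule_format, of "- U"] U by auto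
    then have "space M - f -` (- U) \<inter> space M \<in> sets M" by auto
    moreover have "space M - f -` (- U) \<inter> space M = f -` U \<inter> space M" by auto
    ultimately show "f -` U \<inter> space M \<in> sets M" by simp
  qed auto
  with f \<Psi>(2) show thesis by (intro that) auto
qed

text \<open>By Fubini, a translation-invariant measure is determined by its value on the symmetric set
  \<open>cball 0 1\<close>, which \<open>f\<close> preserves.\<close>

lemma distr_lborel_isometry:
  fixes f :: "'a::euclidean_space \<Rightarrow> 'a"
  assumes f: "orthogonal_transformation f"
  shows "distr lborel borel f = lborel"
proof -
  have lf: "linear f" using f by (rule orthogonal_transformation_linear)
  then have fm[measurable]: "f \<in> borel_measurable borel"
    by (intro borel_measurable_continuous_onI linear_continuous_on)
       (simp add: linear_conv_bounded_linear)
  have nf: "norm (f x) = norm x" for x using f by (rule orthogonal_transformation_norm)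
  define M where "M = distr lborel borel f"
  have sM[measurable_cong, simp]: "sets M = sets borel" and spM[simp]: "space M = UNIV"
    by (auto simp: M_def)
  have cballM: "emeasure M (cball 0 r) = emeasure lborel (cball 0 r :: 'a set)" for r
  proof -
    have "f -` cball 0 r = cball 0 r" by (auto simp: nf)
    then show ?thesis unfolding M_def by (simp add: emeasure_distr)
  qed
  interpret M: sigma_finite_measure M
  proof
    show "\<exists>A. countable A \<and> A \<subseteq> sets M \<and> \<Union>A = space M \<and> (\<forall>a\<in>A. emeasure M a \<noteq> \<infinity>)"
    proof (intro exI[of _ "range (\<lambda>n::nat. cball 0 (real n))"] conjI)
      show "\<Union>(range (\<lambda>n::nat. cball 0 (real n))) = space M"
        using real_arch_simple by auto
      show "\<forall>a\<in>range (\<lambda>n::nat. cball 0 (real n)). emeasure M a \<noteq> \<infinity>"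
        using emeasure_lborel_cball_finite[of 0] by (auto simp: cballM less_top)
    qed auto
  qed
  interpret pair_sigma_finite M lborel ..
  have transM: "(\<integral>\<^sup>+x. g (x + c) \<partial>M) = (\<integral>\<^sup>+x. g x \<partial>M)" if [measurable]: "g \<in> borel_measurable borel" for g c
  proof -
    obtain c' where c': "f c' = c"
      using orthogonal_transformation_surj[OF f] by (metis surjD)
    have "(\<integral>\<^sup>+x. g (x + c) \<partial>M) = (\<integral>\<^sup>+x. g (f (c' + x)) \<partial>lborel)"
      unfolding M_def by (subst nn_integral_distr) (auto simp: linear_add[OF lf] c' add.commute)
    also have "\<dots> = (\<integral>\<^sup>+x. g (f x) \<partial>distr lborel borel ((+) c'))"
      by (subst nn_integral_distr) auto
    also have "\<dots> = (\<integral>\<^sup>+x. g x \<partial>M)"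
      unfolding lborel_distr_plus M_def by (subst nn_integral_distr) auto
    finally show ?thesis .
  qed
  have transL: "(\<integral>\<^sup>+x. g (x + c) \<partial>lborel) = (\<integral>\<^sup>+x. g x \<partial>lborel)" if [measurable]: "g \<in> borel_measurable borel" for g and c :: 'a
    by (subst (2) lborel_distr_plus[of c, symmetric], subst nn_integral_distr) (auto simp: add.commute)
  let ?b = "indicator (cball (0::'a) 1) :: 'a \<Rightarrow> ennreal"
  have [measurable]: "?b \<in> borel_measurable borel"
    by (intro borel_measurable_indicator borel_closed closed_cball)
  have eq: "emeasure M A * emeasure lborel (cball (0::'a) 1) = emeasure lborel A * emeasure M (cball 0 1)"
    if A[measurable]: "A \<in> sets borel" for A
  proof -
    have "emeasure M A * emeasure lborel (cball (0::'a) 1) =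
        (\<integral>\<^sup>+x. indicator A x * (\<integral>\<^sup>+y. ?b y \<partial>lborel) \<partial>M)"
      by (subst nn_integral_multc) auto
    also have "\<dots> = (\<integral>\<^sup>+x. indicator A x * (\<integral>\<^sup>+y. ?b (y + - x) \<partial>lborel) \<partial>M)"
      by (subst transL) auto
    also have "\<dots> = (\<integral>\<^sup>+x. (\<integral>\<^sup>+y. indicator A x * ?b (y + - x) \<partial>lborel) \<partial>M)"
      by (subst nn_integral_cmult) auto
    also have "\<dots> = (\<integral>\<^sup>+y. (\<integral>\<^sup>+x. indicator A x * ?b (y + - x) \<partial>M) \<partial>lborel)"
      by (rule Fubini'[symmetric]) measurable
    \<comment> \<open>Shifting \<open>x\<close> by \<open>y\<close> separates the variables: the
      argument of \<open>?b\<close> becomes \<open>- x\<close>, which the symmetric ball does not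
      distinguish from \<open>x\<close>, and \<open>y\<close> remains only in the indicator of
      \<open>A\<close>.\<close>
    also have "\<dots> = (\<integral>\<^sup>+y. (\<integral>\<^sup>+x. indicator A (x + y) * ?b (y + - (x + y)) \<partial>M) \<partial>lborel)"
      by (intro nn_integral_cong transM[symmetric]) measurable
    also have "\<dots> = (\<integral>\<^sup>+y. (\<integral>\<^sup>+x. indicator A (x + y) * ?b x \<partial>M) \<partial>lborel)"
      by (intro nn_integral_cong) (auto simp: indicator_def)
    also have "\<dots> = (\<integral>\<^sup>+x. (\<integral>\<^sup>+y. indicator A (x + y) * ?b x \<partial>lborel) \<partial>M)"
      by (rule Fubini') measurable
    also have "\<dots> = (\<integral>\<^sup>+x. (\<integral>\<^sup>+y. indicator A (y + x) \<partial>lborel) * ?b x \<partial>M)"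
      by (subst nn_integral_multc) (auto simp: add.commute)
    also have "\<dots> = (\<integral>\<^sup>+x. emeasure lborel A * ?b x \<partial>M)"
      by (subst transL) auto
    also have "\<dots> = emeasure lborel A * emeasure M (cball 0 1)"
      by (subst nn_integral_cmult) auto
    finally show ?thesis .
  qed
  have pos: "emeasure lborel (cball (0::'a) 1) \<noteq> 0"
  proof -
    have "0 < unit_ball_vol (real DIM('a))" by (rule unit_ball_vol_pos) simp
    then have "unit_ball_vol (real DIM('a)) \<noteq> 0" by linarith
    then show ?thesis by (simp add: emeasure_cball)
  qed
  have fin: "emeasure lborel (cball (0::'a) 1) \<noteq> \<infinity>"
    using emeasure_lborel_cball_finite[of "0::'a" 1] by auto
  show ?thesis unfolding M_def[symmetric]
  proof (rule measure_eqI)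
    fix A assume A: "A \<in> sets M"
    have "emeasure lborel (cball (0::'a) 1) * emeasure M A = emeasure lborel (cball (0::'a) 1) * emeasure lborel A"
      using eq[of A] A by (simp only: cballM sM mult.commute)
    then show "emeasure M A = emeasure lborel A"
      unfolding ennreal_mult_cancel_left using pos fin by simp
  qed simp
qed


text \<open>The continuous bound \<open>c\<close> keeps points chosen in the fibres over a
  convergent sequence bounded, so a subsequence converges, and the closed graph puts its limit into
  the limit fibre.\<close>

lemma closed_graph_fibre_compact:
  fixes \<Phi> :: "'a::euclidean_space \<Rightarrow> 'b::euclidean_space set"
  assumes cl: "closed {(w, x). x \<in> \<Phi> w}"
    and c: "continuous_on UNIV c" "\<forall>w. \<forall>x\<in>\<Phi> w. norm x \<le> c w"
    and K: "closed K"
  shows "compact (\<Phi> w)" "closed {w. \<Phi> w \<inter> K \<noteq> {}}"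
proof -
  have "closed ((\<lambda>x. (w, x)) -` {(w, x). x \<in> \<Phi> w})"
    by (intro closed_vimage cl continuous_intros)
  moreover have "(\<lambda>x. (w, x)) -` {(w, x). x \<in> \<Phi> w} = \<Phi> w" by auto
  ultimately show "compact (\<Phi> w)"
    using c(2) by (auto simp: compact_eq_bounded_closed bounded_iff)
  show "closed {w. \<Phi> w \<inter> K \<noteq> {}}"
  proof (rule closed_sequential_limits[THEN iffD2], intro allI impI, elim conjE)
    fix w l assume w: "\<forall>n. w n \<in> {w. \<Phi> w \<inter> K \<noteq> {}}" and lim: "w \<longlonglongrightarrow> l"
    then have "\<forall>n. \<exists>x. x \<in> \<Phi> (w n) \<and> x \<in> K" by blast
    from choice[OF this] obtain x where x: "\<And>n. x n \<in> \<Phi> (w n)" "\<And>n. x n \<in> K" by blast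
    have "(\<lambda>n. c (w n)) \<longlonglongrightarrow> c l"
      using c(1) lim by (rule continuous_on_tendsto_compose) auto
    then have "Bseq (\<lambda>n. c (w n))" by (intro convergent_imp_Bseq convergentI)
    then obtain B where B: "\<And>n. norm (c (w n)) \<le> B" by (auto simp: Bseq_def)
    have "norm (x n) \<le> B" for n using c(2) x(1)[of n] B[of n] by force
    then have "bounded (range x)" by (auto simp: bounded_iff)
    then obtain y r where r: "strict_mono (r :: nat \<Rightarrow> nat)" and y: "(x \<circ> r) \<longlonglongrightarrow> y"
      using bounded_imp_convergent_subsequence by blast
    have wl: "(w \<circ> r) \<longlonglongrightarrow> l" using lim r by (rule LIMSEQ_subseq_LIMSEQ)
    have lim': "(\<lambda>n. ((w \<circ> r) n, (x \<circ> r) n)) \<longlonglongrightarrow> (l, y)" by (intro tendsto_Pair wl y)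
    have "(l, y) \<in> {(w, x). x \<in> \<Phi> w}"
      by (rule closed_sequentially[OF cl _ lim']) (simp add: x(1))
    moreover have "y \<in> K" by (rule closed_sequentially[OF K _ y]) (simp add: x(2))
    ultimately show "l \<in> {w. \<Phi> w \<inter> K \<noteq> {}}" by auto
  qed
qed

lemma closed_graph_selection:
  fixes \<Phi> :: "'a::euclidean_space \<Rightarrow> 'b::euclidean_space set"
  assumes cl: "closed {(w, x). x \<in> \<Phi> w}"
    and c: "continuous_on UNIV c" "\<forall>w. \<forall>x\<in>\<Phi> w. norm x \<le> c w"
  obtains f where "f \<in> borel_measurable borel" "\<And>w. \<Phi> w \<noteq> {} \<Longrightarrow> f w \<in> \<Phi> w"
proof -
  note * = closed_graph_fibre_compact[OF cl c]
  \<comment> \<open>Selection needs nonempty fibres everywhere. The set of base points where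
    \<open>{0}\<close> is substituted is open, hence Borel.\<close>
  define \<Phi>' where "\<Phi>' w = (if \<Phi> w = {} then {0} else \<Phi> w)" for w
  obtain f where f: "f \<in> borel_measurable borel" "\<And>w. w \<in> space (borel :: 'a measure) \<Longrightarrow> f w \<in> \<Phi>' w"
  proof (rule measurable_selection_compact[of "borel :: 'a measure" \<Phi>'])
    show "compact (\<Phi>' w)" "\<Phi>' w \<noteq> {}" for w using *(1)[of UNIV] by (auto simp: \<Phi>'_def)
    fix K :: "'b set" assume K: "closed K"
    have "{w \<in> space borel. \<Phi>' w \<inter> K \<noteq> {}} =
        {w. \<Phi> w \<inter> K \<noteq> {}} \<union> (if 0 \<in> K then - {w. \<Phi> w \<inter> UNIV \<noteq> {}} else {})"
      by (auto simp: \<Phi>'_def)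
    also have "\<dots> \<in> sets borel" using *(2)[OF K] *(2)[OF closed_UNIV] by auto
    finally show "{w \<in> space borel. \<Phi>' w \<inter> K \<noteq> {}} \<in> sets borel" .
  qed blast
  have "f w \<in> \<Phi> w" if "\<Phi> w \<noteq> {}" for w
    using f(2)[of w] that by (simp add: \<Phi>'_def)
  with f(1) show thesis by (rule that)
qed

section \<open>Borel measurability of matrix operations\<close>

lemma borel_measurable_det [measurable]:
  fixes M :: "'a \<Rightarrow> real ^ 'd ^ 'd"
  assumes [measurable]: "M \<in> borel_measurable N"
  shows "(\<lambda>x. det (M x)) \<in> borel_measurable N"
  unfolding det_def by measurable

lemma borel_measurable_matrix_mult [measurable]:
  fixes A :: "'a \<Rightarrow> real ^ 'n ^ 'm" and B :: "'a \<Rightarrow> real ^ 'k ^ 'n"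
  assumes [measurable]: "A \<in> borel_measurable N" "B \<in> borel_measurable N"
  shows "(\<lambda>x. A x ** B x) \<in> borel_measurable N"
  unfolding matrix_matrix_mult_def
  by (intro borel_measurable_vecI) (simp, measurable)

lemma borel_measurable_matrix_vector_mult [measurable]:
  fixes A :: "'a \<Rightarrow> real ^ 'n ^ 'm" and B :: "'a \<Rightarrow> real ^ 'n"
  assumes [measurable]: "A \<in> borel_measurable N" "B \<in> borel_measurable N"
  shows "(\<lambda>x. A x *v B x) \<in> borel_measurable N"
  unfolding matrix_vector_mult_def
  by (intro borel_measurable_vecI) (simp, measurable)

lemma borel_measurable_transpose [measurable]:
  fixes A :: "'a \<Rightarrow> real ^ 'n ^ 'm"
  assumes [measurable]: "A \<in> borel_measurable N"
  shows "(\<lambda>x. transpose (A x)) \<in> borel_measurable N"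
  unfolding transpose_def
  by (intro borel_measurable_vecI) (simp, measurable)

text \<open>Cramer's rule: the columns of the inverse are quotients of determinants, an expression
  that is Borel on all matrices, singular ones included.\<close>

lemma measurable_right_inverse:
  obtains J :: "real ^ 'd ^ 'd \<Rightarrow> real ^ 'd ^ 'd"
  where "J \<in> borel_measurable borel" "\<And>A. det A \<noteq> 0 \<Longrightarrow> A ** J A = mat 1"
proof
  define J :: "real ^ 'd ^ 'd \<Rightarrow> real ^ 'd ^ 'd"
    where "J A = (\<chi> k j. det (\<chi> i l. if l = k then axis j 1 $ i else A $ i $ l) / det A)" for A
  have [measurable]: "(\<lambda>A :: real ^ 'd ^ 'd. \<chi> i l. if l = k then axis j 1 $ i else A $ i $ l) \<in> borel_measurable borel"
    for k j :: 'd
    by (intro borel_measurable_vecI) (simp, measurable)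
  show "J \<in> borel_measurable borel"
    unfolding J_def by (intro borel_measurable_vecI) (simp, measurable)
  show "A ** J A = mat 1" if "det A \<noteq> 0" for A
  proof -
    have "A *v (\<chi> k. det (\<chi> i l. if l = k then axis j 1 $ i else A $ i $ l) / det A) = axis j 1" for j
      using cramer[OF that] by simp
    then have "column j (A ** J A) = axis j 1" for j
      by (simp add: J_def matrix_matrix_mult_def matrix_vector_mult_def column_def)
    then show ?thesis
      by (simp add: vec_eq_iff column_def mat_def axis_def)
  qed
qed

text \<open>The inner product of matrices is the sum of the inner products of their columns, and
  left multiplication acts on each column separately. Lebesgue measure on matrices is thereby
  invariant under it.\<close>

lemma orthogonal_transformation_matrix_mult:
  fixes B :: "real ^ 'd ^ 'd"
  assumes B: "orthogonal_matrix B"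
  shows "orthogonal_transformation (\<lambda>M :: real ^ 'd ^ 'd. B ** M)"
  unfolding orthogonal_transformation_def
proof (intro conjI allI)
  show "linear (\<lambda>M :: real ^ 'd ^ 'd. B ** M)"
    by (rule linearI) (simp_all add: matrix_add_ldistrib scalar_matrix_assoc
        matrix_scalar_ac flip: scalar_mult_eq_scaleR)
  have col: "v \<bullet> w = (\<Sum>j\<in>UNIV. column j v \<bullet> column j w)" for v w :: "real ^ 'd ^ 'd"
    unfolding inner_vec_def column_def by (simp, rule sum.swap)
  have "column j (B ** v) = B *v column j v" for j and v :: "real ^ 'd ^ 'd"
    by (simp add: matrix_matrix_mult_def matrix_vector_mult_def column_def)
  moreover have "(B *v x) \<bullet> (B *v y) = x \<bullet> y" for x y
    using B orthogonal_transformation_matrix[of "(*v) B"]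
    by (metis matrix_of_matrix_vector_mul matrix_vector_mul_linear orthogonal_transformation_def)
  ultimately show "(B ** v) \<bullet> (B ** w) = v \<bullet> w" for v w :: "real ^ 'd ^ 'd"
    by (simp add: col)
qed

section \<open>Invariant measures on orthogonal matrices and on the sphere\<close>

lemma uniform_measure_invariant:
  fixes f :: "'a::euclidean_space \<Rightarrow> 'a"
  assumes f: "orthogonal_transformation f" and S: "S \<in> sets borel" "f -` S = S"
  shows "distr (uniform_measure lborel S) borel f = uniform_measure lborel S"
proof (rule measure_eqI)
  have fm[measurable]: "f \<in> borel_measurable borel"
    using orthogonal_transformation_linear[OF f]
    by (intro borel_measurable_continuous_onI linear_continuous_on)
       (simp add: linear_conv_bounded_linear)
  fix X assume "X \<in> sets (distr (uniform_measure lborel S) borel f)"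
  then have X[measurable]: "X \<in> sets borel" by simp
  note S(1)[measurable]
  have "emeasure lborel (S \<inter> f -` X) = emeasure (distr lborel borel f) (S \<inter> X)"
    using S(2) by (subst emeasure_distr) (auto simp: vimage_Int)
  also have "\<dots> = emeasure lborel (S \<inter> X)" by (simp add: distr_lborel_isometry[OF f])
  finally show "emeasure (distr (uniform_measure lborel S) borel f) X = emeasure (uniform_measure lborel S) X"
    using measurable_sets[OF fm X]
    by (simp add: emeasure_distr emeasure_uniform_measure)
qed simp

lemma prob_space_uniform_measure_open:
  fixes S :: "'a::euclidean_space set"
  assumes "open S" "bounded S" "S \<noteq> {}"
  shows "prob_space (uniform_measure lborel S)"
proof (rule prob_space_uniform_measure)
  have "\<not> negligible S" using assms open_not_negligible by blast
  then show "emeasure lborel S \<noteq> 0"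
    using assms(1) by (auto simp: negligible_iff_null_sets null_sets_def)
  show "emeasure lborel S \<noteq> \<infinity>"
    using emeasure_bounded_finite[OF assms(2)] by auto
qed

lemma orthogonal_matrix_vector_mult:
  fixes B :: "real ^ 'd ^ 'd"
  assumes B: "orthogonal_matrix B"
  shows "orthogonal_transformation ((*v) B)"
  using B by (simp add: orthogonal_transformation_matrix)

text \<open>Take \<open>M\<close> uniform among the invertible matrices in the unit ball and return \<open>M N\<inverse>\<close>, where
  \<open>N\<close> is a measurable function of \<open>M\<^sup>T M\<close> with \<open>N\<^sup>T N = M\<^sup>T M\<close>. This map commutes with left
  multiplication by orthogonal matrices.\<close>

lemma invariant_orthogonal_matrix_measure:
  obtains \<nu> :: "(real ^ 'd ^ 'd) measure"
  where "prob_space \<nu>" "sets \<nu> = sets borel" "AE A in \<nu>. orthogonal_matrix A"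
    "\<And>B. orthogonal_matrix B \<Longrightarrow> distr \<nu> borel (\<lambda>A. B ** A) = \<nu>"
proof -
  define S where "S = {M :: real ^ 'd ^ 'd. norm M < 1 \<and> det M \<noteq> 0}"
  have cdet: "continuous_on UNIV (det :: real ^ 'd ^ 'd \<Rightarrow> real)"
    unfolding det_def by (intro continuous_intros)
  have "open {M :: real ^ 'd ^ 'd. norm M < 1}" "open {M :: real ^ 'd ^ 'd. det M \<noteq> 0}"
    using cdet by (auto intro!: open_Collect_less open_Collect_neq continuous_intros)
  then have oS: "open S" unfolding S_def Collect_conj_eq by (rule open_Int)
  have bS: "bounded S" by (auto simp: S_def bounded_iff intro!: exI[of _ 1])
  \<comment> \<open>This scaling puts a multiple of the identity into the unit ball; it serves to
    show that \<open>S\<close> is nonempty.\<close>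
  define c where "c = 1 / (2 * (1 + norm (mat 1 :: real ^ 'd ^ 'd)))"
  have c: "c > 0" by (auto simp: c_def divide_simps add_pos_nonneg)
  have "det (c *\<^sub>R mat 1 :: real ^ 'd ^ 'd) = c ^ CARD('d)"
    by (subst det_diagonal) (auto simp: mat_def)
  moreover have "norm (c *\<^sub>R mat 1 :: real ^ 'd ^ 'd) < 1"
    by (simp add: c_def divide_simps) (use norm_ge_zero[of "mat 1 :: real ^ 'd ^ 'd"] in linarith)
  ultimately have neS: "c *\<^sub>R mat 1 \<in> S" using c by (auto simp: S_def)
  define U where "U = uniform_measure lborel S"
  interpret U: prob_space U unfolding U_def
    using oS bS neS by (intro prob_space_uniform_measure_open) auto
  have sU[measurable_cong, simp]: "sets U = sets borel" by (simp add: U_def)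
  define \<Phi> where "\<Phi> G = {N :: real ^ 'd ^ 'd. transpose N ** N = G}" for G
  obtain f where f[measurable]: "f \<in> borel_measurable borel" and f\<Phi>: "\<And>G. \<Phi> G \<noteq> {} \<Longrightarrow> f G \<in> \<Phi> G"
  \<comment> \<open>\<open>G $ j $ j\<close> is the squared length of column \<open>j\<close> of
    \<open>N\<close>, so its root bounds the entries of that column.\<close>
  proof (rule closed_graph_selection[of \<Phi> "\<lambda>G. \<Sum>i\<in>UNIV. \<Sum>j\<in>UNIV. sqrt \<bar>G $ j $ j\<bar>"])
    have ct: "continuous_on UNIV (\<lambda>p. transpose (snd p) ** snd p :: real ^ 'd ^ 'd)"
      unfolding matrix_matrix_mult_def transpose_def by (intro continuous_intros)
    have "closed {p :: (real ^ 'd ^ 'd) \<times> (real ^ 'd ^ 'd). transpose (snd p) ** snd p = fst p}"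
      by (intro closed_Collect_eq ct continuous_intros)
    then show "closed {(G, N). N \<in> \<Phi> G}" by (simp add: \<Phi>_def case_prod_beta')
    show "continuous_on UNIV (\<lambda>G :: real ^ 'd ^ 'd. \<Sum>i\<in>(UNIV :: 'd set). \<Sum>j\<in>UNIV. sqrt \<bar>G $ j $ j\<bar>)"
      by (intro continuous_intros)
    show "\<forall>G. \<forall>N\<in>\<Phi> G. norm N \<le> (\<Sum>i\<in>(UNIV :: 'd set). \<Sum>j\<in>UNIV. sqrt \<bar>G $ j $ j\<bar>)"
    proof (intro allI ballI)
      fix G N assume "N \<in> \<Phi> G"
      then have "G $ j $ j = (\<Sum>i\<in>UNIV. (N $ i $ j)\<^sup>2)" for j
        by (auto simp: \<Phi>_def matrix_matrix_mult_def transpose_def power2_eq_square)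
      then have *: "\<bar>N $ i $ j\<bar> \<le> sqrt \<bar>G $ j $ j\<bar>" for i j
        by (auto intro!: real_le_rsqrt member_le_sum abs_ge_self[THEN order_trans[rotated]] simp: power2_abs)
      have "norm N \<le> (\<Sum>i\<in>UNIV. norm (N $ i))" by (simp add: norm_le_l1_cart norm_vec_def L2_set_le_sum)
      also have "\<dots> \<le> (\<Sum>i\<in>UNIV. \<Sum>j\<in>UNIV. \<bar>N $ i $ j\<bar>)" by (intro sum_mono norm_le_l1_cart)
      also have "\<dots> \<le> (\<Sum>i\<in>(UNIV :: 'd set). \<Sum>j\<in>UNIV. sqrt \<bar>G $ j $ j\<bar>)" by (intro sum_mono *)
      finally show "norm N \<le> \<dots>" .
    qed
  qed blast
  obtain J where J[measurable]: "J \<in> borel_measurable borel"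
    and AJ: "\<And>A :: real ^ 'd ^ 'd. det A \<noteq> 0 \<Longrightarrow> A ** J A = mat 1"
    using measurable_right_inverse by blast
  define Q where "Q M = M ** J (f (transpose M ** M))" for M :: "real ^ 'd ^ 'd"
  have Qm[measurable]: "Q \<in> borel_measurable borel" unfolding Q_def by measurable
  have orthQ: "orthogonal_matrix (Q M)" if "det M \<noteq> 0" for M
  proof -
    define N where "N = f (transpose M ** M)"
    have N: "transpose N ** N = transpose M ** M"
      using f\<Phi>[of "transpose M ** M"] by (auto simp: \<Phi>_def N_def)
    then have "det N * det N = det M * det M" by (metis det_mul det_transpose)
    with that have "det N \<noteq> 0" by auto
    then have NJ: "N ** J N = mat 1" by (rule AJ)
    have "transpose (Q M) ** Q M = transpose (J N) ** (transpose M ** M) ** J N"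
      by (simp add: Q_def N_def matrix_transpose_mul matrix_mul_assoc)
    also have "\<dots> = transpose (N ** J N) ** (N ** J N)"
      unfolding N[symmetric] by (simp add: matrix_transpose_mul matrix_mul_assoc)
    finally show ?thesis unfolding NJ by (simp add: orthogonal_matrix transpose_mat)
  qed
  have QB: "Q (B ** M) = B ** Q M" if "orthogonal_matrix B" for B M
  proof -
    have "transpose (B ** M) ** (B ** M) = transpose M ** (transpose B ** B) ** M"
      by (simp add: matrix_transpose_mul matrix_mul_assoc)
    also have "\<dots> = transpose M ** M" using that by (simp add: orthogonal_matrix)
    finally show ?thesis by (simp add: Q_def matrix_mul_assoc)
  qed
  have Um[measurable]: "(\<lambda>M. B ** M) \<in> borel_measurable borel" for B :: "real ^ 'd ^ 'd" by measurable
  have UB: "distr U borel (\<lambda>M. B ** M) = U" if B: "orthogonal_matrix B" for B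
    unfolding U_def
  proof (rule uniform_measure_invariant[OF orthogonal_transformation_matrix_mult[OF B]])
    show "S \<in> sets borel" using oS by simp
    have "det B \<noteq> 0" using det_orthogonal_matrix[OF B] by auto
    then show "(\<lambda>M. B ** M) -` S = S"
      using orthogonal_transformation_norm[OF orthogonal_transformation_matrix_mult[OF B]]
      by (auto simp: S_def det_mul)
  qed
  show thesis
  proof (rule that[of "distr U borel Q"])
    show "prob_space (distr U borel Q)" by (rule U.prob_space_distr) simp
    have "AE M in U. orthogonal_matrix (Q M)"
      unfolding U_def using oS by (intro AE_uniform_measureI) (auto simp: S_def intro!: orthQ)
    then have "AE M in U. Q M \<in> {A. orthogonal_matrix A}" by simp
    moreover have "{A :: real ^ 'd ^ 'd. orthogonal_matrix A} \<in> sets borel"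
    proof -
      have "{A \<in> space borel. transpose A ** A = (mat 1 :: real ^ 'd ^ 'd)} \<in> sets borel" by measurable
      then show ?thesis by (simp add: orthogonal_matrix)
    qed
    ultimately show "AE A in distr U borel Q. orthogonal_matrix A"
      by (subst AE_distr_iff) auto
    fix B :: "real ^ 'd ^ 'd" assume B: "orthogonal_matrix B"
    have "distr (distr U borel Q) borel (\<lambda>A. B ** A) = distr U borel (\<lambda>M. Q (B ** M))"
      by (subst distr_distr) (auto simp: comp_def QB[OF B])
    also have "\<dots> = distr (distr U borel (\<lambda>M. B ** M)) borel Q"
      by (subst distr_distr) (auto simp: comp_def)
    finally show "distr (distr U borel Q) borel (\<lambda>A. B ** A) = distr U borel Q"
      by (simp add: UB[OF B])
  qed simp
qed

lemma uniform_sphere_props: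
  shows "prob_space (uniform_sphere :: (real ^ 'd) measure)"
    and "sets (uniform_sphere :: (real ^ 'd) measure) = sets borel"
    and "AE x in (uniform_sphere :: (real ^ 'd) measure). norm x = 1"
    and "\<And>B :: real ^ 'd ^ 'd. orthogonal_matrix B \<Longrightarrow> distr uniform_sphere borel ((*v) B) = uniform_sphere"
proof -
  let ?U = "uniform_measure lborel (ball 0 1) :: (real ^ 'd) measure"
  let ?n = "\<lambda>x :: real ^ 'd. x /\<^sub>R norm x"
  interpret U: prob_space ?U by (intro prob_space_uniform_measure_open) auto
  show "prob_space (uniform_sphere :: (real ^ 'd) measure)"
    unfolding uniform_sphere_def by (intro U.prob_space_distr) measurable
  show "sets (uniform_sphere :: (real ^ 'd) measure) = sets borel" by (simp add: uniform_sphere_def)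
  have "AE x in lborel. x \<noteq> (0 :: real ^ 'd)" by (rule AE_lborel_singleton)
  then have "AE x in ?U. x \<noteq> 0" by (intro AE_uniform_measureI) auto
  then have "AE x in ?U. norm (?n x) = 1" by eventually_elim simp
  then show "AE x in (uniform_sphere :: (real ^ 'd) measure). norm x = 1"
    unfolding uniform_sphere_def by (subst AE_distr_iff) auto
  fix B :: "real ^ 'd ^ 'd" assume B: "orthogonal_matrix B"
  note oB = orthogonal_matrix_vector_mult[OF B]
  have [measurable]: "(*v) B \<in> borel_measurable borel" by measurable
  have "distr uniform_sphere borel ((*v) B) = distr ?U borel (\<lambda>x. B *v ?n x)"
    unfolding uniform_sphere_def by (subst distr_distr) (auto simp: comp_def)
  also have "(\<lambda>x. B *v ?n x) = (\<lambda>x. ?n (B *v x))"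
    using orthogonal_transformation_norm[OF oB] by (simp add: matrix_vector_mult_scaleR)
  also have "distr ?U borel \<dots> = distr (distr ?U borel ((*v) B)) borel ?n"
    by (subst distr_distr) (auto simp: comp_def)
  also have "distr ?U borel ((*v) B) = ?U"
    using orthogonal_transformation_norm[OF oB]
    by (intro uniform_measure_invariant[OF oB]) auto
  finally show "distr uniform_sphere borel ((*v) B) = uniform_sphere"
    by (simp add: uniform_sphere_def)
qed

text \<open>For fixed \<open>X\<close>, the probability that \<open>A\<^sup>T x \<in> X\<close> does not depend on the unit vector \<open>x\<close>, and
  it averages to the measure of \<open>X\<close>.\<close>

lemma invariant_measure_sphere_unique:
  fixes \<nu> :: "(real ^ 'd ^ 'd) measure" and \<sigma> \<tau> :: "(real ^ 'd) measure"
  assumes \<nu>: "prob_space \<nu>" "sets \<nu> = sets borel" "AE A in \<nu>. orthogonal_matrix A"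
    "\<And>B. orthogonal_matrix B \<Longrightarrow> distr \<nu> borel (\<lambda>A. B ** A) = \<nu>"
    and \<sigma>: "prob_space \<sigma>" "sets \<sigma> = sets borel" "AE x in \<sigma>. norm x = 1"
      "\<And>B. orthogonal_matrix B \<Longrightarrow> distr \<sigma> borel ((*v) B) = \<sigma>"
    and \<tau>: "prob_space \<tau>" "sets \<tau> = sets borel" "AE x in \<tau>. norm x = 1"
      "\<And>B. orthogonal_matrix B \<Longrightarrow> distr \<tau> borel ((*v) B) = \<tau>"
  shows "\<sigma> = \<tau>"
proof (rule measure_eqI)
  fix X assume "X \<in> sets \<sigma>"
  then have X[measurable]: "X \<in> sets borel" by (simp add: \<sigma>)
  define F where "F x = (\<integral>\<^sup>+A. indicator X (transpose A *v x) \<partial>\<nu>)" for x :: "real ^ 'd"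
  have inv: "F (B *v x) = F x" if B: "orthogonal_matrix B" for B x
  proof -
    have B': "orthogonal_matrix (transpose B)" using B by (simp add: orthogonal_matrix_transpose)
    note \<nu>(2)[measurable_cong]
    have "F (B *v x) = (\<integral>\<^sup>+A. indicator X (transpose (transpose B ** A) *v x) \<partial>\<nu>)"
      unfolding F_def by (simp add: matrix_transpose_mul matrix_vector_mul_assoc)
    also have "\<dots> = (\<integral>\<^sup>+A. indicator X (transpose A *v x) \<partial>distr \<nu> borel (\<lambda>A. transpose B ** A))"
      by (subst nn_integral_distr) (auto simp del: transpose_matrix_vector)
    finally show ?thesis by (simp add: \<nu>(4)[OF B'] F_def)
  qed
  have Fc: "F x = F (axis undefined 1)" if x: "norm x = 1" for x
  proof -
    have "norm (axis undefined 1 :: real ^ 'd) = norm x" using x by simp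
    from orthogonal_transformation_exists[OF this]
    obtain f :: "real ^ 'd \<Rightarrow> real ^ 'd" where f: "orthogonal_transformation f" "f (axis undefined 1) = x" .
    then have "orthogonal_matrix (matrix f)" "matrix f *v axis undefined 1 = x"
      using orthogonal_transformation_matrix[of f] matrix_works[of f "axis undefined 1"]
      by (auto simp: orthogonal_transformation_linear linear_matrix_vector_mul_eq)
    with inv show ?thesis by metis
  qed
  have *: "emeasure \<sigma> X = F (axis undefined 1)"
    if \<sigma>: "prob_space \<sigma>" "sets \<sigma> = sets borel" "AE x in \<sigma>. norm x = 1"
      "\<And>B. orthogonal_matrix B \<Longrightarrow> distr \<sigma> borel ((*v) B) = \<sigma>" for \<sigma> :: "(real ^ 'd) measure"
  proof -
    interpret \<nu>: prob_space \<nu> by fact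
    interpret \<sigma>: prob_space \<sigma> by fact
    interpret pair_sigma_finite \<nu> \<sigma> ..
    note \<sigma>(2)[measurable_cong] \<nu>(2)[measurable_cong]
    have inner: "(\<integral>\<^sup>+x. indicator X (transpose A *v x) \<partial>\<sigma>) = emeasure \<sigma> X" if A: "orthogonal_matrix A" for A
    proof -
      have A': "orthogonal_matrix (transpose A)" using A by (simp add: orthogonal_matrix_transpose)
      have "(\<integral>\<^sup>+x. indicator X (transpose A *v x) \<partial>\<sigma>) = (\<integral>\<^sup>+x. indicator X x \<partial>distr \<sigma> borel ((*v) (transpose A)))"
        by (subst nn_integral_distr) auto
      then show ?thesis by (simp add: \<sigma>(4)[OF A'])
    qed
    have "emeasure \<sigma> X = (\<integral>\<^sup>+A. emeasure \<sigma> X \<partial>\<nu>)" by (simp add: \<nu>.emeasure_space_1)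
    also have "\<dots> = (\<integral>\<^sup>+A. \<integral>\<^sup>+x. indicator X (transpose A *v x) \<partial>\<sigma> \<partial>\<nu>)"
      using \<nu>(3) by (intro nn_integral_cong_AE, eventually_elim) (simp only: inner)
    also have "\<dots> = (\<integral>\<^sup>+x. F x \<partial>\<sigma>)" unfolding F_def by (rule Fubini'[symmetric]) measurable
    also have "\<dots> = (\<integral>\<^sup>+x. F (axis undefined 1) \<partial>\<sigma>)"
      using \<sigma>(3) by (intro nn_integral_cong_AE) (auto intro: Fc)
    also have "\<dots> = F (axis undefined 1)" by (simp add: \<sigma>.emeasure_space_1)
    finally show ?thesis .
  qed
  show "emeasure \<sigma> X = emeasure \<tau> X" by (simp only: *[OF \<sigma>] *[OF \<tau>])
qed (simp add: \<sigma> \<tau>)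

text \<open>The law of a randomly rotated unit vector does not depend on the vector. Rotating all
  points of a configuration by the same matrix therefore makes each single point uniform in
  direction, however the points are correlated.\<close>

lemma distr_invariant_unit_vector:
  fixes \<nu> :: "(real ^ 'd ^ 'd) measure" and e :: "real ^ 'd"
  assumes \<nu>: "prob_space \<nu>" "sets \<nu> = sets borel" "AE A in \<nu>. orthogonal_matrix A"
    "\<And>B. orthogonal_matrix B \<Longrightarrow> distr \<nu> borel (\<lambda>A. B ** A) = \<nu>"
    and e: "norm e = 1"
  shows "distr \<nu> borel (\<lambda>A. A *v e) = uniform_sphere"
proof (rule invariant_measure_sphere_unique[OF \<nu>])
  interpret prob_space \<nu> by fact
  note \<nu>(2)[measurable_cong]
  show "prob_space (distr \<nu> borel (\<lambda>A. A *v e))" by (rule prob_space_distr) measurable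
  show "AE x in distr \<nu> borel (\<lambda>A. A *v e). norm x = 1"
  proof (subst AE_distr_iff)
    show "AE A in \<nu>. norm (A *v e) = 1"
      using \<nu>(3)
      by eventually_elim (simp add: e orthogonal_transformation_norm[OF orthogonal_matrix_vector_mult])
  qed auto
  fix B :: "real ^ 'd ^ 'd" assume B: "orthogonal_matrix B"
  have "distr (distr \<nu> borel (\<lambda>A. A *v e)) borel ((*v) B) = distr \<nu> borel (\<lambda>A. (B ** A) *v e)"
    by (subst distr_distr) (auto simp: comp_def matrix_vector_mul_assoc)
  also have "\<dots> = distr (distr \<nu> borel (\<lambda>A. B ** A)) borel (\<lambda>A. A *v e)"
    by (subst distr_distr) (auto simp: comp_def)
  finally show "distr (distr \<nu> borel (\<lambda>A. A *v e)) borel ((*v) B) = distr \<nu> borel (\<lambda>A. A *v e)"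
    by (simp add: \<nu>(4)[OF B])
qed (use uniform_sphere_props in auto)

section \<open>The Coulomb cost\<close>

text \<open>Zeros of \<open>f\<close> do no harm, since the quotient is \<open>top\<close> there and
  tends to \<open>top\<close> nearby. The cost is thus continuous on all configurations, including
  those with coinciding points.\<close>

lemma continuous_on_inverse_ennreal_real:
  fixes f :: "'a::topological_space \<Rightarrow> real"
  assumes f: "continuous_on S f" and nonneg: "\<And>x. x \<in> S \<Longrightarrow> 0 \<le> f x"
  shows "continuous_on S (\<lambda>x. 1 / ennreal (f x))"
  unfolding continuous_on_def
proof
  fix x assume x: "x \<in> S"
  have lim: "(f \<longlongrightarrow> f x) (at x within S)" using f x by (simp add: continuous_on_def)
  have inS: "eventually (\<lambda>y. y \<in> S) (at x within S)" by (simp add: eventually_at_topological, blast)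
  show "((\<lambda>y. 1 / ennreal (f y)) \<longlongrightarrow> 1 / ennreal (f x)) (at x within S)"
  proof (cases "f x = 0")
    case True
    have "((\<lambda>y. 1 / ennreal (f y)) \<longlongrightarrow> top) (at x within S)"
      unfolding tendsto_top_iff_ennreal
    proof (intro allI impI)
      fix l :: real assume l: "0 \<le> l"
      have "eventually (\<lambda>y. f y < 1 / (l + 1)) (at x within S)"
        using lim l unfolding True by (intro order_tendstoD) auto
      then show "eventually (\<lambda>y. ennreal l < 1 / ennreal (f y)) (at x within S)"
        using inS
      proof eventually_elim
        case (elim y)
        show ?case
        proof (cases "f y = 0")
          case False
          with nonneg elim(2) have "f y > 0" by force
          moreover from this elim(1) l have "l < 1 / f y" by (simp add: field_simps add_pos_nonneg)
          ultimately show ?thesis using l divide_ennreal[of 1 "f y"] by (simp add: ennreal_less_iff)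
        qed simp
      qed
    qed
    with True show ?thesis by simp
  next
    case False
    with nonneg[OF x] have pos: "0 < f x" by simp
    have eq: "ennreal (1 / t) = 1 / ennreal t" if "0 < t" for t
      using divide_ennreal[of 1 t] that by simp
    have "eventually (\<lambda>y. 0 < f y) (at x within S)" using lim pos by (rule order_tendstoD)
    then have "eventually (\<lambda>y. ennreal (1 / f y) = 1 / ennreal (f y)) (at x within S)"
      by eventually_elim (rule eq)
    moreover have "((\<lambda>y. ennreal (1 / f y)) \<longlongrightarrow> ennreal (1 / f x)) (at x within S)"
      using pos by (intro tendsto_ennrealI tendsto_intros lim) auto
    ultimately show ?thesis by (simp add: eq[OF pos] tendsto_cong)
  qed
qed

lemma continuous_on_coulomb_cost: "continuous_on S (coulomb_cost :: (real ^ 'd) ^ 'n \<Rightarrow> ennreal)"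
  unfolding coulomb_cost_def case_prod_beta'
  by (intro continuous_on_sum continuous_on_inverse_ennreal_real continuous_intros) auto

lemma borel_measurable_coulomb_cost [measurable]: "coulomb_cost \<in> borel_measurable borel"
  by (intro borel_measurable_continuous_onI continuous_on_coulomb_cost)

lemma coulomb_cost_orthogonal:
  assumes "orthogonal_matrix A"
  shows "coulomb_cost (\<chi> i. A *v x $ i) = coulomb_cost x"
  using orthogonal_transformation_norm[OF orthogonal_matrix_vector_mult[OF assms]]
  by (simp add: coulomb_cost_def flip: matrix_vector_mult_diff_distrib)

lemma reduced_cost_le:
  fixes x :: "(real ^ 'd) ^ 'n"
  assumes "\<And>i. norm (x $ i) = r $ i"
  shows "reduced_cost TYPE('d) r \<le> coulomb_cost x"
  unfolding reduced_cost_def using assms by (intro INF_lower) auto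

lemma attains_reduced_costI:
  fixes x :: "(real ^ 'd) ^ 'n"
  assumes "\<And>i. norm (x $ i) = r $ i"
    and "\<And>y :: (real ^ 'd) ^ 'n. (\<And>i. norm (y $ i) = r $ i) \<Longrightarrow> coulomb_cost x \<le> coulomb_cost y"
  shows "attains_reduced_cost r x"
proof -
  have "coulomb_cost x \<le> reduced_cost TYPE('d) r"
    unfolding reduced_cost_def using assms(2) by (intro INF_greatest) auto
  with reduced_cost_le[OF assms(1)] assms(1) show ?thesis
    by (auto simp: attains_reduced_cost_def intro: antisym)
qed

lemma attains_reduced_cost_exists:
  fixes r :: "real ^ 'n"
  assumes "\<And>i. 0 \<le> r $ i"
  shows "\<exists>x :: (real ^ 'd) ^ 'n. attains_reduced_cost r x"
proof -
  let ?S = "{x :: (real ^ 'd) ^ 'n. \<forall>i. norm (x $ i) = r $ i}"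
  have "closed ?S" by (intro closed_Collect_all closed_Collect_eq continuous_intros)
  moreover have "norm x \<le> norm r" if "x \<in> ?S" for x
    using that by (auto simp: norm_vec_def L2_set_def)
  ultimately have "compact ?S" by (auto simp: compact_eq_bounded_closed bounded_iff)
  moreover have "(\<chi> i. r $ i *\<^sub>R axis undefined 1) \<in> ?S" using assms by simp
  then have "?S \<noteq> {}" by blast
  ultimately have "\<exists>x\<in>?S. \<forall>y\<in>?S. coulomb_cost x \<le> coulomb_cost y"
    by (intro continuous_attains_inf continuous_on_coulomb_cost)
  then obtain x where "x \<in> ?S" "\<forall>y\<in>?S. coulomb_cost x \<le> coulomb_cost y" by (rule bexE)
  then show ?thesis by (intro exI[of _ x] attains_reduced_costI) auto
qed

lemma attains_reduced_cost_norm_le: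
  "attains_reduced_cost r x \<Longrightarrow> norm x \<le> norm r"
  by (auto simp: attains_reduced_cost_def norm_vec_def L2_set_def)

text \<open>A competitor over the limit radii keeps its directions and is rescaled to the radii
  \<open>r n\<close>; comparing costs there and passing to the limit uses continuity of the
  cost.\<close>

lemma closed_attains_reduced_cost:
  "closed {(r :: real ^ 'n, x :: (real ^ 'd) ^ 'n). attains_reduced_cost r x}"
proof (rule closed_sequential_limits[THEN iffD2], intro allI impI, elim conjE)
  fix p :: "nat \<Rightarrow> (real ^ 'n) \<times> ((real ^ 'd) ^ 'n)" and l
  assume p: "\<forall>n. p n \<in> {(r, x). attains_reduced_cost r x}" and lim: "p \<longlonglongrightarrow> l"
  define r x where "r n = fst (p n)" and "x n = snd (p n)" for n
  obtain r0 x0 where l: "l = (r0, x0)" by force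
  have r: "r \<longlonglongrightarrow> r0" and x: "x \<longlonglongrightarrow> x0"
    using tendsto_fst[OF lim] tendsto_snd[OF lim] by (simp_all add: r_def[abs_def] x_def[abs_def] l)
  have att: "attains_reduced_cost (r n) (x n)" for n
    using p by (auto simp: r_def x_def split: prod.splits)
  have nx: "norm (x n $ i) = r n $ i" for n i
    using att[of n] by (simp add: attains_reduced_cost_def)
  have nx0: "norm (x0 $ i) = r0 $ i" for i
  proof (rule LIMSEQ_unique)
    show "(\<lambda>n. norm (x n $ i)) \<longlonglongrightarrow> norm (x0 $ i)" by (intro tendsto_intros x)
    show "(\<lambda>n. norm (x n $ i)) \<longlonglongrightarrow> r0 $ i" unfolding nx by (intro tendsto_intros r)
  qed
  have r_nonneg: "0 \<le> r n $ i" for n i using nx[of n i] norm_ge_zero by metis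
  have "attains_reduced_cost r0 x0"
  proof (rule attains_reduced_costI[OF nx0])
    fix y :: "(real ^ 'd) ^ 'n" assume y: "\<And>i. norm (y $ i) = r0 $ i"
    \<comment> \<open>Where \<open>y $ i\<close> vanishes any direction will do, but one is needed:
      \<open>r n $ i\<close> may be positive although its limit is \<open>0\<close>.\<close>
    define u where "u i = (if y $ i = 0 then axis undefined 1 else y $ i /\<^sub>R norm (y $ i))" for i
    have u: "norm (u i) = 1" "r0 $ i *\<^sub>R u i = y $ i" for i
      unfolding y[of i, symmetric] by (auto simp: u_def)
    define z where "z n = (\<chi> i. r n $ i *\<^sub>R u i)" for n
    have "z \<longlonglongrightarrow> (\<chi> i. r0 $ i *\<^sub>R u i)"
      unfolding z_def by (intro tendsto_intros r)
    then have z: "z \<longlonglongrightarrow> y" using u(2) by (simp add: vec_nth_inverse)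
    have le: "coulomb_cost (x n) \<le> coulomb_cost (z n)" for n
    proof -
      have "reduced_cost TYPE('d) (r n) \<le> coulomb_cost (z n)"
        by (rule reduced_cost_le) (simp add: z_def u(1) r_nonneg)
      with att[of n] show ?thesis by (simp add: attains_reduced_cost_def)
    qed
    have cont: "(\<lambda>n. coulomb_cost (f n)) \<longlonglongrightarrow> coulomb_cost a" if "f \<longlonglongrightarrow> a"
      for f and a :: "(real ^ 'd) ^ 'n"
      using continuous_on_tendsto_compose[OF continuous_on_coulomb_cost[of UNIV] that] by simp
    show "coulomb_cost x0 \<le> coulomb_cost y"
      by (rule LIMSEQ_le[OF cont[OF x] cont[OF z]]) (use le in auto)
  qed
  then show "l \<in> {(r, x). attains_reduced_cost r x}" by (simp add: l)
qed

lemma attains_reduced_cost_selection: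
  obtains f :: "real ^ 'n \<Rightarrow> (real ^ 'd) ^ 'n"
  where "f \<in> borel_measurable borel" "\<And>r. (\<And>i. 0 \<le> r $ i) \<Longrightarrow> attains_reduced_cost r (f r)"
proof -
  define \<Phi> where "\<Phi> r = {x :: (real ^ 'd) ^ 'n. attains_reduced_cost r x}" for r
  have "closed {(r, x). x \<in> \<Phi> r}" using closed_attains_reduced_cost by (simp add: \<Phi>_def)
  moreover have "continuous_on UNIV (norm :: real ^ 'n \<Rightarrow> real)" by (intro continuous_intros)
  moreover have "\<forall>r. \<forall>x \<in> \<Phi> r. norm x \<le> norm r"
    by (auto simp: \<Phi>_def intro: attains_reduced_cost_norm_le)
  ultimately obtain f where f: "f \<in> borel_measurable borel" "\<And>r. \<Phi> r \<noteq> {} \<Longrightarrow> f r \<in> \<Phi> r"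
    by (rule closed_graph_selection) blast
  show thesis
  proof (rule that[OF f(1)])
    fix r :: "real ^ 'n" assume "\<And>i. 0 \<le> r $ i"
    from attains_reduced_cost_exists[OF this, where 'd='d] f(2)[of r]
    show "attains_reduced_cost r (f r)" by (auto simp: \<Phi>_def)
  qed
qed

text \<open>The infimum runs over an uncountable set that varies with \<open>r\<close>; a measurable
  selection of optimizers evaluates it. If some radius is negative, the set is empty and the infimum
  is \<open>top\<close>.\<close>

lemma reduced_cost_measurable [measurable]:
  "reduced_cost TYPE('d::finite) \<in> borel_measurable (borel :: (real ^ 'n) measure)"
proof -
  obtain f :: "real ^ 'n \<Rightarrow> (real ^ 'd) ^ 'n" where f[measurable]: "f \<in> borel_measurable borel"
    and att: "\<And>r. (\<And>i. 0 \<le> r $ i) \<Longrightarrow> attains_reduced_cost r (f r)"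
    using attains_reduced_cost_selection by blast
  have "reduced_cost TYPE('d) = (\<lambda>r :: real ^ 'n. if \<forall>i. 0 \<le> r $ i then coulomb_cost (f r) else top)"
  proof
    fix r :: "real ^ 'n"
    have "{x :: (real ^ 'd) ^ 'n. \<forall>i. norm (x $ i) = r $ i} = {}" if "\<not> (\<forall>i. 0 \<le> r $ i)"
    proof -
      from that obtain i where "r $ i < 0" by (auto simp: not_le)
      then have "norm (x $ i) \<noteq> r $ i" for x :: "(real ^ 'd) ^ 'n"
        using norm_ge_zero[of "x $ i"] by linarith
      then show ?thesis by blast
    qed
    then show "reduced_cost TYPE('d) r = (if \<forall>i. 0 \<le> r $ i then coulomb_cost (f r) else top)"
      using att[of r] by (auto simp: attains_reduced_cost_def reduced_cost_def)
  qed
  then show ?thesis by simp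
qed

section \<open>Supports of Borel measures\<close>

lemma closed_measure_support: "closed (measure_support M)"
proof -
  have "- measure_support M = \<Union>{U. open U \<and> emeasure M U = 0}"
    by (auto simp: measure_support_def)
  then have "open (- measure_support M)" by (simp add: open_Union)
  then show ?thesis by (simp add: closed_def)
qed

lemma measure_support_compl_null:
  fixes M :: "'a::second_countable_topology measure"
  assumes "sets M = sets borel"
  shows "emeasure M (- measure_support M) = 0"
proof -
  obtain \<F> where \<F>: "\<F> \<subseteq> {U. open U \<and> emeasure M U = 0}" "countable \<F>"
      "\<Union>\<F> = \<Union>{U. open U \<and> emeasure M U = 0}"
    using Lindelof[of "{U. open U \<and> emeasure M U = 0}"] by blast
  have "- measure_support M = \<Union>\<F>"
    unfolding \<F>(3) by (auto simp: measure_support_def)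
  moreover have "(\<Union>U\<in>\<F>. U) \<in> null_sets M"
  proof (intro null_sets_UN' \<F>(2))
    fix U assume "U \<in> \<F>"
    with \<F>(1) show "U \<in> null_sets M" using assms by (intro null_setsI) auto
  qed
  ultimately show ?thesis by auto
qed

lemma measure_support_invariant:
  assumes M: "sets M = sets borel" "distr M borel g = M" and g: "continuous_on UNIV g" and x: "x \<in> measure_support M"
  shows "g x \<in> measure_support M"
  unfolding measure_support_def
proof (intro CollectI allI impI)
  fix U assume U: "open U" "g x \<in> U"
  have gm: "g \<in> borel_measurable M"
    using borel_measurable_continuous_onI[OF g] M(1) by (simp cong: measurable_cong_sets)
  have sp: "space M = UNIV" using sets_eq_imp_space_eq[OF M(1)] by simp
  have "open (g -` U)" using open_vimage[OF U(1) g] .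
  then have "0 < emeasure M (g -` U)" using x U(2) by (auto simp: measure_support_def)
  also have "emeasure M (g -` U) = emeasure (distr M borel g) U"
    using U(1) gm sp by (subst emeasure_distr) auto
  finally show "0 < emeasure M U" using M(2) by simp
qed

section \<open>Rotation-invariant optimal plans\<close>

lemma sets_radial_marginal [simp, measurable_cong]: "sets (radial_marginal \<rho>) = sets borel"
  by (simp add: radial_marginal_def)

lemma space_radial_marginal [simp]: "space (radial_marginal \<rho>) = UNIV"
  by (simp add: radial_marginal_def)

lemma sets_radial_measure [simp, measurable_cong]: "sets (radial_measure \<rho>) = sets borel"
  by (simp add: radial_measure_def)

lemma space_radial_measure [simp]: "space (radial_measure \<rho>) = UNIV"
  by (simp add: radial_measure_def)

lemma AE_radial_marginal_nonneg:
  assumes [measurable]: "\<rho> \<in> borel_measurable borel"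
  shows "AE r in radial_marginal \<rho>. 0 \<le> r"
  unfolding radial_marginal_def by (subst AE_density) (auto split: split_indicator)

lemma sigma_finite_radial_marginal:
  assumes [measurable]: "\<rho> \<in> borel_measurable borel"
  shows "sigma_finite_measure (radial_marginal \<rho>)"
  unfolding radial_marginal_def
  by (subst sigma_finite_measure.sigma_finite_iff_density_finite[OF sigma_finite_lborel]) (auto split: split_indicator)

lemma emeasure_radial_measure:
  assumes [measurable]: "\<rho> \<in> borel_measurable borel" "X \<in> sets borel"
  shows "emeasure (radial_measure \<rho> :: (real ^ 'd) measure) X =
    (\<integral>\<^sup>+r. \<integral>\<^sup>+\<theta>. indicator X (r *\<^sub>R \<theta>) \<partial>uniform_sphere \<partial>radial_marginal \<rho>)"
proof -
  interpret S: prob_space "uniform_sphere :: (real ^ 'd) measure" by (rule uniform_sphere_props)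
  note uniform_sphere_props(2)[measurable_cong]
  interpret R: sigma_finite_measure "radial_marginal \<rho>" by (rule sigma_finite_radial_marginal) simp
  let ?T = "\<lambda>(r, \<theta>). r *\<^sub>R \<theta> :: real ^ 'd"
  have [measurable]: "?T \<in> borel_measurable (radial_marginal \<rho> \<Otimes>\<^sub>M uniform_sphere)" by measurable
  have "emeasure (radial_measure \<rho> :: (real ^ 'd) measure) X = (\<integral>\<^sup>+x. indicator X x \<partial>radial_measure \<rho>)"
    by simp
  also have "\<dots> = (\<integral>\<^sup>+p. indicator X (?T p) \<partial>(radial_marginal \<rho> \<Otimes>\<^sub>M uniform_sphere))"
    unfolding radial_measure_def by (subst nn_integral_distr) auto
  also have "\<dots> = (\<integral>\<^sup>+r. \<integral>\<^sup>+\<theta>. indicator X (r *\<^sub>R \<theta>) \<partial>uniform_sphere \<partial>radial_marginal \<rho>)"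
    by (subst S.nn_integral_fst[symmetric]) auto
  finally show ?thesis .
qed

lemma prob_space_radial_marginal:
  assumes [measurable]: "\<rho> \<in> borel_measurable borel"
    and "prob_space (radial_measure \<rho> :: (real ^ 'd) measure)"
  shows "prob_space (radial_marginal \<rho>)"
proof
  interpret S: prob_space "uniform_sphere :: (real ^ 'd) measure" by (rule uniform_sphere_props)
  have "emeasure (radial_measure \<rho> :: (real ^ 'd) measure) UNIV = 1"
    using prob_space.emeasure_space_1[OF assms(2)] by simp
  then show "emeasure (radial_marginal \<rho>) (space (radial_marginal \<rho>)) = 1"
    by (subst (asm) emeasure_radial_measure) (auto simp: S.emeasure_space_1)
qed

lemma distr_norm_radial_measure:
  assumes [measurable]: "\<rho> \<in> borel_measurable borel"
  shows "distr (radial_measure \<rho> :: (real ^ 'd) measure) borel norm = radial_marginal \<rho>"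
proof (rule measure_eqI)
  interpret S: prob_space "uniform_sphere :: (real ^ 'd) measure" by (rule uniform_sphere_props)
  fix X assume "X \<in> sets (distr (radial_measure \<rho> :: (real ^ 'd) measure) borel norm)"
  then have X[measurable]: "X \<in> sets borel" by simp
  have inner: "(\<integral>\<^sup>+\<theta>. indicator (norm -` X) (r *\<^sub>R (\<theta> :: real ^ 'd)) \<partial>uniform_sphere) = indicator X r"
    if "0 \<le> r" for r
  proof -
    have "(\<integral>\<^sup>+\<theta>. indicator (norm -` X) (r *\<^sub>R (\<theta> :: real ^ 'd)) \<partial>uniform_sphere) =
        (\<integral>\<^sup>+\<theta>. indicator X r \<partial>(uniform_sphere :: (real ^ 'd) measure))"
      using uniform_sphere_props(3)
      by (intro nn_integral_cong_AE, eventually_elim) (simp add: indicator_def that)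
    then show ?thesis by (simp add: S.emeasure_space_1)
  qed
  have nX: "norm -` X \<in> sets (borel :: (real ^ 'd) measure)"
  proof -
    have "norm \<in> borel_measurable (borel :: (real ^ 'd) measure)" by measurable
    from measurable_sets[OF this X] show ?thesis by simp
  qed
  have "emeasure (distr (radial_measure \<rho> :: (real ^ 'd) measure) borel norm) X =
      emeasure (radial_measure \<rho> :: (real ^ 'd) measure) (norm -` X)"
    by (subst emeasure_distr) auto
  also have "\<dots> = (\<integral>\<^sup>+r. indicator X r \<partial>radial_marginal \<rho>)"
    unfolding emeasure_radial_measure[OF assms nX] using AE_radial_marginal_nonneg[OF assms]
    by (intro nn_integral_cong_AE, eventually_elim) (rule inner)
  also have "\<dots> = emeasure (radial_marginal \<rho>) X" by simp
  finally show "emeasure (distr (radial_measure \<rho> :: (real ^ 'd) measure) borel norm) X = emeasure (radial_marginal \<rho>) X" .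
qed simp

lemma couplingsD:
  assumes "P \<in> couplings \<rho>"
  shows "prob_space P" "sets P = sets borel" "distr P borel (\<lambda>x. x $ i) = \<rho>"
  using assms by (auto simp: couplings_def)

lemma AE_coupling:
  fixes P :: "('a::euclidean_space ^ 'n) measure"
  assumes P: "P \<in> couplings \<mu>" and Q: "AE r in \<mu>. Q r" "Measurable.pred borel Q"
  shows "AE x in P. \<forall>i. Q (x $ i)"
proof -
  have "AE x in P. Q (x $ i)" for i
  proof -
    have "AE r in distr P borel (\<lambda>x. x $ i). Q r" unfolding couplingsD(3)[OF P] by (rule Q(1))
    then show ?thesis
      using Q(2) couplingsD(2)[OF P]
      by (subst (asm) AE_distr_iff) (auto cong: measurable_cong_sets)
  qed
  then show ?thesis by (simp add: AE_all_countable)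
qed

text \<open>One half of the equality of the two minimum values: passing from a plan to its radii
  cannot raise the cost. The other half is the plan built in
  \<open>symmetric_optimal_plan\<close>.\<close>

lemma coupling_norms:
  fixes Q :: "((real ^ 'd) ^ 'n) measure"
  assumes [measurable]: "\<rho> \<in> borel_measurable borel" and Q: "Q \<in> couplings (radial_measure \<rho>)"
  defines "\<gamma> \<equiv> distr Q borel (\<lambda>x. \<chi> i. norm (x $ i))"
  shows "\<gamma> \<in> couplings (radial_marginal \<rho>)"
    and "reduced_functional TYPE('d) \<gamma> \<le> coulomb_functional Q"
proof -
  interpret prob_space Q using Q by (rule couplingsD)
  note couplingsD(2)[OF Q, measurable_cong]
  have nm[measurable]: "(\<lambda>x :: (real ^ 'd) ^ 'n. \<chi> i. norm (x $ i)) \<in> borel_measurable borel"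
    by (intro borel_measurable_continuous_onI continuous_intros)
  have "distr \<gamma> borel (\<lambda>x. x $ i) = radial_marginal \<rho>" for i
  proof -
    have "distr \<gamma> borel (\<lambda>x. x $ i) = distr Q borel (\<lambda>x. norm (x $ i))"
      unfolding \<gamma>_def by (subst distr_distr) (auto simp: comp_def)
    also have "\<dots> = distr (distr Q borel (\<lambda>x. x $ i)) borel norm"
      by (subst distr_distr) (auto simp: comp_def)
    finally show ?thesis using couplingsD(3)[OF Q] distr_norm_radial_measure[of \<rho>, where 'd='d] by simp
  qed
  moreover have "prob_space \<gamma>" unfolding \<gamma>_def by (rule prob_space_distr) measurable
  ultimately show "\<gamma> \<in> couplings (radial_marginal \<rho>)"
    by (simp add: couplings_def \<gamma>_def)
  have "reduced_functional TYPE('d) \<gamma> = (\<integral>\<^sup>+x. reduced_cost TYPE('d) (\<chi> i. norm (x $ i)) \<partial>Q)"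
    unfolding reduced_functional_def \<gamma>_def by (subst nn_integral_distr) auto
  also have "\<dots> \<le> coulomb_functional Q"
    unfolding coulomb_functional_def by (intro nn_integral_mono reduced_cost_le) simp
  finally show "reduced_functional TYPE('d) \<gamma> \<le> coulomb_functional Q" .
qed

text \<open>The cost of \<open>P\<close> equals the minimum of the reduced problem, which by
  \<open>coupling_norms\<close> bounds the cost of every plan from below. The last claim speaks of
  some optimizer only: the selection \<open>f\<close> is merely measurable, so its value at an
  individual point of the support of \<open>\<gamma>\<close> says nothing about nearby
  values.\<close>

lemma symmetric_optimal_plan:
  fixes \<gamma> :: "(real ^ 'n) measure"
  assumes [measurable]: "\<rho> \<in> borel_measurable borel"
    and \<gamma>: "is_arg_min (reduced_functional TYPE('d::finite)) (\<lambda>\<gamma>. \<gamma> \<in> couplings (radial_marginal \<rho>)) \<gamma>"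
  obtains P :: "((real ^ 'd) ^ 'n) measure"
  where "is_arg_min coulomb_functional (\<lambda>P. P \<in> couplings (radial_measure \<rho>)) P"
    "\<And>A x. orthogonal_matrix A \<Longrightarrow> x \<in> measure_support P \<Longrightarrow> (\<chi> i. A *v x $ i) \<in> measure_support P"
    "\<And>v. v \<in> measure_support \<gamma> \<Longrightarrow> \<exists>x\<in>measure_support P. attains_reduced_cost v x"
proof -
  obtain \<nu> :: "(real ^ 'd ^ 'd) measure"
    where \<nu>: "prob_space \<nu>" "sets \<nu> = sets borel" "AE A in \<nu>. orthogonal_matrix A"
    "\<And>B. orthogonal_matrix B \<Longrightarrow> distr \<nu> borel (\<lambda>A. B ** A) = \<nu>"
    using invariant_orthogonal_matrix_measure by blast
  obtain f :: "real ^ 'n \<Rightarrow> (real ^ 'd) ^ 'n" where f[measurable]: "f \<in> borel_measurable borel"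
    and att: "\<And>r. (\<And>i. 0 \<le> r $ i) \<Longrightarrow> attains_reduced_cost r (f r)"
    using attains_reduced_cost_selection by blast
  have \<gamma>c: "\<gamma> \<in> couplings (radial_marginal \<rho>)"
    and \<gamma>min: "\<And>\<gamma>' :: (real ^ 'n) measure. \<gamma>' \<in> couplings (radial_marginal \<rho>) \<Longrightarrow> reduced_functional TYPE('d) \<gamma> \<le> reduced_functional TYPE('d) \<gamma>'"
    using \<gamma> by (auto simp: is_arg_min_def not_less)
  interpret \<nu>: prob_space \<nu> by fact
  interpret \<gamma>: prob_space \<gamma> using \<gamma>c by (rule couplingsD)
  interpret pair_prob_space \<gamma> \<nu> ..
  note \<nu>(2)[measurable_cong] couplingsD(2)[OF \<gamma>c, measurable_cong]
  have nn: "AE v in \<gamma>. \<forall>i. 0 \<le> v $ i"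
    using \<gamma>c AE_radial_marginal_nonneg[OF assms(1)] by (rule AE_coupling) measurable
  define T where "T = (\<lambda>(v, A :: real ^ 'd ^ 'd). \<chi> i. A *v f v $ i)"
  have T[measurable]: "T \<in> borel_measurable (borel \<Otimes>\<^sub>M borel)"
    unfolding T_def by (intro borel_measurable_vecI) (simp add: case_prod_beta')
  define P where "P = distr (\<gamma> \<Otimes>\<^sub>M \<nu>) borel T"
  have sP[simp, measurable_cong]: "sets P = sets borel" by (simp add: P_def)
  have intP: "(\<integral>\<^sup>+x. g x \<partial>P) = (\<integral>\<^sup>+v. \<integral>\<^sup>+A. g (\<chi> i. A *v f v $ i) \<partial>\<nu> \<partial>\<gamma>)"
    if [measurable]: "g \<in> borel_measurable borel" for g :: "(real ^ 'd) ^ 'n \<Rightarrow> ennreal"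
    unfolding P_def by (subst nn_integral_distr, measurable, subst \<nu>.nn_integral_fst[symmetric], measurable)
      (simp add: T_def)
  have "prob_space P" unfolding P_def by (rule prob_space_distr) measurable
  have marg: "distr P borel (\<lambda>x. x $ i) = radial_measure \<rho>" for i
  proof (rule measure_eqI)
    fix X assume "X \<in> sets (distr P borel (\<lambda>x. x $ i))"
    then have X[measurable]: "X \<in> sets borel" by simp
    define H where "H r = (\<integral>\<^sup>+\<theta>. indicator X (r *\<^sub>R (\<theta> :: real ^ 'd)) \<partial>uniform_sphere)" for r
    interpret S: prob_space "uniform_sphere :: (real ^ 'd) measure" by (rule uniform_sphere_props)
    note uniform_sphere_props(2)[measurable_cong]
    have [measurable]: "H \<in> borel_measurable borel" unfolding H_def by measurable
    \<comment> \<open>Both sides depend on \<open>f v $ i\<close> alone; its length is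
      \<open>v $ i\<close>, and the random rotation makes its direction uniform.\<close>
    have inner: "(\<integral>\<^sup>+A. indicator X (A *v f v $ i) \<partial>\<nu>) = H (v $ i)" if v: "\<forall>i. 0 \<le> v $ i" for v
    proof -
      have n: "norm (f v $ i) = v $ i" using att[of v] v by (auto simp: attains_reduced_cost_def)
      show ?thesis
      proof (cases "v $ i = 0")
        case True
        with n show ?thesis by (simp add: H_def S.emeasure_space_1 \<nu>.emeasure_space_1)
      next
        case False
        define e where "e = f v $ i /\<^sub>R v $ i"
        have e: "norm e = 1" "f v $ i = v $ i *\<^sub>R e" using n v False by (auto simp: e_def)
        have law: "distr \<nu> borel (\<lambda>A. A *v e) = uniform_sphere"
          by (rule distr_invariant_unit_vector[OF \<nu>(1-3) _ e(1)]) (rule \<nu>(4))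
        have "H (v $ i) = (\<integral>\<^sup>+\<theta>. indicator X (v $ i *\<^sub>R \<theta>) \<partial>distr \<nu> borel (\<lambda>A. A *v e))"
          unfolding H_def law ..
        also have "\<dots> = (\<integral>\<^sup>+A. indicator X (v $ i *\<^sub>R (A *v e)) \<partial>\<nu>)"
          by (subst nn_integral_distr) auto
        finally show ?thesis unfolding e(2) by (simp add: matrix_vector_mult_scaleR)
      qed
    qed
    have "emeasure (distr P borel (\<lambda>x. x $ i)) X = (\<integral>\<^sup>+x. indicator X x \<partial>distr P borel (\<lambda>x. x $ i))" by simp
    also have "\<dots> = (\<integral>\<^sup>+x. indicator X (x $ i) \<partial>P)" by (subst nn_integral_distr) auto
    also have "\<dots> = (\<integral>\<^sup>+v. \<integral>\<^sup>+A. indicator X (A *v f v $ i) \<partial>\<nu> \<partial>\<gamma>)" by (subst intP) auto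
    also have "\<dots> = (\<integral>\<^sup>+v. H (v $ i) \<partial>\<gamma>)"
      using nn by (intro nn_integral_cong_AE, eventually_elim) (rule inner)
    also have "\<dots> = (\<integral>\<^sup>+r. H r \<partial>distr \<gamma> borel (\<lambda>v. v $ i))" by (subst nn_integral_distr) auto
    also have "\<dots> = emeasure (radial_measure \<rho>) X"
      unfolding couplingsD(3)[OF \<gamma>c] emeasure_radial_measure[OF assms(1) X] H_def[symmetric] ..
    finally show "emeasure (distr P borel (\<lambda>x. x $ i)) X = emeasure (radial_measure \<rho>) X" .
  qed simp
  have Pc: "P \<in> couplings (radial_measure \<rho>)"
    using marg \<open>prob_space P\<close> by (simp add: couplings_def)
  have "coulomb_functional P = (\<integral>\<^sup>+v. \<integral>\<^sup>+A. coulomb_cost (\<chi> i. A *v f v $ i) \<partial>\<nu> \<partial>\<gamma>)"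
    unfolding coulomb_functional_def by (subst intP) auto
  also have "\<dots> = (\<integral>\<^sup>+v. \<integral>\<^sup>+A. coulomb_cost (f v) \<partial>\<nu> \<partial>\<gamma>)"
  proof (rule nn_integral_cong)
    fix v
    show "(\<integral>\<^sup>+A. coulomb_cost (\<chi> i. A *v f v $ i) \<partial>\<nu>) = (\<integral>\<^sup>+A. coulomb_cost (f v) \<partial>\<nu>)"
      using \<nu>(3) by (intro nn_integral_cong_AE, eventually_elim) (rule coulomb_cost_orthogonal)
  qed
  also have "\<dots> = (\<integral>\<^sup>+v. reduced_cost TYPE('d) v \<partial>\<gamma>)"
    using nn by (intro nn_integral_cong_AE, eventually_elim) (use att in \<open>simp add: \<nu>.emeasure_space_1 attains_reduced_cost_def\<close>)
  finally have costP: "coulomb_functional P = reduced_functional TYPE('d) \<gamma>"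
    by (simp add: reduced_functional_def)
  have "is_arg_min coulomb_functional (\<lambda>P. P \<in> couplings (radial_measure \<rho>)) P"
    unfolding is_arg_min_def
  proof (intro conjI notI, rule Pc, elim exE conjE)
    fix Q :: "((real ^ 'd) ^ 'n) measure"
    assume Q: "Q \<in> couplings (radial_measure \<rho>)" "coulomb_functional Q < coulomb_functional P"
    from \<gamma>min[OF coupling_norms(1)[OF assms(1) Q(1)]] coupling_norms(2)[OF assms(1) Q(1)] Q(2) costP
    show False by simp
  qed
  moreover have "(\<chi> i. B *v x $ i) \<in> measure_support P"
    if B: "orthogonal_matrix B" and x: "x \<in> measure_support P" for B x
  proof (rule measure_support_invariant[of P "\<lambda>x. \<chi> i. B *v x $ i", OF sP _ _ x])
    show cB: "continuous_on UNIV (\<lambda>x :: (real ^ 'd) ^ 'n. \<chi> i. B *v x $ i)"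
      by (intro continuous_intros linear_continuous_on_compose[of _ _ "(*v) B"]) auto
    have [measurable]: "(\<lambda>x :: (real ^ 'd) ^ 'n. \<chi> i. B *v x $ i) \<in> borel_measurable borel"
      using cB by (rule borel_measurable_continuous_onI)
    show "distr P borel (\<lambda>x. \<chi> i. B *v x $ i) = P"
    proof (rule measure_eqI)
      fix X assume "X \<in> sets (distr P borel (\<lambda>x. \<chi> i. B *v x $ i))"
      then have X[measurable]: "X \<in> sets borel" by simp
      have "emeasure (distr P borel (\<lambda>x. \<chi> i. B *v x $ i)) X =
          (\<integral>\<^sup>+x. indicator X x \<partial>distr P borel (\<lambda>x. \<chi> i. B *v x $ i))" by simp
      also have "\<dots> = (\<integral>\<^sup>+x. indicator X (\<chi> i. B *v x $ i) \<partial>P)" by (subst nn_integral_distr) auto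
      also have "\<dots> = (\<integral>\<^sup>+v. \<integral>\<^sup>+A. indicator X (\<chi> i. (B ** A) *v f v $ i) \<partial>\<nu> \<partial>\<gamma>)"
        by (subst intP) (auto simp: matrix_vector_mul_assoc)
      also have "\<dots> = (\<integral>\<^sup>+v. \<integral>\<^sup>+A. indicator X (\<chi> i. A *v f v $ i) \<partial>distr \<nu> borel (\<lambda>A. B ** A) \<partial>\<gamma>)"
      proof (rule nn_integral_cong)
        fix v
        have "(\<lambda>A. indicator X (\<chi> i. A *v f v $ i) :: ennreal) \<in> borel_measurable (borel :: (real ^ 'd ^ 'd) measure)"
          by (rule measurable_compose[OF borel_measurable_vecI borel_measurable_indicator[OF X]]) simp
        then show "(\<integral>\<^sup>+A. indicator X (\<chi> i. (B ** A) *v f v $ i) \<partial>\<nu>) =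
            (\<integral>\<^sup>+A. indicator X (\<chi> i. A *v f v $ i) \<partial>distr \<nu> borel (\<lambda>A. B ** A))"
          by (subst nn_integral_distr) auto
      qed
      also have "\<dots> = (\<integral>\<^sup>+x. indicator X x \<partial>P)" unfolding \<nu>(4)[OF B] by (subst intP) auto
      finally show "emeasure (distr P borel (\<lambda>x. \<chi> i. B *v x $ i)) X = emeasure P X" by simp
    qed simp
  qed
  moreover have "\<exists>x\<in>measure_support P. attains_reduced_cost v x" if v: "v \<in> measure_support \<gamma>" for v
  proof (rule ccontr)
    assume neg: "\<not> (\<exists>x\<in>measure_support P. attains_reduced_cost v x)"
    \<comment> \<open>\<open>W\<close> collects the radii with an optimizer in the support and is
      closed. If \<open>v\<close> were outside, the rotated optimizers over a set of positive
      \<open>\<gamma>\<close>-mass would miss the support of \<open>P\<close>, whose complement is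
      null.\<close>
    define W where "W = {v. {x :: (real ^ 'd) ^ 'n. attains_reduced_cost v x} \<inter> measure_support P \<noteq> {}}"
    have "closed W" unfolding W_def
      by (rule closed_graph_fibre_compact(2)[of _ norm])
         (auto simp: closed_attains_reduced_cost closed_measure_support attains_reduced_cost_norm_le intro!: continuous_intros)
    moreover have "v \<in> - W" using neg by (auto simp: W_def)
    ultimately have pos: "0 < emeasure \<gamma> (- W)"
      using v by (auto simp: measure_support_def)
    have Wm[measurable]: "- W \<in> sets borel" using \<open>closed W\<close> by auto
    have Sm[measurable]: "- measure_support P \<in> sets borel" using closed_measure_support[of P] by (intro borel_open) (rule open_Compl)
    have "emeasure \<gamma> (- W) = (\<integral>\<^sup>+v. \<integral>\<^sup>+A. indicator (- W) v \<partial>\<nu> \<partial>\<gamma>)"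
      by (simp add: \<nu>.emeasure_space_1 couplingsD(2)[OF \<gamma>c])
    also have "\<dots> \<le> (\<integral>\<^sup>+v. \<integral>\<^sup>+A. indicator (- measure_support P) (\<chi> i. A *v f v $ i) \<partial>\<nu> \<partial>\<gamma>)"
      using nn
    proof (intro nn_integral_mono_AE, eventually_elim)
      fix v :: "real ^ 'n" assume v: "\<forall>i. 0 \<le> v $ i"
      show "(\<integral>\<^sup>+A. indicator (- W) v \<partial>\<nu>) \<le> (\<integral>\<^sup>+A. indicator (- measure_support P) (\<chi> i. A *v f v $ i) \<partial>\<nu>)"
        using \<nu>(3)
      proof (intro nn_integral_mono_AE, eventually_elim)
        fix A :: "real ^ 'd ^ 'd" assume A: "orthogonal_matrix A"
        have "attains_reduced_cost v (\<chi> i. A *v f v $ i)"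
          using att[of v] v coulomb_cost_orthogonal[OF A, of "f v"] orthogonal_transformation_norm[OF orthogonal_matrix_vector_mult[OF A]]
          by (auto simp: attains_reduced_cost_def)
        then show "indicator (- W) v \<le> (indicator (- measure_support P) (\<chi> i. A *v f v $ i) :: ennreal)"
          by (auto simp: W_def split: split_indicator)
      qed
    qed
    also have "\<dots> = emeasure P (- measure_support P)" by (subst intP[symmetric]) auto
    also have "\<dots> = 0" by (rule measure_support_compl_null) simp
    finally show False using pos by simp
  qed
  ultimately show thesis by (rule that)
qed

section \<open>Rigidity of collinear optimizers\<close>

definition distinct_pairs :: "('n \<times> 'n) set" where
  "distinct_pairs = {(i, j). i \<noteq> j}"

text \<open>A real-valued stand-in for \<open>coulomb_cost\<close>. Since \<open>1 / 0 = 0\<close>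
  in the reals, it is meaningful only for pairwise distinct points.\<close>

definition coulomb_energy :: "(real ^ 'd) ^ 'n \<Rightarrow> real" where
  "coulomb_energy x = (\<Sum>(i, j) \<in> distinct_pairs. 1 / norm (x $ i - x $ j))"

lemma coulomb_cost_eq_energy:
  assumes "inj (($) x)"
  shows "coulomb_cost x = ennreal (coulomb_energy x)"
proof -
  have "1 / ennreal (norm (x $ i - x $ j)) = ennreal (1 / norm (x $ i - x $ j))" if "i \<noteq> j" for i j
  proof -
    have "norm (x $ i - x $ j) > 0" using assms that by (auto dest: injD)
    then show ?thesis using divide_ennreal[of 1 "norm (x $ i - x $ j)"] by simp
  qed
  then show ?thesis
    unfolding coulomb_cost_def coulomb_energy_def distinct_pairs_def
    by (subst sum_ennreal[symmetric]) (auto intro!: sum.cong)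
qed

lemma coulomb_cost_finite_imp_inj:
  assumes "coulomb_cost x \<noteq> top"
  shows "inj (($) x)"
proof (rule injI, rule ccontr)
  fix i j assume ij: "x $ i = x $ j" "i \<noteq> j"
  have "1 / ennreal (norm (x $ i - x $ j)) \<le> coulomb_cost x"
    unfolding coulomb_cost_def
    using member_le_sum[of "(i, j)" "{(i, j). i \<noteq> j}" "\<lambda>(i, j). 1 / ennreal (norm (x $ i - x $ j))"] ij(2)
    by simp
  with ij(1) assms show False by (simp add: top_unique)
qed

text \<open>Strict convexity of the inverse square root: the expression is its height at
  \<open>t\<^sup>2\<close> above the tangent at \<open>s\<^sup>2\<close>. Squared distances are the
  right variable because they are affine in the Gram matrix.\<close>

lemma inverse_above_tangent:
  fixes s t :: real
  assumes "0 < s" "0 < t"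
  shows "0 \<le> 1 / t - 1 / s + (t\<^sup>2 - s\<^sup>2) / (2 * s ^ 3)"
    and "1 / t - 1 / s + (t\<^sup>2 - s\<^sup>2) / (2 * s ^ 3) = 0 \<Longrightarrow> t = s"
proof -
  have eq: "1 / t - 1 / s + (t\<^sup>2 - s\<^sup>2) / (2 * s ^ 3) = (t - s)\<^sup>2 * (t + 2 * s) / (2 * s ^ 3 * t)"
    using assms by (simp add: field_simps power2_eq_square power3_eq_cube)
  show "0 \<le> 1 / t - 1 / s + (t\<^sup>2 - s\<^sup>2) / (2 * s ^ 3)"
    unfolding eq using assms by (intro divide_nonneg_nonneg mult_nonneg_nonneg) auto
  show "t = s" if "1 / t - 1 / s + (t\<^sup>2 - s\<^sup>2) / (2 * s ^ 3) = 0"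
    using that assms unfolding eq by auto
qed

text \<open>The sum is the derivative at \<open>0\<close> of the energy along a family of
  configurations with unchanged radii, so a negative value would produce a cheaper competitor. The
  cubes come from differentiating the inverse distance with respect to the squared distance.\<close>

lemma collinear_optimizer_second_order:
  fixes x :: "(real ^ 'd) ^ 'n" and c a :: "'n \<Rightarrow> real" and e z :: "real ^ 'd"
  assumes att: "attains_reduced_cost v x" and fin: "coulomb_cost x \<noteq> top"
    and x: "\<And>i. x $ i = c i *\<^sub>R e" and e: "norm e = 1" and z: "norm z = 1" "e \<bullet> z = 0"
  shows "0 \<le> (\<Sum>(i, j) \<in> distinct_pairs. (a i * v $ i * (a j * v $ j) - c i * c j * ((a i)\<^sup>2 + (a j)\<^sup>2) / 2) / \<bar>c i - c j\<bar> ^ 3)"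
    (is "0 \<le> ?D")
proof (rule ccontr)
  assume neg: "\<not> 0 \<le> ?D"
  have inj: "inj (($) x)" using fin by (rule coulomb_cost_finite_imp_inj)
  have cne: "c i \<noteq> c j" if "i \<noteq> j" for i j using inj that x by (metis injD)
  have v: "\<bar>c i\<bar> = v $ i" for i
  proof -
    have "norm (x $ i) = \<bar>c i\<bar>" by (simp add: x e)
    then show ?thesis using att by (simp add: attains_reduced_cost_def)
  qed
  have vv: "(c i)\<^sup>2 = (v $ i)\<^sup>2" for i unfolding v[symmetric] by simp
  \<comment> \<open>Rotating \<open>x\<^sub>i\<close> towards \<open>z\<close> by an angle of sine \<open>a\<^sub>i \<surd>p\<close> turns the second-order condition into
    a one-sided first-order condition in \<open>p\<close>.\<close>
  define s where "s i p = sqrt (1 - p * (a i)\<^sup>2)" for i p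
  define T where "T i j p = (s i p * c i - s j p * c j)\<^sup>2 + p * (a i * v $ i - a j * v $ j)\<^sup>2" for i j p
  define G where "G p = (\<Sum>(i, j) \<in> distinct_pairs. 1 / sqrt (T i j p))" for p
  have T0: "T i j 0 = (c i - c j)\<^sup>2" for i j by (simp add: T_def s_def)
  have T': "((\<lambda>p. T i j p) has_real_derivative (c i * c j * ((a i)\<^sup>2 + (a j)\<^sup>2) - 2 * (a i * v $ i * (a j * v $ j)))) (at 0)" for i j
  proof -
    have s': "(s i has_real_derivative - (a i)\<^sup>2 / 2) (at 0)" for i
      unfolding s_def[abs_def] by (auto intro!: derivative_eq_intros)
    have [simp]: "s i 0 = 1" for i by (simp add: s_def)
    have "((\<lambda>p. T i j p) has_real_derivative
        (c i - c j) * ((a j)\<^sup>2 * c j - (a i)\<^sup>2 * c i) + (a i * v $ i - a j * v $ j)\<^sup>2) (at 0)"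
      unfolding T_def by (rule derivative_eq_intros s' refl)+ (simp add: field_simps)
    also have "(c i - c j) * ((a j)\<^sup>2 * c j - (a i)\<^sup>2 * c i) + (a i * v $ i - a j * v $ j)\<^sup>2 =
        c i * c j * ((a i)\<^sup>2 + (a j)\<^sup>2) - 2 * (a i * v $ i * (a j * v $ j))"
      using vv[of i] vv[of j] by algebra
    finally show ?thesis .
  qed
  have G': "(G has_real_derivative ?D) (at 0)"
  proof -
    have "((\<lambda>p. 1 / sqrt (T i j p)) has_real_derivative
       (a i * v $ i * (a j * v $ j) - c i * c j * ((a i)\<^sup>2 + (a j)\<^sup>2) / 2) / \<bar>c i - c j\<bar> ^ 3) (at 0)"
      if "i \<noteq> j" for i j
    proof -
      have pos: "0 < T i j 0" using cne[OF that] by (simp add: T0)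
      let ?T' = "c i * c j * ((a i)\<^sup>2 + (a j)\<^sup>2) - 2 * (a i * v $ i * (a j * v $ j))"
      have "((\<lambda>p. 1 / sqrt (T i j p)) has_real_derivative
          - (?T' * (inverse (sqrt (T i j 0)) / 2)) / (sqrt (T i j 0) * sqrt (T i j 0))) (at 0)"
        using pos by (auto intro!: derivative_eq_intros T' simp: field_simps)
      also have "- (?T' * (inverse (sqrt (T i j 0)) / 2)) / (sqrt (T i j 0) * sqrt (T i j 0)) =
          (- ?T' / 2) / \<bar>c i - c j\<bar> ^ 3"
        by (simp add: T0 power3_eq_cube divide_simps)
      also have "- ?T' / 2 = a i * v $ i * (a j * v $ j) - c i * c j * ((a i)\<^sup>2 + (a j)\<^sup>2) / 2"
        by (simp add: field_simps)
      finally show ?thesis .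
    qed
    then show ?thesis
      unfolding G_def[abs_def] case_prod_beta'
      by (intro DERIV_sum) (auto simp: distinct_pairs_def)
  qed
  obtain d where d: "d > 0" "\<And>h. 0 < h \<Longrightarrow> h < d \<Longrightarrow> G h < G 0"
    using has_real_derivative_neg_dec_right[OF has_field_derivative_at_within[OF G'], of UNIV] neg by auto
  then have "eventually (\<lambda>p. G p < G 0) (at_right 0)"
    by (auto simp: eventually_at_right_field)
  \<comment> \<open>Two more conditions on small \<open>p\<close>: distinct points, so that the cost
    is the real number \<open>G p\<close>, and positive radicands in \<open>s\<close>, so that the
    radii are preserved.\<close>
  moreover have "eventually (\<lambda>p. \<forall>i j. i \<noteq> j \<longrightarrow> 0 < T i j p) (at_right 0)"
  proof (intro eventually_all_finite)
    fix i j
    have "isCont (T i j) 0" using T'[of i j] by (rule DERIV_isCont)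
    then have "(T i j \<longlongrightarrow> T i j 0) (at_right 0)"
      by (simp add: isCont_def filterlim_at_split)
    then show "eventually (\<lambda>p. i \<noteq> j \<longrightarrow> 0 < T i j p) (at_right 0)"
    proof (cases "i = j")
      case False
      have "0 < T i j 0" using cne[OF False] by (simp add: T0)
      from order_tendstoD(1)[OF \<open>(T i j \<longlongrightarrow> T i j 0) (at_right 0)\<close> this]
      show ?thesis by eventually_elim simp
    qed simp
  qed
  moreover have "eventually (\<lambda>p. \<forall>i. 0 < 1 - p * (a i)\<^sup>2) (at_right 0)"
  proof (intro eventually_all_finite)
    fix i
    have "((\<lambda>p. 1 - p * (a i)\<^sup>2) \<longlongrightarrow> 1 - 0 * (a i)\<^sup>2) (at_right 0)" by (intro tendsto_intros)
    from order_tendstoD(1)[OF this, of 0]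
    show "eventually (\<lambda>p. 0 < 1 - p * (a i)\<^sup>2) (at_right 0)" by simp
  qed
  moreover have "eventually (\<lambda>p. p > (0 :: real)) (at_right 0)" by (simp add: eventually_at_right_less)
  ultimately have "eventually (\<lambda>p. G p < G 0 \<and> (\<forall>i j. i \<noteq> j \<longrightarrow> 0 < T i j p) \<and> (\<forall>i. 0 < 1 - p * (a i)\<^sup>2) \<and> p > 0) (at_right 0)"
    by eventually_elim blast
  from eventually_happens'[OF trivial_limit_at_right_real this]
  obtain p where p: "G p < G 0" "\<And>i j. i \<noteq> j \<Longrightarrow> 0 < T i j p" "\<And>i. 0 < 1 - p * (a i)\<^sup>2" "p > 0"
    by blast
  define u where "u = (\<chi> i. s i p *\<^sub>R x $ i + (sqrt p * a i * v $ i) *\<^sub>R z)"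
  have pyth: "norm (\<alpha> *\<^sub>R e + \<beta> *\<^sub>R z) = sqrt (\<alpha>\<^sup>2 + \<beta>\<^sup>2)" for \<alpha> \<beta>
    using e z by (simp add: norm_eq_sqrt_inner inner_add_left inner_add_right inner_commute[of z e] power2_eq_square)
  have u: "u $ i = (s i p * c i) *\<^sub>R e + (sqrt p * (a i * v $ i)) *\<^sub>R z" for i
    by (simp add: u_def x algebra_simps)
  have nu: "norm (u $ i) = v $ i" for i
  proof -
    have "(s i p * c i)\<^sup>2 + (sqrt p * (a i * v $ i))\<^sup>2 = (1 - p * (a i)\<^sup>2) * (v $ i)\<^sup>2 + p * ((a i)\<^sup>2 * (v $ i)\<^sup>2)"
      using p(3)[of i] p(4) by (simp add: power_mult_distrib s_def vv)
    also have "\<dots> = (v $ i)\<^sup>2" by (simp add: algebra_simps)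
    finally show ?thesis unfolding u pyth using v[of i] by (simp add: real_sqrt_abs)
  qed
  have du: "norm (u $ i - u $ j) = sqrt (T i j p)" for i j
  proof -
    have "u $ i - u $ j = (s i p * c i - s j p * c j) *\<^sub>R e + (sqrt p * (a i * v $ i - a j * v $ j)) *\<^sub>R z"
      unfolding u by (simp add: algebra_simps)
    then show ?thesis unfolding T_def using p(4) by (simp only: pyth) (simp add: power_mult_distrib)
  qed
  have "inj (($) u)"
  proof (rule injI, rule ccontr)
    fix i j assume "u $ i = u $ j" "i \<noteq> j"
    with du[of i j] p(2)[of i j] show False by simp
  qed
  then have "coulomb_cost u = ennreal (G p)"
    by (simp add: coulomb_cost_eq_energy coulomb_energy_def G_def du)
  moreover have "coulomb_cost x = ennreal (G 0)"
  proof -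
    have "norm (x $ i - x $ j) = sqrt (T i j 0)" for i j
      using e by (simp add: x T0 flip: scaleR_diff_left)
    then show ?thesis using inj by (simp add: coulomb_cost_eq_energy coulomb_energy_def G_def)
  qed
  moreover have "coulomb_cost x \<le> coulomb_cost u"
    using reduced_cost_le[of u v] nu att by (simp add: attains_reduced_cost_def)
  moreover have "0 \<le> G 0" unfolding G_def T0 by (intro sum_nonneg) auto
  moreover have "0 \<le> G p" using p(2) unfolding G_def by (intro sum_nonneg) (auto simp: distinct_pairs_def intro: less_imp_le)
  ultimately show False using p(1) by (simp add: ennreal_le_iff)
qed

text \<open>The energy is strictly convex in the off-diagonal inner products. Second-order
  optimality of \<open>x\<close> shows that its slope from the Gram matrix of \<open>x\<close>
  towards that of \<open>y\<close> is nonnegative, so equal energies force equal inner products.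
  Those of \<open>x\<close> saturate Cauchy-Schwarz, hence so do those of \<open>y\<close>.\<close>

lemma collinear_optimizer_unique:
  fixes x y :: "(real ^ 'd) ^ 'n"
  assumes d: "2 \<le> CARD('d)" and v1: "0 < v $ one"
    and x: "attains_reduced_cost v x" and y: "attains_reduced_cost v y"
    and fin: "reduced_cost TYPE('d) v \<noteq> top"
    and col: "\<And>i. collinear {0, x $ one, x $ i}"
  shows "collinear {0, y $ one, y $ i}"
proof -
  have nx: "norm (x $ i) = v $ i" and ny: "norm (y $ i) = v $ i" for i
    using x y by (auto simp: attains_reduced_cost_def)
  have fx: "coulomb_cost x \<noteq> top" and fy: "coulomb_cost y \<noteq> top" and cxy: "coulomb_cost x = coulomb_cost y"
    using x y fin by (auto simp: attains_reduced_cost_def)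
  note ix = coulomb_cost_finite_imp_inj[OF fx] and iy = coulomb_cost_finite_imp_inj[OF fy]
  define e where "e = x $ one /\<^sub>R v $ one"
  have e: "norm e = 1" using v1 nx[of one] by (simp add: e_def)
  have "\<exists>c. x $ i = c *\<^sub>R e" for i
  proof -
    consider "x $ i = 0" | k where "x $ i = k *\<^sub>R x $ one"
      using col[of i] nx[of one] v1 by (auto simp: collinear_lemma)
    then show ?thesis
    proof cases
      case 1 then show ?thesis by (intro exI[of _ 0]) simp
    next
      case 2 then show ?thesis using v1 by (intro exI[of _ "k * v $ one"]) (simp add: e_def)
    qed
  qed
  then obtain c where c: "\<And>i. x $ i = c i *\<^sub>R e" by metis
  have vc: "\<bar>c i\<bar> = v $ i" for i using nx[of i] e by (simp add: c)
  obtain z0 :: "real ^ 'd" where z0: "z0 \<noteq> 0" "orthogonal e z0"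
    using orthogonal_to_vector_exists[of e] d by auto
  define z where "z = z0 /\<^sub>R norm z0"
  have z: "norm z = 1" "e \<bullet> z = 0" using z0 by (auto simp: z_def orthogonal_def)
  define w where "w i j = 1 / \<bar>c i - c j\<bar> ^ 3" for i j
  \<comment> \<open>Coordinate \<open>k\<close> of \<open>y\<close> supplies the amplitudes for one
    perturbation in the fixed direction \<open>z\<close>; the directions of the competitor are
    recovered by summing over \<open>k\<close>.\<close>
  define a where "a k i = y $ i $ k / v $ i" for k i
  have a: "a k i * v $ i = y $ i $ k" for k i
  proof (cases "v $ i = 0")
    case True
    then have "y $ i = 0" using ny[of i] by simp
    then show ?thesis by (simp add: a_def)
  qed (simp add: a_def)
  \<comment> \<open>The amplitudes of a point have square sum \<open>1\<close>, except at radius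
    \<open>0\<close>, where they vanish; the factor \<open>c i = 0\<close> covers that case.\<close>
  have aa: "(\<Sum>k\<in>UNIV. c i * c j * (a k i)\<^sup>2) = c i * c j" for i j
  proof (cases "v $ i = 0")
    case True
    then show ?thesis using vc[of i] by simp
  next
    case False
    have "(\<Sum>k\<in>UNIV. (y $ i $ k)\<^sup>2) = (v $ i)\<^sup>2"
      unfolding ny[of i, symmetric] power2_norm_eq_inner inner_vec_def by (simp add: power2_eq_square)
    then have "(\<Sum>k\<in>UNIV. (a k i)\<^sup>2) = 1"
      using False by (simp add: a_def power_divide flip: sum_divide_distrib)
    then show ?thesis by (simp flip: sum_distrib_left)
  qed
  have "0 \<le> (\<Sum>k\<in>UNIV. \<Sum>(i, j) \<in> distinct_pairs. (a k i * v $ i * (a k j * v $ j) - c i * c j * ((a k i)\<^sup>2 + (a k j)\<^sup>2) / 2) / \<bar>c i - c j\<bar> ^ 3)"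
    by (intro sum_nonneg collinear_optimizer_second_order[OF x fx c e z])
  also have "\<dots> = (\<Sum>(i, j) \<in> distinct_pairs. \<Sum>k\<in>UNIV. w i j * (y $ i $ k * y $ j $ k - (c i * c j * (a k i)\<^sup>2 + c j * c i * (a k j)\<^sup>2) / 2))"
  proof -
    have "(a k i * v $ i * (a k j * v $ j) - c i * c j * ((a k i)\<^sup>2 + (a k j)\<^sup>2) / 2) / \<bar>c i - c j\<bar> ^ 3 =
        w i j * (y $ i $ k * y $ j $ k - (c i * c j * (a k i)\<^sup>2 + c j * c i * (a k j)\<^sup>2) / 2)" for i j k
      unfolding a w_def by (simp add: mult.commute[of "c j" "c i"] distrib_left)
    then show ?thesis unfolding case_prod_beta' by (subst sum.swap) (simp only:)
  qed
  also have "\<dots> = (\<Sum>(i, j) \<in> distinct_pairs. w i j * (y $ i \<bullet> y $ j - c i * c j))"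
  proof -
    have "(\<Sum>k\<in>UNIV. w i j * (y $ i $ k * y $ j $ k - (c i * c j * (a k i)\<^sup>2 + c j * c i * (a k j)\<^sup>2) / 2)) =
        w i j * (y $ i \<bullet> y $ j - c i * c j)" for i j
      unfolding sum_distrib_left[of "w i j", symmetric] sum_subtractf sum_divide_distrib[symmetric] sum.distrib aa
      by (simp add: inner_vec_def mult.commute)
    then show ?thesis by (simp only:)
  qed
  \<comment> \<open>This is the directional derivative of the energy from the Gram matrix of
    \<open>x\<close> to that of \<open>y\<close>: \<open>w i j\<close> is the derivative of the
    inverse distance with respect to the inner product.\<close>
  finally have S: "0 \<le> (\<Sum>(i, j) \<in> distinct_pairs. w i j * (y $ i \<bullet> y $ j - c i * c j))" .
  define s t where "s i j = norm (x $ i - x $ j)" and "t i j = norm (y $ i - y $ j)" for i j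
  have st: "0 < s i j" "0 < t i j" if "i \<noteq> j" for i j
    using ix iy that by (auto simp: s_def t_def dest: injD)
  have s2: "(s i j)\<^sup>2 = (v $ i)\<^sup>2 + (v $ j)\<^sup>2 - 2 * (c i * c j)" for i j
  proof -
    have "s i j = \<bar>c i - c j\<bar>" using e by (simp add: s_def c flip: scaleR_diff_left)
    moreover have "(v $ k)\<^sup>2 = (c k)\<^sup>2" for k by (simp flip: vc)
    ultimately show ?thesis by (simp add: power2_eq_square algebra_simps)
  qed
  have t2: "(t i j)\<^sup>2 = (v $ i)\<^sup>2 + (v $ j)\<^sup>2 - 2 * (y $ i \<bullet> y $ j)" for i j
    unfolding t_def power2_norm_eq_inner inner_diff_left inner_diff_right
    using ny[of i] ny[of j] by (simp add: dot_square_norm inner_commute)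
  have sw: "w i j = 1 / s i j ^ 3" for i j
    using e by (simp add: w_def s_def c flip: scaleR_diff_left)
  \<comment> \<open>The gap above the tangent. As \<open>x\<close> and \<open>y\<close> have the
    same radii, the difference of squared distances is \<open>- 2\<close> times that of inner
    products, so the gaps sum to the difference of the energies minus the expression in
    \<open>S\<close>.\<close>
  define \<delta> where "\<delta> i j = 1 / t i j - 1 / s i j + ((t i j)\<^sup>2 - (s i j)\<^sup>2) / (2 * s i j ^ 3)" for i j
  have \<delta>: "\<delta> i j = 1 / t i j - 1 / s i j - w i j * (y $ i \<bullet> y $ j - c i * c j)" if "i \<noteq> j" for i j
    using st[OF that] unfolding \<delta>_def sw s2 t2 by (simp add: field_simps)
  have \<delta>0: "0 \<le> \<delta> i j" if "i \<noteq> j" for i j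
    using inverse_above_tangent(1)[OF st[OF that]] by (simp add: \<delta>_def)
  have "coulomb_energy x = coulomb_energy y"
  proof -
    have "0 \<le> coulomb_energy x" "0 \<le> coulomb_energy y"
      by (auto simp: coulomb_energy_def intro!: sum_nonneg)
    then show ?thesis using cxy by (simp add: coulomb_cost_eq_energy[OF ix] coulomb_cost_eq_energy[OF iy])
  qed
  then have "(\<Sum>(i, j) \<in> distinct_pairs. 1 / t i j) - (\<Sum>(i, j) \<in> distinct_pairs. 1 / s i j) = 0"
    by (simp add: coulomb_energy_def s_def t_def)
  moreover have "(\<Sum>(i, j) \<in> distinct_pairs. \<delta> i j) = (\<Sum>(i, j) \<in> distinct_pairs. 1 / t i j - 1 / s i j - w i j * (y $ i \<bullet> y $ j - c i * c j))"
    by (intro sum.cong) (auto simp: distinct_pairs_def \<delta>)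
  ultimately have "(\<Sum>(i, j) \<in> distinct_pairs. \<delta> i j) \<le> 0"
    using S by (simp add: sum_subtractf case_prod_beta')
  then have "(\<Sum>p \<in> distinct_pairs. case p of (i, j) \<Rightarrow> \<delta> i j) = 0"
    using \<delta>0 by (intro antisym sum_nonneg) (auto simp: distinct_pairs_def)
  then have \<delta>z: "\<delta> i j = 0" if "i \<noteq> j" for i j
    using that \<delta>0 by (subst (asm) sum_nonneg_eq_0_iff) (auto simp: distinct_pairs_def)
  show ?thesis
  proof (cases "i = one")
    case False
    then have "t one i = s one i"
      using inverse_above_tangent(2)[OF st] \<delta>z[of one i] by (simp add: \<delta>_def)
    \<comment> \<open>Equal distances and equal radii give equal inner products, and
      \<open>c one * c i\<close> has the largest modulus that Cauchy-Schwarz allows.\<close>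
    then have "y $ one \<bullet> y $ i = c one * c i" using s2[of one i] t2[of one i] by simp
    then have "\<bar>y $ one \<bullet> y $ i\<bar> = norm (y $ one) * norm (y $ i)"
      by (simp add: ny abs_mult vc)
    then show ?thesis by (simp add: norm_cauchy_schwarz_equal)
  qed (simp add: collinear_2 insert_commute)
qed

section \<open>Hausdorff dimension of rotation-invariant sets\<close>

text \<open>A cubic grid, rounded down in each coordinate. The constants are crude: only the growth
  of the cardinality like \<open>e\<close> to the power \<open>- DIM('b)\<close> matters.\<close>

lemma cball_grid_cover:
  assumes R: "0 \<le> R" and e: "0 < e" "e \<le> 1"
  obtains Q :: "'b::euclidean_space set"
  where "finite Q" "cball 0 R \<subseteq> (\<Union>q\<in>Q. cball q e)"
    "real (card Q) \<le> ((2 * R * DIM('b) + 3) / e) ^ DIM('b)"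
proof -
  \<comment> \<open>With this spacing the \<open>DIM('b)\<close> coordinate errors add up to at most
    \<open>e\<close>.\<close>
  define h where "h = e / DIM('b)"
  have h: "0 < h" using e by (simp add: h_def)
  define K where "K = \<lceil>R / h\<rceil>"
  have K: "R / h \<le> real_of_int K" "real_of_int K \<le> R / h + 1" "0 \<le> K"
  proof -
    have "0 \<le> R / h" using R h by simp
    then show "R / h \<le> real_of_int K" "real_of_int K \<le> R / h + 1" "0 \<le> K"
      unfolding K_def by linarith+
  qed
  define g where "g f = (\<Sum>b\<in>Basis. (h * real_of_int (f b)) *\<^sub>R b)" for f :: "'b \<Rightarrow> int"
  define Q where "Q = g ` (Basis \<rightarrow>\<^sub>E {- K..K})"
  show thesis
  proof (rule that)
    show "finite Q" unfolding Q_def by (intro finite_imageI finite_PiE) auto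
    show "cball 0 R \<subseteq> (\<Union>q\<in>Q. cball q e)"
    proof
      fix x :: 'b assume x: "x \<in> cball 0 R"
      define f where "f = restrict (\<lambda>b. \<lfloor>(x \<bullet> b) / h\<rfloor>) Basis"
      have "\<lfloor>(x \<bullet> b) / h\<rfloor> \<in> {- K..K}" if b: "b \<in> Basis" for b
      proof -
        have "\<bar>x \<bullet> b\<bar> \<le> R" using Basis_le_norm[OF b, of x] x by simp
        then have "- (R / h) \<le> (x \<bullet> b) / h" "(x \<bullet> b) / h \<le> R / h"
          using h by (auto simp: field_simps abs_le_iff)
        with K(1) have "real_of_int (- K) \<le> (x \<bullet> b) / h" "(x \<bullet> b) / h \<le> real_of_int K" by auto
        then show ?thesis by (simp add: le_floor_iff floor_le_iff)
      qed
      then have "g f \<in> Q" by (auto simp: Q_def f_def)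
      moreover have "dist (g f) x \<le> e"
      proof -
        have "dist (g f) x = norm (\<Sum>b\<in>Basis. (h * real_of_int (f b) - x \<bullet> b) *\<^sub>R b)"
          by (simp add: g_def dist_norm scaleR_diff_left sum_subtractf euclidean_representation)
        also have "\<dots> \<le> (\<Sum>b\<in>(Basis :: 'b set). h)"
        proof (rule order_trans[OF norm_sum sum_mono])
          fix b :: 'b assume b: "b \<in> Basis"
          have "real_of_int \<lfloor>(x \<bullet> b) / h\<rfloor> \<le> (x \<bullet> b) / h" "(x \<bullet> b) / h \<le> real_of_int \<lfloor>(x \<bullet> b) / h\<rfloor> + 1"
            by (rule of_int_floor_le, rule real_of_int_floor_add_one_ge)
          then have "h * real_of_int (f b) \<le> x \<bullet> b" "x \<bullet> b \<le> h * real_of_int (f b) + h"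
            using h b by (simp_all only: pos_le_divide_eq pos_divide_le_eq f_def restrict_apply' distrib_left mult.commute mult_1_right)
          with b show "norm ((h * real_of_int (f b) - x \<bullet> b) *\<^sub>R b) \<le> h" by simp
        qed
        also have "\<dots> = e" by (simp add: h_def)
        finally show ?thesis .
      qed
      ultimately show "x \<in> (\<Union>q\<in>Q. cball q e)" by auto
    qed
    have "card Q \<le> card (Basis \<rightarrow>\<^sub>E {- K..K} :: ('b \<Rightarrow> int) set)"
      unfolding Q_def by (intro card_image_le finite_PiE) auto
    also have "\<dots> = nat (2 * K + 1) ^ DIM('b)" by (simp add: card_PiE algebra_simps)
    finally have "real (card Q) \<le> real (nat (2 * K + 1)) ^ DIM('b)"
      by (metis of_nat_le_iff of_nat_power)
    also have "\<dots> \<le> ((2 * R * DIM('b) + 3) / e) ^ DIM('b)"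
    proof (rule power_mono)
      have "real (nat (2 * K + 1)) = 2 * real_of_int K + 1" using K(3) by simp
      also have "\<dots> \<le> 2 * (R / h) + 3" using K(2) by simp
      also have "\<dots> \<le> 2 * (R / h) + 3 / e" using e by (simp add: field_simps)
      also have "\<dots> = (2 * R * DIM('b) + 3) / e"
        by (simp add: h_def add_divide_distrib mult.commute mult.left_commute)
      finally show "real (nat (2 * K + 1)) \<le> (2 * R * DIM('b) + 3) / e" .
    qed simp
    finally show "real (card Q) \<le> ((2 * R * DIM('b) + 3) / e) ^ DIM('b)" .
  qed
qed

lemma hausdorff_null_cover:
  assumes "hausdorff_measure s S = 0" "0 < \<epsilon>"
  obtains U :: "nat \<Rightarrow> 'a::metric_space set"
  where "S \<subseteq> (\<Union>i. U i)" "\<And>i. bounded (U i)" "\<And>i. diameter (U i) \<le> 1"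
    "(\<Sum>i. ennreal (diameter (U i) powr s)) < ennreal \<epsilon>"
proof -
  have "hausdorff_content 1 s S \<le> hausdorff_measure s S"
    unfolding hausdorff_measure_def by (intro SUP_upper) auto
  then have "hausdorff_content 1 s S < ennreal \<epsilon>" using assms by simp
  then show thesis
    unfolding hausdorff_content_def INF_less_iff using that by auto
qed

text \<open>Over a covering set of size \<open>e\<close>, the parameter ball splits into about
  \<open>e\<close> to the power \<open>- DIM('b)\<close> pieces, each with image in a ball of radius
  \<open>3 * L * e\<close>. The total volume is of order \<open>e ^ (DIM('c) - DIM('b))\<close>, at
  most of order \<open>e powr s\<close> for \<open>e \<le> 1\<close>, and these terms have an
  arbitrarily small sum.\<close>

lemma negligible_Lipschitz_image_hausdorff_null:
  fixes S :: "'a::metric_space set" and F :: "'a \<Rightarrow> 'b::euclidean_space \<Rightarrow> 'c::euclidean_space"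
  assumes null: "hausdorff_measure s S = 0" and s: "0 < s" "s + DIM('b) \<le> DIM('c)"
    and S': "S' \<subseteq> S" and R: "0 \<le> R" and L: "0 \<le> L"
    and lip: "\<And>x x' t t'. \<lbrakk>x \<in> S'; x' \<in> S'; t \<in> cball 0 R; t' \<in> cball 0 R\<rbrakk> \<Longrightarrow>
        dist (F x t) (F x' t') \<le> L * (dist x x' + dist t t')"
  shows "negligible {F x t | x t. x \<in> S' \<and> t \<in> cball 0 R}"
proof (rule negligible_outer_le[THEN iffD2], intro allI impI)
  fix \<tau> :: real assume \<tau>: "0 < \<tau>"
  define m where "m = DIM('c) - DIM('b)"
  have sm: "s \<le> real m" "DIM('c) = DIM('b) + m" and m: "1 \<le> m" using s by (auto simp: m_def of_nat_diff)
  \<comment> \<open>Grid cardinality times ball volume with the powers of \<open>e i\<close>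
    removed. The factor \<open>3\<close> is one for the distance in \<open>U i\<close> plus two for
    two parameters in a common ball.\<close>
  define C where "C = (2 * R * DIM('b) + 3) ^ DIM('b) * (unit_ball_vol (DIM('c)) * (3 * L) ^ DIM('c))"
  have C: "0 \<le> C" unfolding C_def using R L by (intro mult_nonneg_nonneg zero_le_power) auto
  \<comment> \<open>Both the Hausdorff sum and the extra sizes \<open>\<eta>\<close> contribute
    \<open>\<epsilon>\<close>, hence \<open>2 * C\<close>; adding \<open>1\<close> avoids division
    by zero when \<open>C = 0\<close>.\<close>
  define \<epsilon> where "\<epsilon> = min 1 (\<tau> / (2 * C + 1))"
  have \<epsilon>: "0 < \<epsilon>" "\<epsilon> \<le> 1" using \<tau> C by (auto simp: \<epsilon>_def)
  have "\<epsilon> \<le> \<tau> / (2 * C + 1)" by (simp add: \<epsilon>_def)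
  then have "\<epsilon> * (2 * C + 1) \<le> \<tau>" using C by (simp add: pos_le_divide_eq)
  then have \<epsilon>C: "C * (\<epsilon> + \<epsilon>) \<le> \<tau>" using \<epsilon> by (simp add: algebra_simps)
  obtain U where U: "S \<subseteq> (\<Union>i. U i)" "\<And>i. bounded (U i)" "\<And>i. diameter (U i) \<le> 1"
    "(\<Sum>i. ennreal (diameter (U i) powr s)) < ennreal \<epsilon>"
    using hausdorff_null_cover[OF null \<epsilon>(1)] by blast
  \<comment> \<open>Covering sets of diameter \<open>0\<close> contribute nothing to the Hausdorff sum, hence the extra size \<open>\<eta> i\<close>.\<close>
  define \<eta> where "\<eta> i = \<epsilon> * (1 / 2) ^ Suc i" for i
  have \<eta>: "0 < \<eta> i" "\<eta> i \<le> 1" for i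
  proof -
    show "0 < \<eta> i" using \<epsilon> by (simp add: \<eta>_def)
    have "\<epsilon> * (1 / 2) ^ Suc i \<le> 1 * 1" using \<epsilon> by (intro mult_mono power_le_one) auto
    then show "\<eta> i \<le> 1" by (simp add: \<eta>_def)
  qed
  define e where "e i = max (diameter (U i)) (\<eta> i)" for i
  have e: "0 < e i" "e i \<le> 1" "diameter (U i) \<le> e i" for i using \<eta>[of i] U(3)[of i] by (auto simp: e_def)
  have em: "e i ^ m \<le> diameter (U i) powr s + \<eta> i" for i
  proof (cases "diameter (U i) \<le> \<eta> i")
    case True
    have "\<eta> i ^ m \<le> \<eta> i ^ 1" using \<eta>[of i] m by (intro power_decreasing) auto
    with True show ?thesis by (simp add: e_def max_absorb2 add_increasing)
  next
    case False
    then have pos: "0 < diameter (U i)" using \<eta>(1)[of i] by simp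
    then have "diameter (U i) ^ m = diameter (U i) powr real m" by (simp add: powr_realpow)
    also have "\<dots> \<le> diameter (U i) powr s"
      using pos U(3)[of i] sm(1) by (intro powr_mono') auto
    finally show ?thesis using False \<eta>(1)[of i] by (simp add: e_def max_absorb1)
  qed
  have "\<forall>i. \<exists>B. B \<in> sets lborel \<and> {F x t | x t. x \<in> S' \<inter> U i \<and> t \<in> cball 0 R} \<subseteq> B \<and>
      emeasure lborel B \<le> ennreal (C * e i ^ m)"
  proof
    fix i
    obtain Q :: "'b set" where Q: "finite Q" "cball 0 R \<subseteq> (\<Union>q\<in>Q. cball q (e i))"
      "real (card Q) \<le> ((2 * R * DIM('b) + 3) / e i) ^ DIM('b)"
      using cball_grid_cover[OF R e(1,2)] by blast
    define A where "A q = {F x t | x t. x \<in> S' \<inter> U i \<and> t \<in> cball 0 R \<inter> cball q (e i)}" for q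
    define c where "c q = (SOME z. z \<in> A q)" for q
    define B where "B = (\<Union>q\<in>Q. cball (c q) (3 * L * e i))"
    have AB: "A q \<subseteq> cball (c q) (3 * L * e i)" for q
    proof
      fix z assume z: "z \<in> A q"
      then have "c q \<in> A q" unfolding c_def by (rule someI)
      then obtain x t where c: "c q = F x t" "x \<in> S'" "x \<in> U i" "t \<in> cball 0 R" "t \<in> cball q (e i)"
        by (auto simp: A_def)
      obtain x' t' where z': "z = F x' t'" "x' \<in> S'" "x' \<in> U i" "t' \<in> cball 0 R" "t' \<in> cball q (e i)"
        using z by (auto simp: A_def)
      have "dist x x' \<le> e i"
        using diameter_bounded_bound[OF U(2) c(3) z'(3)] e(3)[of i] by simp
      moreover have "dist t t' \<le> 2 * e i"
        using dist_triangle2[of t t' q] c(5) z'(5) by (simp add: dist_commute)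
      ultimately have "L * (dist x x' + dist t t') \<le> L * (3 * e i)" using L by (intro mult_left_mono) auto
      with lip[OF c(2) z'(2) c(4) z'(4)] show "z \<in> cball (c q) (3 * L * e i)" by (simp add: c(1) z'(1) mult_ac)
    qed
    have sub: "{F x t | x t. x \<in> S' \<inter> U i \<and> t \<in> cball 0 R} \<subseteq> B"
    proof
      fix z assume "z \<in> {F x t | x t. x \<in> S' \<inter> U i \<and> t \<in> cball 0 R}"
      then obtain x t where z: "z = F x t" "x \<in> S' \<inter> U i" "t \<in> cball 0 R" by blast
      then obtain q where q: "q \<in> Q" "t \<in> cball q (e i)" using Q(2) by blast
      with z have "z \<in> A q" unfolding A_def by blast
      with q(1) AB show "z \<in> B" unfolding B_def by blast
    qed
    moreover have "emeasure lborel B \<le> ennreal (C * e i ^ m)"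
    proof -
      have "emeasure lborel B \<le> (\<Sum>q\<in>Q. emeasure lborel (cball (c q) (3 * L * e i)))"
        unfolding B_def by (intro emeasure_subadditive_finite Q(1)) auto
      also have "\<dots> = ennreal (real (card Q) * (unit_ball_vol (DIM('c)) * (3 * L * e i) ^ DIM('c)))"
        using L e(1)[of i] by (simp add: emeasure_cball ennreal_mult'' ennreal_of_nat_eq_real_of_nat less_imp_le)
      also have "\<dots> \<le> ennreal (C * e i ^ m)"
      proof (rule ennreal_leI)
        have "real (card Q) * (unit_ball_vol (DIM('c)) * (3 * L * e i) ^ DIM('c)) \<le>
          ((2 * R * DIM('b) + 3) / e i) ^ DIM('b) * (unit_ball_vol (DIM('c)) * (3 * L * e i) ^ DIM('c))"
          using L e(1)[of i] by (intro mult_right_mono Q(3)) (auto intro!: mult_nonneg_nonneg)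
        also have "\<dots> = C * e i ^ m"
          unfolding C_def sm(2) power_divide power_mult_distrib power_add using e(1)[of i]
          by (simp add: field_simps)
        finally show "real (card Q) * (unit_ball_vol (DIM('c)) * (3 * L * e i) ^ DIM('c)) \<le> C * e i ^ m" .
      qed
      finally show ?thesis .
    qed
    moreover have "B \<in> sets lborel" unfolding B_def using Q(1) by auto
    ultimately show "\<exists>B. B \<in> sets lborel \<and> {F x t | x t. x \<in> S' \<inter> U i \<and> t \<in> cball 0 R} \<subseteq> B \<and>
      emeasure lborel B \<le> ennreal (C * e i ^ m)" by (intro exI[of _ B] conjI)
  qed
  from choice[OF this] obtain B where B: "\<And>i. B i \<in> sets lborel" "\<And>i. {F x t | x t. x \<in> S' \<inter> U i \<and> t \<in> cball 0 R} \<subseteq> B i"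
      "\<And>i. emeasure lborel (B i) \<le> ennreal (C * e i ^ m)"
    by blast
  define T where "T = (\<Union>i. B i)"
  have T: "T \<in> sets lborel" unfolding T_def using B(1) by auto
  have "emeasure lborel T \<le> (\<Sum>i. emeasure lborel (B i))"
    unfolding T_def using B(1) by (intro emeasure_subadditive_countably) auto
  also have "\<dots> \<le> (\<Sum>i. ennreal C * (ennreal (diameter (U i) powr s) + ennreal (\<eta> i)))"
  proof (intro suminf_le)
    fix i
    have "ennreal (C * e i ^ m) \<le> ennreal (C * (diameter (U i) powr s + \<eta> i))"
      using C em[of i] by (intro ennreal_leI mult_left_mono) auto
    also have "\<dots> = ennreal C * (ennreal (diameter (U i) powr s) + ennreal (\<eta> i))"
      using C \<eta>(1)[of i] by (simp add: ennreal_mult' ennreal_plus less_imp_le)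
    finally show "emeasure lborel (B i) \<le> ennreal C * (ennreal (diameter (U i) powr s) + ennreal (\<eta> i))"
      using B(3)[of i] by (rule order_trans[rotated])
  qed auto
  also have "\<dots> = ennreal C * ((\<Sum>i. ennreal (diameter (U i) powr s)) + (\<Sum>i. ennreal (\<eta> i)))"
    by (simp add: ennreal_suminf_cmult suminf_add)
  also have "(\<Sum>i. ennreal (\<eta> i)) = ennreal \<epsilon>"
  proof (rule suminf_ennreal_eq)
    show "\<eta> sums \<epsilon>"
      unfolding \<eta>_def using sums_mult[OF power_half_series, of \<epsilon>] by simp
  qed (use \<eta> in \<open>auto intro: less_imp_le\<close>)
  also have "ennreal C * ((\<Sum>i. ennreal (diameter (U i) powr s)) + ennreal \<epsilon>) \<le> ennreal C * (ennreal \<epsilon> + ennreal \<epsilon>)"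
    using U(4) by (intro mult_left_mono add_right_mono) auto
  also have "\<dots> = ennreal (C * (\<epsilon> + \<epsilon>))" using C \<epsilon> by (simp add: ennreal_mult' del: ennreal_plus flip: ennreal_plus)
  also have "\<dots> \<le> ennreal \<tau>" using \<epsilon>C by (rule ennreal_leI)
  finally have le: "emeasure lborel T \<le> ennreal \<tau>" .
  then have eqm: "emeasure lebesgue T = emeasure lborel T" using T by simp
  show "\<exists>T. {F x t | x t. x \<in> S' \<and> t \<in> cball 0 R} \<subseteq> T \<and> T \<in> lmeasurable \<and> measure lebesgue T \<le> \<tau>"
  proof (intro exI conjI)
    show "{F x t | x t. x \<in> S' \<and> t \<in> cball 0 R} \<subseteq> T"
    proof
      fix z assume "z \<in> {F x t | x t. x \<in> S' \<and> t \<in> cball 0 R}"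
      then obtain x t where x: "z = F x t" "x \<in> S'" "t \<in> cball 0 R" by blast
      then obtain i where "x \<in> U i" using U(1) S' by blast
      with x B(2)[of i] show "z \<in> T" unfolding T_def by blast
    qed
    show "T \<in> lmeasurable" using T le eqm by (intro fmeasurableI) (auto intro: le_less_trans)
    show "measure lebesgue T \<le> \<tau>"
      using le eqm \<tau> by (simp add: measure_def enn2real_leI)
  qed
qed

text \<open>Fubini's theorem without measurability of \<open>T\<close>: it is applied to a Borel
  null set containing \<open>T\<close>.\<close>

lemma negligible_slices:
  fixes T :: "('a::euclidean_space \<times> 'b::euclidean_space) set"
  assumes "negligible T"
  shows "negligible {x. \<not> negligible {y. (x, y) \<in> T}}"
proof -
  obtain B where B: "B \<in> null_sets lborel" "T \<subseteq> B"
    using assms unfolding negligible_iff_null_sets null_sets_completion_iff2 by blast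
  have Bm: "B \<in> sets (lborel \<Otimes>\<^sub>M lborel)" unfolding lborel_prod using B(1) by (rule null_setsD2)
  have "0 = emeasure (lborel \<Otimes>\<^sub>M lborel) B" using B(1) by (simp add: lborel_prod null_sets_def)
  also have "\<dots> = (\<integral>\<^sup>+x. emeasure lborel (Pair x -` B) \<partial>lborel)"
    by (rule lborel.emeasure_pair_measure_alt[OF Bm])
  finally have "AE x in lborel. emeasure lborel (Pair x -` B) = 0"
    using lborel.measurable_emeasure_Pair[OF Bm] by (subst (asm) eq_commute) (simp add: nn_integral_0_iff_AE)
  then obtain N where N: "N \<in> null_sets lborel" "{x. emeasure lborel (Pair x -` B) \<noteq> 0} \<subseteq> N"
    by (auto elim!: AE_E2 simp: eventually_ae_filter)
  have "{x. \<not> negligible {y. (x, y) \<in> T}} \<subseteq> N"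
  proof
    fix x assume "x \<in> {x. \<not> negligible {y. (x, y) \<in> T}}"
    moreover have "negligible {y. (x, y) \<in> T}" if "emeasure lborel (Pair x -` B) = 0"
    proof -
      have "Pair x -` B \<in> null_sets lborel" using that sets_Pair1[OF Bm] by (intro null_setsI) auto
      then have "negligible (Pair x -` B)"
        unfolding negligible_iff_null_sets by (rule null_sets_completionI)
      then show ?thesis by (rule negligible_subset) (use B(2) in auto)
    qed
    ultimately show "x \<in> N" using N(2) by blast
  qed
  moreover have "negligible N" unfolding negligible_iff_null_sets using N(1) by (rule null_sets_completionI)
  ultimately show ?thesis by (rule negligible_subset[rotated])
qed

lemma negligible_collinear:
  fixes y :: "'a::euclidean_space"
  assumes "2 \<le> DIM('a)" "y \<noteq> 0"
  shows "negligible {z. collinear {0, y, z}}"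
proof (rule negligible_subset)
  have "dim (span {y}) \<le> 1" using dim_le_card[of "span {y}" "{y}"] by simp
  then show "negligible (span {y})" using assms by (intro negligible_lowdim) linarith
  show "{z. collinear {0, y, z}} \<subseteq> span {y}"
    using assms by (auto simp: collinear_lemma span_singleton)
qed

text \<open>After a transformation \<open>g\<close> taking \<open>e\<close> to \<open>e'\<close>,
  the reflection exchanging \<open>g f\<close> and \<open>f'\<close> finishes the job; it fixes
  \<open>e'\<close>, which is orthogonal to both.\<close>

lemma orthogonal_matrix_orthonormal_pair:
  fixes e f e' f' :: "real ^ 'd"
  assumes "norm e = 1" "norm f = 1" "e \<bullet> f = 0" "norm e' = 1" "norm f' = 1" "e' \<bullet> f' = 0"
  obtains A where "orthogonal_matrix A" "A *v e = e'" "A *v f = f'"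
proof -
  have "norm e = norm e'" using assms by simp
  from orthogonal_transformation_exists[OF this]
  obtain g :: "real ^ 'd \<Rightarrow> real ^ 'd" where g: "orthogonal_transformation g" "g e = e'" .
  define w where "w = g f - f'"
  have gf: "norm (g f) = 1" "e' \<bullet> g f = 0"
    using g assms orthogonal_transformation_norm[OF g(1)]
    by (auto simp: orthogonal_transformation_def)
  \<comment> \<open>The reflection in the hyperplane orthogonal to \<open>w\<close>; for
    \<open>w = 0\<close> division by zero makes it the identity, as desired.\<close>
  define h where "h v = v - (2 * (v \<bullet> w) / (w \<bullet> w)) *\<^sub>R w" for v
  have "orthogonal_transformation h"
    unfolding orthogonal_transformation
  proof (intro conjI allI)
    show "linear h"
      by (rule linearI) (auto simp: h_def inner_add_left algebra_simps add_divide_distrib)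
    fix v
    have "h v \<bullet> h v = v \<bullet> v"
    proof (cases "w = 0")
      case False
      then have "w \<bullet> w \<noteq> 0" by simp
      then show ?thesis
        unfolding h_def inner_diff_left inner_diff_right inner_scaleR_left inner_scaleR_right inner_commute[of w v]
        by (simp add: field_simps)
    qed (simp add: h_def)
    then show "norm (h v) = norm v" by (simp add: norm_eq_sqrt_inner)
  qed
  then have hg: "orthogonal_transformation (h \<circ> g)"
    using g(1) by (rule orthogonal_transformation_compose)
  have "h e' = e'" using gf(2) assms(6) by (simp add: h_def w_def inner_diff_right)
  moreover have "h (g f) = f'"
  proof (cases "w = 0")
    case False
    have "w \<bullet> w = 2 * (g f \<bullet> w)"
    proof -
      have "g f \<bullet> g f = 1" "f' \<bullet> f' = 1" using gf(1) assms(5) by (simp_all add: norm_eq_1)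
      then show ?thesis
        unfolding w_def inner_diff_left inner_diff_right by (simp add: inner_commute[of f' "g f"])
    qed
    moreover have "w \<bullet> w \<noteq> 0" using False by simp
    ultimately show ?thesis by (simp add: h_def w_def)
  qed (simp add: h_def w_def)
  moreover have "linear (h \<circ> g)" "orthogonal_matrix (matrix (h \<circ> g))"
    using hg orthogonal_transformation_matrix by blast+
  ultimately show thesis
    by (intro that[of "matrix (h \<circ> g)"]) (simp_all add: g(2) matrix_works)
qed


text \<open>A null \<open>s\<close>-dimensional measure with \<open>s\<close> below 2d - 2 would,
  after adding three parameters, give a null image in a space of dimension 2d + 1. Rotation
  invariance makes this image too large for that.\<close>

lemma hausdorff_dim_rotation_invariant:
  fixes S :: "((real ^ 'd) ^ 'n) set" and J :: "real set"
  assumes d: "2 \<le> CARD('d)"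
    and inv: "\<And>A x. orthogonal_matrix A \<Longrightarrow> x \<in> S \<Longrightarrow> (\<chi> i. A *v x $ i) \<in> S"
    and J: "J \<subseteq> {0<..}" "\<not> negligible J"
    and JS: "\<And>r. r \<in> J \<Longrightarrow> \<exists>x\<in>S. norm (x $ one) = r \<and> (\<exists>i. \<not> collinear {0, x $ one, x $ i})"
  shows "ereal (2 * real CARD('d) - 2) \<le> hausdorff_dim S"
  unfolding hausdorff_dim_def
proof (intro INF_greatest, clarify)
  fix s :: real assume s: "0 < s" and null: "hausdorff_measure s S = 0"
  show "ereal (2 * real CARD('d) - 2) \<le> ereal s"
  proof (rule ccontr)
    assume "\<not> ereal (2 * real CARD('d) - 2) \<le> ereal s"
    then have s2: "s < 2 * real CARD('d) - 2" by simp
    \<comment> \<open>The map \<open>F\<close> needs a fixed second index. Since \<open>J\<close> is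
      a finite union of the sets \<open>Ji i\<close>, one of them is not negligible; their
      measurability is left open.\<close>
    define Ji where "Ji i = {r \<in> J. \<exists>x\<in>S. norm (x $ one) = r \<and> \<not> collinear {0, x $ one, x $ i}}" for i
    have "J = (\<Union>i. Ji i)" using JS unfolding Ji_def by blast
    then obtain i where i: "\<not> negligible (Ji i)"
      using J(2) negligible_Union[of "range Ji"] by auto
    define F where "F x \<tau> = (case \<tau> of (p, a, b) \<Rightarrow> ((norm (x $ one), p *\<^sub>R x $ one), a *\<^sub>R x $ i + b *\<^sub>R x $ one))"
      for x :: "(real ^ 'd) ^ 'n" and \<tau> :: "real \<times> real \<times> real"
    \<comment> \<open>Products of parameters and vectors are Lipschitz only on bounded sets, hence
      the exhaustion by balls.\<close>
    define E where "E n = {F x \<tau> | x \<tau>. x \<in> S \<inter> cball 0 (real n) \<and> \<tau> \<in> cball 0 (real n)}" for n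
    have "negligible (E n)" for n
      unfolding E_def
    \<comment> \<open>The constant collects \<open>1\<close> from the norm component,
      \<open>n\<close> from the scaled first vector and \<open>2 * n\<close> from the two summands
      of the last component.\<close>
    proof (rule negligible_Lipschitz_image_hausdorff_null[OF null s, where L = "1 + 3 * real n"])
      show "s + real DIM(real \<times> real \<times> real) \<le> real DIM((real \<times> (real ^ 'd)) \<times> (real ^ 'd))"
        using s2 by simp
      fix x x' :: "(real ^ 'd) ^ 'n" and \<tau> \<tau>' :: "real \<times> real \<times> real"
      assume x: "x \<in> S \<inter> cball 0 (real n)" "x' \<in> S \<inter> cball 0 (real n)"
        and \<tau>: "\<tau> \<in> cball 0 (real n)" "\<tau>' \<in> cball 0 (real n)"
      obtain p a b where t: "\<tau> = (p, a, b)" by (cases \<tau>)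
      obtain p' a' b' where t': "\<tau>' = (p', a', b')" by (cases \<tau>')
      define D where "D = dist x x'"
      define T where "T = dist \<tau> \<tau>'"
      have T0: "0 \<le> T" by (simp add: T_def)
      have nth: "dist (x $ k) (x' $ k) \<le> D" for k by (simp add: D_def dist_vec_nth_le)
      have xn: "norm (x' $ k) \<le> n" for k
        using x(2) Finite_Cartesian_Product.norm_nth_le[of x' k] by simp
      have tn: "\<bar>p\<bar> \<le> n" "\<bar>a\<bar> \<le> n" "\<bar>b\<bar> \<le> n"
        using \<tau>(1) norm_fst_le[of p "(a, b)"] norm_snd_le[of "(a, b)" p] norm_fst_le[of a b] norm_snd_le[of b a]
        by (auto simp: t)
      have tt: "\<bar>p - p'\<bar> \<le> T" "\<bar>a - a'\<bar> \<le> T" "\<bar>b - b'\<bar> \<le> T"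
        using dist_fst_le[of \<tau> \<tau>'] dist_snd_le[of \<tau> \<tau>'] dist_fst_le[of "(a, b)" "(a', b')"] dist_snd_le[of "(a, b)" "(a', b')"]
        by (auto simp: t t' T_def dist_real_def)
      have scale: "norm (c *\<^sub>R x $ k - c' *\<^sub>R x' $ k) \<le> n * (D + T)" if c: "\<bar>c\<bar> \<le> n" "\<bar>c - c'\<bar> \<le> T" for c c' :: real and k
      proof -
        have "c *\<^sub>R x $ k - c' *\<^sub>R x' $ k = c *\<^sub>R (x $ k - x' $ k) + (c - c') *\<^sub>R x' $ k"
          by (simp add: algebra_simps)
        also have "norm \<dots> \<le> \<bar>c\<bar> * norm (x $ k - x' $ k) + \<bar>c - c'\<bar> * norm (x' $ k)"
          by (rule order_trans[OF norm_triangle_ineq]) simp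
        also have "\<dots> \<le> n * D + T * n"
        proof (rule add_mono)
          show "\<bar>c\<bar> * norm (x $ k - x' $ k) \<le> n * D"
            using c(1) nth[of k] unfolding dist_norm by (rule mult_mono) simp_all
          show "\<bar>c - c'\<bar> * norm (x' $ k) \<le> T * n"
            using c(2) xn[of k] by (rule mult_mono) (simp_all add: T_def)
        qed
        finally show ?thesis by (simp add: algebra_simps)
      qed
      have "norm (F x \<tau> - F x' \<tau>') \<le> (\<bar>norm (x $ one) - norm (x' $ one)\<bar> + norm (p *\<^sub>R x $ one - p' *\<^sub>R x' $ one))
          + norm ((a *\<^sub>R x $ i + b *\<^sub>R x $ one) - (a' *\<^sub>R x' $ i + b' *\<^sub>R x' $ one))"
        unfolding F_def t t' by (auto intro!: order_trans[OF norm_Pair_le] add_right_mono)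
      also have "(a *\<^sub>R x $ i + b *\<^sub>R x $ one) - (a' *\<^sub>R x' $ i + b' *\<^sub>R x' $ one) =
          (a *\<^sub>R x $ i - a' *\<^sub>R x' $ i) + (b *\<^sub>R x $ one - b' *\<^sub>R x' $ one)" by simp
      also have "norm \<dots> \<le> n * (D + T) + n * (D + T)"
        by (rule order_trans[OF norm_triangle_ineq]) (intro add_mono scale tn tt)
      also have "norm (p *\<^sub>R x $ one - p' *\<^sub>R x' $ one) \<le> n * (D + T)" by (intro scale tn tt)
      also have "\<bar>norm (x $ one) - norm (x' $ one)\<bar> \<le> D + T"
        using norm_triangle_ineq3[of "x $ one" "x' $ one"] nth[of one] T0
        unfolding dist_norm by linarith
      finally show "dist (F x \<tau>) (F x' \<tau>') \<le> (1 + 3 * real n) * (dist x x' + dist \<tau> \<tau>')"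
        by (simp add: dist_norm[of "F x \<tau>"] D_def[symmetric] T_def[symmetric] algebra_simps)
    qed auto
    then have neg: "negligible (\<Union>n. E n)" by (intro negligible_countable_Union) auto
    have mem: "((r, y), z) \<in> (\<Union>n. E n)" if r: "r \<in> Ji i" and y: "y \<noteq> 0" and z: "\<not> collinear {0, y, z}" for r y z
    proof -
      obtain x where x: "x \<in> S" "norm (x $ one) = r" "\<not> collinear {0, x $ one, x $ i}" and r0: "r \<in> J"
        using r by (auto simp: Ji_def)
      have rpos: "0 < r" using r0 J(1) by auto
      \<comment> \<open>One Gram-Schmidt step, applied both to the given configuration and to the
        target pair so that a rotation can match the frames.\<close>
      have split: "\<exists>e f c g. norm e = 1 \<and> norm f = 1 \<and> e \<bullet> f = 0 \<and> u = norm u *\<^sub>R e \<and> w = c *\<^sub>R e + g *\<^sub>R f \<and> g \<noteq> 0"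
        if "\<not> collinear {0, u, w}" for u w :: "real ^ 'd"
      proof -
        have u0: "u \<noteq> 0" using that by (auto simp: collinear_lemma)
        define e where "e = u /\<^sub>R norm u"
        define g where "g = w - (w \<bullet> e) *\<^sub>R e"
        have e: "norm e = 1" "u = norm u *\<^sub>R e" using u0 by (auto simp: e_def)
        have g0: "g \<noteq> 0"
        proof
          assume "g = 0"
          then have "w = ((w \<bullet> e) / norm u) *\<^sub>R u" by (simp add: g_def e_def divide_inverse mult_ac)
          with that show False by (auto simp: collinear_lemma)
        qed
        have "e \<bullet> g = 0" using e(1) by (simp add: g_def inner_diff_right inner_commute norm_eq_1)
        then show ?thesis
          using e g0 by (intro exI[of _ e] exI[of _ "g /\<^sub>R norm g"] exI[of _ "w \<bullet> e"] exI[of _ "norm g"]) (simp add: g_def)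
      qed
      obtain e f c g where ef: "norm e = 1" "norm f = 1" "e \<bullet> f = 0" "x $ one = norm (x $ one) *\<^sub>R e" "x $ i = c *\<^sub>R e + g *\<^sub>R f" "g \<noteq> 0"
        using split[OF x(3)] by blast
      obtain e' f' c' g' where ef': "norm e' = 1" "norm f' = 1" "e' \<bullet> f' = 0" "y = norm y *\<^sub>R e'" "z = c' *\<^sub>R e' + g' *\<^sub>R f'" "g' \<noteq> 0"
        using split[OF z] by blast
      obtain A where A: "orthogonal_matrix A" "A *v e = e'" "A *v f = f'"
        using orthogonal_matrix_orthonormal_pair[OF ef(1-3) ef'(1-3)] by blast
      define x' where "x' = (\<chi> i. A *v x $ i)"
      have x'S: "x' \<in> S" unfolding x'_def by (rule inv[OF A(1) x(1)])
      have x1: "x' $ one = r *\<^sub>R e'" unfolding x'_def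
        by (simp, subst ef(4)) (simp add: x(2) matrix_vector_mult_scaleR A)
      have xi: "x' $ i = c *\<^sub>R e' + g *\<^sub>R f'"
        unfolding x'_def by (simp add: ef(5) matrix_vector_right_distrib matrix_vector_mult_scaleR A)
      \<comment> \<open>Once the frames agree, these parameters solve a triangular linear system:
        first the length of \<open>y\<close>, then the \<open>f'\<close>-coordinate of
        \<open>z\<close>, then its \<open>e'\<close>-coordinate.\<close>
      define \<tau> where "\<tau> = (norm y / r, g' / g, (c' - g' / g * c) / r)"
      have "F x' \<tau> = ((r, y), z)"
      proof -
        have "(norm y / r) *\<^sub>R x' $ one = y" unfolding x1 using rpos ef'(4) by simp
        moreover have "(g' / g) *\<^sub>R x' $ i + ((c' - g' / g * c) / r) *\<^sub>R x' $ one = z"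
        proof -
          have "(g' / g) *\<^sub>R x' $ i + ((c' - g' / g * c) / r) *\<^sub>R x' $ one =
              ((g' / g) * c + ((c' - g' / g * c) / r) * r) *\<^sub>R e' + ((g' / g) * g) *\<^sub>R f'"
            unfolding x1 xi by (simp only: scaleR_add_right scaleR_add_left scaleR_scaleR add_ac)
          then show ?thesis using rpos ef(6) by (simp add: ef'(5))
        qed
        moreover have "norm (x' $ one) = r" unfolding x1 using rpos ef'(1) by simp
        ultimately show ?thesis by (simp add: F_def \<tau>_def)
      qed
      moreover obtain n :: nat where "max (norm x') (norm \<tau>) \<le> real n" using real_arch_simple by blast
      then have "x' \<in> cball 0 (real n)" "\<tau> \<in> cball 0 (real n)" by auto
      ultimately have "((r, y), z) \<in> E n" using x'S unfolding E_def by (intro CollectI exI[of _ x'] exI[of _ \<tau>]) auto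
      then show ?thesis by blast
    qed
    have big: "\<not> negligible A" if "negligible (- A)" for A :: "(real ^ 'd) set"
    proof
      assume "negligible A"
      with that have "negligible (A \<union> - A)" by (rule negligible_Un[rotated])
      then show False by simp
    qed
    \<comment> \<open>For \<open>r\<close> in \<open>Ji i\<close> and \<open>y \<noteq> 0\<close>
      the slice over \<open>(r, y)\<close> contains every \<open>z\<close> off the line of
      \<open>y\<close>, so it is not null. Slicing twice would then make \<open>Ji i\<close>
      null.\<close>
    define N1 where "N1 = {q. \<not> negligible {z. (q, z) \<in> (\<Union>n. E n)}}"
    have "negligible N1" unfolding N1_def by (rule negligible_slices[OF neg])
    then have "negligible {r. \<not> negligible {y. (r, y) \<in> N1}}" by (rule negligible_slices)
    moreover have "Ji i \<subseteq> {r. \<not> negligible {y. (r, y) \<in> N1}}"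
    proof (intro subsetI CollectI big)
      fix r assume r: "r \<in> Ji i"
      have "(r, y) \<in> N1" if y: "y \<noteq> 0" for y
        unfolding N1_def
      proof (intro CollectI big)
        have "negligible {z. collinear {0, y, z}}" using d y by (intro negligible_collinear) simp_all
        then show "negligible (- {z. ((r, y), z) \<in> (\<Union>n. E n)})"
          by (rule negligible_subset) (use mem[OF r y] in blast)
      qed
      then have "- {y. (r, y) \<in> N1} \<subseteq> {0}" by blast
      then show "negligible (- {y. (r, y) \<in> N1})" by (rule negligible_subset[rotated]) simp
    qed
    ultimately show False using i negligible_subset by blast
  qed
qed

section \<open>Finiteness of the reduced cost on the support\<close>

lemma independent_plan:
  fixes M :: "'n::finite \<Rightarrow> real measure"
  assumes M: "\<And>i. prob_space (M i)" "\<And>i. sets (M i) = sets borel"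
  obtains \<beta> :: "(real ^ 'n) measure"
  where "prob_space \<beta>" "sets \<beta> = sets borel" "\<And>i. distr \<beta> borel (\<lambda>x. x $ i) = M i"
proof -
  interpret product_prob_space M UNIV
    unfolding product_prob_space_def product_prob_space_axioms_def product_sigma_finite_def
    using M(1) by (auto intro: prob_space_imp_sigma_finite)
  note M(2)[measurable_cong]
  have m: "(\<lambda>f. \<chi> i. f i) \<in> borel_measurable (Pi\<^sub>M UNIV M)"
    by (intro borel_measurable_vecI) simp
  have "distr (distr (Pi\<^sub>M UNIV M) borel (\<lambda>f. \<chi> i. f i)) borel (\<lambda>x. x $ i) = M i" for i
  proof -
    have "distr (distr (Pi\<^sub>M UNIV M) borel (\<lambda>f. \<chi> i. f i)) borel (\<lambda>x. x $ i) = distr (Pi\<^sub>M UNIV M) borel (\<lambda>f. f i)"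
      using m by (subst distr_distr) (auto simp: comp_def)
    also have "\<dots> = distr (Pi\<^sub>M UNIV M) (M i) (\<lambda>f. f i)"
      by (intro distr_cong) (auto simp: M(2))
    finally show ?thesis by (simp add: PiM_component)
  qed
  then show thesis by (intro that[of "distr (Pi\<^sub>M UNIV M) borel (\<lambda>f. \<chi> i. f i)"] prob_space_distr m) auto
qed

lemma AE_marginal:
  fixes \<beta> :: "(real ^ 'n) measure"
  assumes "sets \<beta> = sets borel" "AE r in distr \<beta> borel (\<lambda>x. x $ i). Q r" "Measurable.pred borel Q"
  shows "AE x in \<beta>. Q (x $ i)"
  using assms by (subst (asm) AE_distr_iff) (auto cong: measurable_cong_sets)

text \<open>The sum of measures is encoded as the bind of counting measure with the kernel
  \<open>M\<close>; this explains the restriction to subprobability measures.\<close>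

lemma measure_sum_exists:
  fixes M :: "'k::finite \<Rightarrow> 'a measure"
  assumes M: "\<And>k. subprob_space (M k)" "\<And>k. sets (M k) = sets B"
  obtains S where "sets S = sets B"
    "\<And>f. f \<in> borel_measurable B \<Longrightarrow> (\<integral>\<^sup>+x. f x \<partial>S) = (\<Sum>k\<in>UNIV. \<integral>\<^sup>+x. f x \<partial>M k)"
proof (rule that[of "count_space UNIV \<bind> M"])
  have Mm: "M \<in> measurable (count_space UNIV) (subprob_algebra B)"
    using M by (auto simp: space_subprob_algebra)
  show "sets (count_space UNIV \<bind> M) = sets B" using Mm by (rule sets_bind_measurable) simp
  show "(\<integral>\<^sup>+x. f x \<partial>(count_space UNIV \<bind> M)) = (\<Sum>k\<in>UNIV. \<integral>\<^sup>+x. f x \<partial>M k)" if "f \<in> borel_measurable B" for f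
    using that Mm by (simp add: nn_integral_bind nn_integral_count_space_finite)
qed

text \<open>Mass of \<open>\<gamma>\<close> on \<open>V\<close> is combined with \<open>CARD('n) - 1\<close> times as much mass on the region where all
  coordinates are at least \<open>a\<close>: the new plan draws one coordinate from the former and the others,
  independently, from the latter. This keeps the marginals, and at most one coordinate is small.\<close>

lemma coupling_rearrangement:
  fixes \<gamma> :: "(real ^ 'n) measure" and h :: "real ^ 'n \<Rightarrow> ennreal"
  assumes N2: "2 \<le> CARD('n)"
    and \<gamma>: "\<gamma> \<in> couplings \<mu>" and \<mu>: "sets \<mu> = sets borel" "AE r in \<mu>. 0 \<le> r"
    and a: "of_nat (CARD('n) * CARD('n)) * emeasure \<mu> {..<a} \<le> 1"
    and V: "V \<in> sets borel" "V \<subseteq> {w. \<exists>i. w $ i < a}" "emeasure \<gamma> V \<noteq> 0"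
    and h[measurable]: "h \<in> borel_measurable borel"
    and hC: "\<forall>w j. (\<forall>i. 0 \<le> w $ i) \<longrightarrow> (\<forall>i. i \<noteq> j \<longrightarrow> a \<le> w $ i) \<longrightarrow> h w \<le> C"
  obtains \<gamma>' where "\<gamma>' \<in> couplings \<mu>"
    "(\<integral>\<^sup>+w. h w \<partial>\<gamma>') \<le> (\<integral>\<^sup>+w. h w * indicator (- V) w \<partial>\<gamma>) + emeasure \<gamma> V * (of_nat CARD('n) * C)"
proof -
  interpret prob_space \<gamma> using \<gamma> by (rule couplingsD)
  note s\<gamma>[measurable_cong] = couplingsD(2)[OF \<gamma>]
  note V(1)[measurable]
  define W where "W = {w :: real ^ 'n. \<forall>i. a \<le> w $ i}"
  have W[measurable]: "W \<in> sets borel" unfolding W_def by measurable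
  define q where "q = emeasure \<gamma> V"
  define N where "N = CARD('n)"
  have N: "1 \<le> N" by (simp add: N_def Suc_leI)
  have fin: "q < top" "emeasure \<gamma> W < top" by (simp_all add: q_def emeasure_eq_measure)
  have VW: "V \<inter> W = {}" using V(2) by (auto simp: W_def not_le[symmetric])
  have E: "emeasure \<gamma> {w. w $ i < a} = emeasure \<mu> {..<a}" for i
  proof -
    have "emeasure \<mu> {..<a} = emeasure (distr \<gamma> borel (\<lambda>x. x $ i)) {..<a}" by (simp only: couplingsD(3)[OF \<gamma>])
    also have "\<dots> = emeasure \<gamma> {w. w $ i < a}"
      by (subst emeasure_distr) (auto simp: sets_eq_imp_space_eq[OF s\<gamma>] vimage_def)
    finally show ?thesis by simp
  qed
  have cW: "- W \<in> sets \<gamma>" using W by (simp add: s\<gamma>)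
  \<comment> \<open>By the union bound at most a fraction 1/N of the mass lies outside
    \<open>W\<close>, and \<open>V\<close> is part of it. So (N - 1) times the mass of
    \<open>V\<close> is at most 1 - 1/N, hence at most the mass of \<open>W\<close>.\<close>
  have q_le: "of_nat (N - 1) * q \<le> emeasure \<gamma> W"
  proof -
    have "emeasure \<gamma> (- W) = emeasure \<gamma> (\<Union>i. {w. w $ i < a})" by (rule arg_cong[of _ _ "emeasure \<gamma>"]) (auto simp: W_def simp flip: not_le)
    also have "\<dots> \<le> (\<Sum>i\<in>UNIV. emeasure \<gamma> {w. w $ i < a})"
      by (intro emeasure_subadditive_finite) (auto simp: s\<gamma>)
    also have "\<dots> = of_nat N * emeasure \<mu> {..<a}" by (simp add: E N_def)
    finally have "of_nat N * emeasure \<gamma> (- W) \<le> of_nat N * (of_nat N * emeasure \<mu> {..<a})" by (rule mult_left_mono) simp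
    also have "\<dots> \<le> 1" using a by (simp add: N_def mult.assoc)
    finally have le1: "of_nat N * emeasure \<gamma> (- W) \<le> 1" .
    have "measure \<gamma> (- W) = 1 - measure \<gamma> W"
      using prob_compl[of W] W by (simp add: s\<gamma> sets_eq_imp_space_eq[OF s\<gamma>] Compl_eq_Diff_UNIV)
    moreover have "real N * measure \<gamma> (- W) \<le> 1"
      using le1 by (simp add: emeasure_eq_measure ennreal_of_nat_eq_real_of_nat ennreal_mult'[symmetric] del: ennreal_1 flip: ennreal_1)
    moreover have "measure \<gamma> V \<le> measure \<gamma> (- W)"
      using VW by (intro finite_measure_mono cW) auto
    then have "real (N - 1) * measure \<gamma> V \<le> real (N - 1) * measure \<gamma> (- W)" by (intro mult_left_mono) auto
    ultimately have "real (N - 1) * measure \<gamma> V \<le> measure \<gamma> W"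
      using N by (simp add: of_nat_diff algebra_simps)
    then show ?thesis unfolding q_def
      by (simp add: emeasure_eq_measure ennreal_of_nat_eq_real_of_nat ennreal_mult'[symmetric])
  qed
  have q0: "q \<noteq> 0" using V(3) by (simp add: q_def)
  have W0: "emeasure \<gamma> W \<noteq> 0"
  proof
    assume "emeasure \<gamma> W = 0"
    with q_le q0 show False using N2 by (simp add: N_def)
  qed
  \<comment> \<open>The fraction of the mass on \<open>W\<close> that is used up; it amounts to
    \<open>(N - 1) * q\<close>. The density \<open>g\<close> below describes what stays in
    place.\<close>
  define c where "c = of_nat (N - 1) * q / emeasure \<gamma> W"
  have c1: "c \<le> 1"
    using divide_right_mono_ennreal[OF q_le, of "emeasure \<gamma> W"] W0 fin(2) by (simp add: c_def)
  define g :: "real ^ 'n \<Rightarrow> ennreal" where "g w = (if w \<in> V then 0 else if w \<in> W then 1 - c else 1)" for w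
  have [measurable]: "g \<in> borel_measurable borel" unfolding g_def[abs_def] by measurable
  define X where "X j i = (if i = j then V else W)" for i j :: 'n
  have X[measurable]: "X j i \<in> sets borel" for i j by (simp add: X_def)
  have Xpos: "emeasure \<gamma> (X j i) \<noteq> 0" for i j using V(3) W0 by (simp add: X_def)
  \<comment> \<open>In the \<open>j\<close>-th new plan coordinate \<open>j\<close> follows
    \<open>\<gamma>\<close> conditioned on \<open>V\<close>, every other coordinate follows
    \<open>\<gamma>\<close> conditioned on \<open>W\<close>.\<close>
  define M where "M j i = distr (uniform_measure \<gamma> (X j i)) borel (\<lambda>w. w $ i)" for i j :: 'n
  have U: "prob_space (uniform_measure \<gamma> (X j i))" for i j
    using Xpos by (intro prob_space_uniform_measure) auto
  have M: "prob_space (M j i)" "sets (M j i) = sets borel" for i j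
    unfolding M_def by (auto intro!: prob_space.prob_space_distr[OF U])
  have eM: "emeasure (M j i) A = emeasure \<gamma> (X j i \<inter> {w. w $ i \<in> A}) / emeasure \<gamma> (X j i)"
    if [measurable]: "A \<in> sets borel" for i j A
  proof -
    have "{w :: real ^ 'n. w $ i \<in> A} \<in> sets borel" by measurable
    then show ?thesis unfolding M_def
      by (subst emeasure_distr) (auto simp: s\<gamma> sets_eq_imp_space_eq[OF s\<gamma>] vimage_def emeasure_uniform_measure)
  qed
  have "\<exists>\<beta> :: (real ^ 'n) measure. prob_space \<beta> \<and> sets \<beta> = sets borel \<and> (\<forall>i. distr \<beta> borel (\<lambda>x. x $ i) = M j i)" for j
    using independent_plan[of "M j"] M by metis
  then obtain \<beta> :: "'n \<Rightarrow> (real ^ 'n) measure" where \<beta>: "\<And>j. prob_space (\<beta> j)" "\<And>j. sets (\<beta> j) = sets borel"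
      "\<And>i j. distr (\<beta> j) borel (\<lambda>x. x $ i) = M j i"
    by metis
  \<comment> \<open>Each of the \<open>N\<close> new plans gets mass \<open>q\<close>. Coordinate
    \<open>i\<close> thus regains its part of \<open>V\<close> from the plan \<open>j = i\<close>
    and its part of \<open>W\<close> from the other \<open>N - 1\<close> plans.\<close>
  define K where "K k = (case k of None \<Rightarrow> density \<gamma> g | Some j \<Rightarrow> density (\<beta> j) (\<lambda>_. q))" for k
  have K: "subprob_space (K k)" "sets (K k) = sets borel" for k
  proof -
    have "emeasure (K k) (space (K k)) \<le> 1"
    proof (cases k)
      case None
      have "(\<integral>\<^sup>+w. g w \<partial>\<gamma>) \<le> (\<integral>\<^sup>+w. 1 \<partial>\<gamma>)" by (intro nn_integral_mono) (auto simp: g_def diff_le_self_ennreal)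
      then show ?thesis using None by (simp add: K_def emeasure_density emeasure_space_1 cong: nn_integral_cong)
    next
      case (Some j)
      have "q \<le> 1" unfolding q_def by (rule emeasure_le_1)
      then show ?thesis using Some prob_space.emeasure_space_1[OF \<beta>(1)[of j]]
        by (simp add: K_def emeasure_density cong: nn_integral_cong)
    qed
    moreover have "space (K k) \<noteq> {}"
      using sets_eq_imp_space_eq[OF s\<gamma>] sets_eq_imp_space_eq[OF \<beta>(2)] by (auto simp: K_def split: option.split)
    ultimately show "subprob_space (K k)" by (rule subprob_spaceI)
    show "sets (K k) = sets borel" by (auto simp: K_def s\<gamma> \<beta>(2) split: option.split)
  qed
  obtain \<gamma>' where s\<gamma>': "sets \<gamma>' = sets borel"
    and intK: "\<And>f. f \<in> borel_measurable borel \<Longrightarrow> (\<integral>\<^sup>+x. f x \<partial>\<gamma>') = (\<Sum>k\<in>UNIV. \<integral>\<^sup>+x. f x \<partial>K k)"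
    using measure_sum_exists[of K borel] K by metis
  have int\<gamma>': "(\<integral>\<^sup>+x. f x \<partial>\<gamma>') = (\<integral>\<^sup>+x. g x * f x \<partial>\<gamma>) + (\<Sum>j\<in>UNIV. q * (\<integral>\<^sup>+x. f x \<partial>\<beta> j))"
    if [measurable]: "f \<in> borel_measurable borel" for f
  proof -
    note \<beta>(2)[measurable_cong]
    have "(\<integral>\<^sup>+x. f x \<partial>\<gamma>') = (\<Sum>k\<in>UNIV. \<integral>\<^sup>+x. f x \<partial>K k)" by (rule intK) fact
    also have "\<dots> = (\<integral>\<^sup>+x. f x \<partial>K None) + (\<Sum>j\<in>UNIV. \<integral>\<^sup>+x. f x \<partial>K (Some j))"
      by (simp add: UNIV_option_conv sum.reindex)
    finally show ?thesis by (simp add: K_def nn_integral_density nn_integral_cmult)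
  qed
  have marg: "distr \<gamma>' borel (\<lambda>x. x $ i) = \<mu>" for i
  proof (rule measure_eqI)
    note s\<gamma>'[measurable_cong] \<beta>(2)[measurable_cong]
    fix A assume "A \<in> sets (distr \<gamma>' borel (\<lambda>x. x $ i))"
    then have A[measurable]: "A \<in> sets borel" by simp
    define Ai where "Ai = {w :: real ^ 'n. w $ i \<in> A}"
    have Ai[measurable]: "Ai \<in> sets borel" unfolding Ai_def by measurable
    have marg_em: "emeasure (distr \<delta> borel (\<lambda>x. x $ i)) A = (\<integral>\<^sup>+x. indicator Ai x \<partial>\<delta>)" if "sets \<delta> = sets borel" for \<delta> :: "(real ^ 'n) measure"
      using Ai that sets_eq_imp_space_eq[OF that]
      by (subst emeasure_distr) (auto simp: Ai_def vimage_def cong: measurable_cong_sets)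
    have "emeasure (distr \<gamma>' borel (\<lambda>x. x $ i)) A = (\<integral>\<^sup>+x. g x * indicator Ai x \<partial>\<gamma>) + (\<Sum>j\<in>UNIV. q * emeasure (M j i) A)"
      unfolding marg_em[OF s\<gamma>'] \<beta>(3)[symmetric] marg_em[OF \<beta>(2)] by (rule int\<gamma>') simp
    also have "(\<Sum>j\<in>UNIV. q * emeasure (M j i) A) = q * emeasure (M i i) A + (\<Sum>j\<in>UNIV - {i}. q * emeasure (M j i) A)"
      by (subst sum.remove[of _ i]) auto
    also have "q * emeasure (M i i) A = emeasure \<gamma> (V \<inter> Ai)"
      using q0 fin(1) by (simp add: eM X_def Ai_def flip: q_def) (simp add: ennreal_times_divide mult.commute[of q] mult_divide_eq_ennreal)
    also have "(\<Sum>j\<in>UNIV - {i}. q * emeasure (M j i) A) = (\<Sum>j\<in>UNIV - {i}. q * (emeasure \<gamma> (W \<inter> Ai) / emeasure \<gamma> W))"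
      by (intro sum.cong) (auto simp: eM X_def Ai_def)
    also have "\<dots> = c * emeasure \<gamma> (W \<inter> Ai)"
      by (simp add: c_def N_def ennreal_times_divide ennreal_divide_times mult_ac)
    also have "(\<integral>\<^sup>+x. g x * indicator Ai x \<partial>\<gamma>) + (emeasure \<gamma> (V \<inter> Ai) + c * emeasure \<gamma> (W \<inter> Ai)) =
        (\<integral>\<^sup>+x. g x * indicator Ai x + (indicator (V \<inter> Ai) x + c * indicator (W \<inter> Ai) x) \<partial>\<gamma>)"
      by (simp add: nn_integral_add nn_integral_cmult s\<gamma>)
    also have "\<dots> = (\<integral>\<^sup>+x. indicator Ai x \<partial>\<gamma>)"
    proof (rule nn_integral_cong)
      fix x
      have "1 - c + c = 1" using c1 by (simp add: diff_add_cancel_ennreal)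
      then show "g x * indicator Ai x + (indicator (V \<inter> Ai) x + c * indicator (W \<inter> Ai) x) = indicator Ai x"
        using VW by (auto simp: g_def split: split_indicator)
    qed
    also have "\<dots> = emeasure \<mu> A"
      using marg_em[OF s\<gamma>] by (simp add: couplingsD(3)[OF \<gamma>])
    finally show "emeasure (distr \<gamma>' borel (\<lambda>x. x $ i)) A = emeasure \<mu> A" .
  qed (simp add: \<mu>)
  have "prob_space \<gamma>'"
  proof
    have "emeasure \<gamma>' (space \<gamma>') = emeasure (distr \<gamma>' borel (\<lambda>x. x $ undefined)) UNIV"
      using s\<gamma>' sets_eq_imp_space_eq[OF s\<gamma>'] by (subst emeasure_distr) (auto cong: measurable_cong_sets)
    also have "\<dots> = emeasure (distr \<gamma> borel (\<lambda>x. x $ undefined)) UNIV"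
      by (simp only: marg couplingsD(3)[OF \<gamma>])
    also have "\<dots> = 1" using emeasure_space_1 sets_eq_imp_space_eq[OF s\<gamma>] by (subst emeasure_distr) auto
    finally show "emeasure \<gamma>' (space \<gamma>') = 1" .
  qed
  with marg s\<gamma>' have "\<gamma>' \<in> couplings \<mu>" by (simp add: couplings_def)
  moreover have "(\<integral>\<^sup>+w. h w \<partial>\<gamma>') \<le> (\<integral>\<^sup>+w. h w * indicator (- V) w \<partial>\<gamma>) + q * (of_nat CARD('n) * C)"
  proof -
    have nonneg: "AE r in M j i. 0 \<le> r" and big: "i \<noteq> j \<Longrightarrow> AE r in M j i. a \<le> r" for i j
    proof -
      have sU: "sets (uniform_measure \<gamma> (X j i)) = sets borel" by (simp add: s\<gamma>)
      have "AE w in \<gamma>. \<forall>i. 0 \<le> w $ i" using \<gamma> \<mu>(2) by (rule AE_coupling) measurable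
      then have "AE w in uniform_measure \<gamma> (X j i). 0 \<le> w $ i"
        by (intro AE_uniform_measureI) (auto simp: s\<gamma>)
      then show "AE r in M j i. 0 \<le> r"
        unfolding M_def by (subst AE_distr_iff) (auto cong: measurable_cong_sets[OF sU])
      show "AE r in M j i. a \<le> r" if "i \<noteq> j"
      proof -
        have "AE w in uniform_measure \<gamma> (X j i). a \<le> w $ i"
          using that by (intro AE_uniform_measureI) (auto simp: s\<gamma> X_def W_def)
        then show ?thesis
          unfolding M_def by (subst AE_distr_iff) (auto cong: measurable_cong_sets[OF sU])
      qed
    qed
    have \<beta>C: "(\<integral>\<^sup>+w. h w \<partial>\<beta> j) \<le> C" for j
    proof -
      have "AE w in \<beta> j. 0 \<le> w $ i" for i
        by (rule AE_marginal[OF \<beta>(2)], unfold \<beta>(3), rule nonneg) measurable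
      moreover have "AE w in \<beta> j. i \<noteq> j \<longrightarrow> a \<le> w $ i" for i
      proof (cases "i = j")
        case False
        have "AE w in \<beta> j. a \<le> w $ i"
          by (rule AE_marginal[OF \<beta>(2)], unfold \<beta>(3), rule big[OF False]) measurable
        then show ?thesis by eventually_elim simp
      qed simp
      ultimately have "AE w in \<beta> j. (\<forall>i. 0 \<le> w $ i) \<and> (\<forall>i. i \<noteq> j \<longrightarrow> a \<le> w $ i)"
        by (simp add: AE_all_countable AE_conj_iff)
      then have "(\<integral>\<^sup>+w. h w \<partial>\<beta> j) \<le> (\<integral>\<^sup>+w. C \<partial>\<beta> j)"
        by (intro nn_integral_mono_AE, eventually_elim) (use hC in blast)
      then show ?thesis by (simp add: prob_space.emeasure_space_1[OF \<beta>(1)])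
    qed
    have "(\<integral>\<^sup>+w. h w \<partial>\<gamma>') = (\<integral>\<^sup>+w. g w * h w \<partial>\<gamma>) + (\<Sum>j\<in>UNIV. q * (\<integral>\<^sup>+w. h w \<partial>\<beta> j))"
      by (rule int\<gamma>') measurable
    also have "\<dots> \<le> (\<integral>\<^sup>+w. h w * indicator (- V) w \<partial>\<gamma>) + (\<Sum>j\<in>(UNIV :: 'n set). q * C)"
    proof (intro add_mono nn_integral_mono sum_mono mult_left_mono \<beta>C)
      fix w
      have "(1 - c) * h w \<le> 1 * h w" by (intro mult_right_mono diff_le_self_ennreal) auto
      then show "g w * h w \<le> h w * indicator (- V) w" by (auto simp: g_def)
    qed simp
    also have "(\<Sum>j\<in>(UNIV :: 'n set). q * C) = q * (of_nat CARD('n) * C)" by (simp add: mult_ac)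
    finally show ?thesis .
  qed
  ultimately show thesis by (intro that) (auto simp: q_def)
qed

text \<open>Distinct points on a line missing the origin have different directions. The strict
  inequality reduces to \<open>0 < (k i - k j)\<^sup>2\<close>.\<close>

lemma non_parallel_unit_vectors:
  assumes "2 \<le> CARD('d)"
  obtains \<theta> :: "'n::finite \<Rightarrow> real ^ 'd::finite"
  where "\<And>i. norm (\<theta> i) = 1" "\<And>i j. i \<noteq> j \<Longrightarrow> (\<theta> i \<bullet> \<theta> j)\<^sup>2 < 1"
proof -
  define e where "e = (axis undefined 1 :: real ^ 'd)"
  have e: "e \<bullet> e = 1" by (simp add: e_def inner_axis_axis)
  obtain f0 :: "real ^ 'd" where f0: "f0 \<noteq> 0" "orthogonal e f0"
    using orthogonal_to_vector_exists[of e] assms by auto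
  define f where "f = f0 /\<^sub>R norm f0"
  have "norm f = 1" using f0 by (simp add: f_def)
  then have "f \<bullet> f = 1" by (simp add: dot_square_norm)
  moreover have "e \<bullet> f = 0" using f0(2) by (simp add: f_def orthogonal_def)
  ultimately have f: "f \<bullet> f = 1" "e \<bullet> f = 0" "f \<bullet> e = 0" by (simp_all add: inner_commute)
  obtain k :: "'n \<Rightarrow> nat" where k: "inj k"
    using finite_imp_inj_to_nat_seg[of "UNIV :: 'n set"] by auto
  define u where "u i = e + real (k i) *\<^sub>R f" for i
  have uu: "u i \<bullet> u j = 1 + real (k i) * real (k j)" for i j
    by (simp add: u_def inner_add_left inner_add_right e f)
  have pos: "0 < 1 + (real (k i))\<^sup>2" for i by (simp add: add_pos_nonneg)
  have nu: "norm (u i) = sqrt (1 + (real (k i))\<^sup>2)" for i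
    by (simp add: norm_eq_sqrt_inner uu power2_eq_square)
  define \<theta> where "\<theta> i = u i /\<^sub>R norm (u i)" for i
  have "norm (\<theta> i) = 1" for i using pos[of i] by (simp add: \<theta>_def nu)
  moreover have "(\<theta> i \<bullet> \<theta> j)\<^sup>2 < 1" if "i \<noteq> j" for i j
  proof -
    have "(\<theta> i \<bullet> \<theta> j)\<^sup>2 = (1 + real (k i) * real (k j))\<^sup>2 / ((1 + (real (k i))\<^sup>2) * (1 + (real (k j))\<^sup>2))"
      using pos[of i] pos[of j]
      by (simp add: \<theta>_def nu uu power_mult_distrib power_divide field_simps)
    also have "\<dots> < 1"
    proof -
      have "k i \<noteq> k j" using k that by (auto dest: injD)
      then have "0 < (real (k i) - real (k j))\<^sup>2" by simp
      then have "(1 + real (k i) * real (k j))\<^sup>2 < (1 + (real (k i))\<^sup>2) * (1 + (real (k j))\<^sup>2)"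
        by (simp add: power2_eq_square algebra_simps)
      then show ?thesis using pos[of i] pos[of j] by (simp add: pos_divide_less_eq)
    qed
    finally show ?thesis .
  qed
  ultimately show thesis by (rule that)
qed

text \<open>Points are placed along fixed, pairwise non-parallel directions. A point at radius at
  least \<open>a\<close> keeps a positive distance from the line of any other direction, so in each
  pair it is enough that one radius is large.\<close>

lemma reduced_cost_bounded:
  assumes d: "2 \<le> CARD('d::finite)" and a: "0 < a"
  obtains C :: real where "0 \<le> C"
    "\<And>(w :: real ^ 'n) j. (\<And>i. 0 \<le> w $ i) \<Longrightarrow> (\<And>i. i \<noteq> j \<Longrightarrow> a \<le> w $ i) \<Longrightarrow> reduced_cost TYPE('d) w \<le> ennreal C"
proof -
  obtain \<theta> :: "'n \<Rightarrow> real ^ 'd" where \<theta>: "\<And>i. norm (\<theta> i) = 1" "\<And>i j. i \<noteq> j \<Longrightarrow> (\<theta> i \<bullet> \<theta> j)\<^sup>2 < 1"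
    using non_parallel_unit_vectors[OF d] by blast
  define s where "s i j = a * sqrt (1 - (\<theta> i \<bullet> \<theta> j)\<^sup>2)" for i j
  have s: "0 < s i j" if "i \<noteq> j" for i j using \<theta>(2)[OF that] a by (simp add: s_def)
  define C where "C = (\<Sum>(i, j)\<in>{(i, j). i \<noteq> j}. 1 / s i j)"
  show thesis
  proof (rule that[of C])
    show "0 \<le> C" unfolding C_def using s by (intro sum_nonneg) (auto intro: less_imp_le)
    fix w :: "real ^ 'n" and j0
    assume w: "\<And>i. 0 \<le> w $ i" "\<And>i. i \<noteq> j0 \<Longrightarrow> a \<le> w $ i"
    define x where "x = (\<chi> i. w $ i *\<^sub>R \<theta> i)"
    have "reduced_cost TYPE('d) w \<le> coulomb_cost x"
      by (rule reduced_cost_le) (simp add: x_def \<theta>(1) w(1))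
    also have "\<dots> \<le> (\<Sum>(i, j)\<in>{(i, j). i \<noteq> j}. ennreal (1 / s i j))"
      unfolding coulomb_cost_def
    proof (rule sum_mono, clarify)
      fix i j :: 'n assume ij: "i \<noteq> j"
      define \<kappa> where "\<kappa> = \<theta> i \<bullet> \<theta> j"
      have \<kappa>: "0 < 1 - \<kappa>\<^sup>2" using \<theta>(2)[OF ij] by (simp add: \<kappa>_def)
      have big: "a\<^sup>2 * (1 - \<kappa>\<^sup>2) \<le> p\<^sup>2 + q\<^sup>2 - 2 * p * q * \<kappa>" if "a \<le> p" for p q
      proof -
        have "a\<^sup>2 * (1 - \<kappa>\<^sup>2) \<le> p\<^sup>2 * (1 - \<kappa>\<^sup>2)"
          using that a \<kappa> by (intro mult_right_mono power_mono) auto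
        also have "\<dots> \<le> p\<^sup>2 * (1 - \<kappa>\<^sup>2) + (q - p * \<kappa>)\<^sup>2" by simp
        also have "\<dots> = p\<^sup>2 + q\<^sup>2 - 2 * p * q * \<kappa>" by (simp add: power2_eq_square algebra_simps)
        finally show ?thesis .
      qed
      have "(norm (x $ i - x $ j))\<^sup>2 = (w $ i)\<^sup>2 + (w $ j)\<^sup>2 - 2 * w $ i * w $ j * \<kappa>"
        unfolding power2_norm_eq_inner inner_diff_left inner_diff_right
        using \<theta>(1)[of i] \<theta>(1)[of j]
        by (simp add: x_def \<kappa>_def norm_eq_1 inner_commute[of "\<theta> j" "\<theta> i"] power2_eq_square algebra_simps)
      moreover have "a \<le> w $ i \<or> a \<le> w $ j" using w(2) ij by metis
      ultimately have "a\<^sup>2 * (1 - \<kappa>\<^sup>2) \<le> (norm (x $ i - x $ j))\<^sup>2"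
        using big[of "w $ i" "w $ j"] big[of "w $ j" "w $ i"] by (auto simp: algebra_simps)
      then have "sqrt (a\<^sup>2 * (1 - \<kappa>\<^sup>2)) \<le> norm (x $ i - x $ j)" by (intro real_le_lsqrt) auto
      then have le: "s i j \<le> norm (x $ i - x $ j)" using a by (simp add: s_def \<kappa>_def real_sqrt_mult)
      then have pos: "0 < norm (x $ i - x $ j)" using s[OF ij] by linarith
      then have "1 / ennreal (norm (x $ i - x $ j)) = ennreal (1 / norm (x $ i - x $ j))"
        using divide_ennreal[of 1 "norm (x $ i - x $ j)"] by simp
      also have "\<dots> \<le> ennreal (1 / s i j)" using le s[OF ij] by (intro ennreal_leI divide_left_mono) (auto intro: mult_pos_pos pos)
      finally show "1 / ennreal (norm (x $ i - x $ j)) \<le> ennreal (1 / s i j)" .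
    qed
    also have "\<dots> = ennreal C"
      unfolding C_def using s by (subst sum_ennreal[symmetric]) (auto intro!: sum.cong intro: less_imp_le)
    finally show "reduced_cost TYPE('d) w \<le> ennreal C" .
  qed
qed

text \<open>Continuity from above: the measure has a density, so it has no atom at \<open>0\<close>,
  and it gives no mass to negative numbers.\<close>

lemma radial_marginal_small_ball:
  assumes [measurable]: "\<rho> \<in> borel_measurable borel"
    and "prob_space (radial_marginal \<rho>)" "0 < \<epsilon>"
  obtains a where "0 < a" "emeasure (radial_marginal \<rho>) {..<a} \<le> ennreal \<epsilon>"
proof -
  interpret prob_space "radial_marginal \<rho>" by fact
  define A where "A n = {..<1 / real (Suc n)}" for n
  have "(\<lambda>n. emeasure (radial_marginal \<rho>) (A n)) \<longlonglongrightarrow> emeasure (radial_marginal \<rho>) (\<Inter>n. A n)"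
  proof (rule Lim_emeasure_decseq)
    show "decseq A" unfolding A_def decseq_def by (auto simp: field_simps elim!: less_le_trans)
  qed (auto simp: A_def emeasure_eq_measure)
  moreover have "(\<Inter>n. A n) = {..0}"
  proof (intro set_eqI iffI)
    fix x assume x: "x \<in> (\<Inter>n. A n)"
    show "x \<in> {..0}"
    proof (rule ccontr)
      assume "x \<notin> {..0}"
      then obtain n where "1 / real (Suc n) < x" using reals_Archimedean[of x] by (auto simp: inverse_eq_divide)
      with x show False by (auto simp: A_def dest!: spec[of _ n])
    qed
  qed (auto simp: A_def intro: le_less_trans)
  moreover have "emeasure (radial_marginal \<rho>) {..0} = 0"
  proof -
    have "AE r in lborel. r \<noteq> (0 :: real)" by (rule AE_lborel_singleton)
    then have "(\<integral>\<^sup>+r. indicator {0..} r * ennreal (\<rho> r) * indicator {..0} r \<partial>lborel) = (\<integral>\<^sup>+r. 0 \<partial>(lborel :: real measure))"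
      by (intro nn_integral_cong_AE, eventually_elim) (auto split: split_indicator)
    then show ?thesis unfolding radial_marginal_def by (subst emeasure_density) auto
  qed
  ultimately have "(\<lambda>n. emeasure (radial_marginal \<rho>) (A n)) \<longlonglongrightarrow> 0" by simp
  then have "eventually (\<lambda>n. emeasure (radial_marginal \<rho>) (A n) < ennreal \<epsilon>) sequentially"
    using assms(3) by (intro order_tendstoD) auto
  then obtain n where "emeasure (radial_marginal \<rho>) (A n) < ennreal \<epsilon>"
    by (auto simp: eventually_sequentially)
  then show thesis by (intro that[of "1 / real (Suc n)"]) (auto simp: A_def)
qed

text \<open>Near a point of infinite cost the cost exceeds any given bound on an open set of
  positive mass. Rearranging that mass at a fixed cost per unit would beat the minimizer.\<close>

lemma reduced_cost_finite_on_support: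
  fixes \<gamma> :: "(real ^ 'n) measure"
  assumes \<rho>[measurable]: "\<rho> \<in> borel_measurable borel"
    and d: "2 \<le> CARD('d::finite)" and n: "2 \<le> CARD('n)"
    and \<gamma>: "is_arg_min (reduced_functional TYPE('d)) (\<lambda>\<gamma>. \<gamma> \<in> couplings (radial_marginal \<rho>)) \<gamma>"
    and prob: "prob_space (radial_marginal \<rho>)"
    and v: "v \<in> measure_support \<gamma>"
  shows "reduced_cost TYPE('d) v \<noteq> top"
proof
  assume top: "reduced_cost TYPE('d) v = top"
  let ?\<mu> = "radial_marginal \<rho>" and ?h = "reduced_cost TYPE('d) :: real ^ 'n \<Rightarrow> ennreal"
  have \<gamma>c: "\<gamma> \<in> couplings ?\<mu>"
    and \<gamma>min: "\<And>\<gamma>' :: (real ^ 'n) measure. \<gamma>' \<in> couplings ?\<mu> \<Longrightarrow> (\<integral>\<^sup>+w. ?h w \<partial>\<gamma>) \<le> (\<integral>\<^sup>+w. ?h w \<partial>\<gamma>')"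
    using \<gamma> by (auto simp: is_arg_min_def not_less reduced_functional_def)
  interpret prob_space \<gamma> using \<gamma>c by (rule couplingsD)
  note s\<gamma>[measurable_cong] = couplingsD(2)[OF \<gamma>c]
  define N where "N = CARD('n)"
  have N: "0 < N" using n by (simp add: N_def)
  obtain a where a: "0 < a" "emeasure ?\<mu> {..<a} \<le> ennreal (1 / real (N * N))"
    using radial_marginal_small_ball[OF \<rho> prob, of "1 / real (N * N)"] N by auto
  have "of_nat (N * N) * emeasure ?\<mu> {..<a} \<le> ennreal (real (N * N)) * ennreal (1 / real (N * N))"
    using a(2) by (intro mult_mono) (auto simp: ennreal_of_nat_eq_real_of_nat)
  also have "\<dots> = 1" using N by (subst ennreal_mult'[symmetric]) auto
  finally have a2: "of_nat (CARD('n) * CARD('n)) * emeasure ?\<mu> {..<a} \<le> 1" by (simp add: N_def)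
  obtain C where C: "0 \<le> C"
    "\<And>(w :: real ^ 'n) j. (\<And>i. 0 \<le> w $ i) \<Longrightarrow> (\<And>i. i \<noteq> j \<Longrightarrow> a \<le> w $ i) \<Longrightarrow> ?h w \<le> ennreal C"
    using reduced_cost_bounded[OF d a(1)] by blast
  have hC: "\<forall>(w :: real ^ 'n) j. (\<forall>i. 0 \<le> w $ i) \<longrightarrow> (\<forall>i. i \<noteq> j \<longrightarrow> a \<le> w $ i) \<longrightarrow> ?h w \<le> ennreal C"
    using C(2) by blast
  note rearr = coupling_rearrangement[OF n \<gamma>c sets_radial_marginal AE_radial_marginal_nonneg[OF \<rho>] a2 _ _ _ reduced_cost_measurable hC]
  have improve: "(\<integral>\<^sup>+w. ?h w \<partial>\<gamma>) \<le> (\<integral>\<^sup>+w. ?h w * indicator (- V) w \<partial>\<gamma>) + emeasure \<gamma> V * (of_nat N * ennreal C)"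
    if V: "V \<in> sets borel" "V \<subseteq> {w. \<exists>i. w $ i < a}" "emeasure \<gamma> V \<noteq> 0" for V
  proof -
    obtain \<gamma>' where "\<gamma>' \<in> couplings ?\<mu>"
      "(\<integral>\<^sup>+w. ?h w \<partial>\<gamma>') \<le> (\<integral>\<^sup>+w. ?h w * indicator (- V) w \<partial>\<gamma>) + emeasure \<gamma> V * (of_nat CARD('n) * ennreal C)"
      using rearr[OF V] by blast
    with \<gamma>min show ?thesis unfolding N_def by (meson order_trans)
  qed
  have nn: "AE w in \<gamma>. \<forall>i. 0 \<le> w $ i"
    using \<gamma>c AE_radial_marginal_nonneg[OF \<rho>] by (rule AE_coupling) measurable
  \<comment> \<open>Finiteness of the minimum has to come first, since the comparison at the end
    cancels the common part \<open>?R\<close>. It follows by rearranging all mass with a small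
    coordinate.\<close>
  have finite: "(\<integral>\<^sup>+w. ?h w \<partial>\<gamma>) < top"
  proof -
    define V where "V = {w :: real ^ 'n. \<exists>i. w $ i < a}"
    have V[measurable]: "V \<in> sets borel" unfolding V_def by measurable
    have "(\<integral>\<^sup>+w. ?h w * indicator (- V) w \<partial>\<gamma>) \<le> (\<integral>\<^sup>+w. ennreal C \<partial>\<gamma>)"
      using nn
    proof (intro nn_integral_mono_AE, eventually_elim)
      fix w :: "real ^ 'n" assume "\<forall>i. 0 \<le> w $ i"
      then show "?h w * indicator (- V) w \<le> ennreal C"
        using C(2)[of w undefined] by (auto simp: V_def not_less split: split_indicator)
    qed
    then have le: "(\<integral>\<^sup>+w. ?h w * indicator (- V) w \<partial>\<gamma>) \<le> ennreal C" by (simp add: emeasure_space_1)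
    show ?thesis
    proof (cases "emeasure \<gamma> V = 0")
      case True
      then have "AE w in \<gamma>. w \<notin> V" by (intro AE_not_in null_setsI) (auto simp: s\<gamma>)
      then have "(\<integral>\<^sup>+w. ?h w \<partial>\<gamma>) = (\<integral>\<^sup>+w. ?h w * indicator (- V) w \<partial>\<gamma>)"
        by (intro nn_integral_cong_AE, eventually_elim) simp
      with le show ?thesis by (simp add: le_less_trans)
    next
      case False
      have "(\<integral>\<^sup>+w. ?h w \<partial>\<gamma>) \<le> (\<integral>\<^sup>+w. ?h w * indicator (- V) w \<partial>\<gamma>) + emeasure \<gamma> V * (of_nat N * ennreal C)"
        by (rule improve[OF V _ False]) (simp add: V_def)
      also have "\<dots> \<le> ennreal C + 1 * (of_nat N * ennreal C)"
        by (intro add_mono le mult_right_mono emeasure_le_1) auto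
      also have "\<dots> < top" by (simp add: ennreal_mult_less_top of_nat_less_top)
      finally show ?thesis .
    qed
  qed
  \<comment> \<open>One more than \<open>N * C\<close>, the cost of rearrangement per unit of mass,
    so that the gain is strict.\<close>
  define L where "L = real N * C + 1"
  have L: "C \<le> L" "0 \<le> L"
  proof -
    have "1 * C \<le> real N * C" using N C(1) by (intro mult_right_mono) auto
    then show "C \<le> L" "0 \<le> L" using C(1) by (auto simp: L_def)
  qed
  \<comment> \<open>On nonnegative radii this is the sublevel set of the reduced cost at
    \<open>L\<close>. Written through optimizers, its closedness follows from the closed
    graph.\<close>
  define Z where "Z = {w :: real ^ 'n. {x :: (real ^ 'd) ^ 'n. attains_reduced_cost w x} \<inter> {x. coulomb_cost x \<le> ennreal L} \<noteq> {}}"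
  have "closed {x :: (real ^ 'd) ^ 'n. coulomb_cost x \<le> ennreal L}"
    by (intro closed_Collect_le continuous_on_coulomb_cost continuous_on_const)
  then have "closed Z" unfolding Z_def
    by (rule closed_graph_fibre_compact(2)[of _ norm, rotated -1])
       (auto simp: closed_attains_reduced_cost attains_reduced_cost_norm_le intro!: continuous_intros)
  then have oZ: "open (- Z)" and Zm: "- Z \<in> sets borel" and [measurable]: "Z \<in> sets borel" by auto
  have Zle: "w \<in> Z" if "\<And>i. 0 \<le> w $ i" "?h w \<le> ennreal L" for w
    using attains_reduced_cost_exists[OF that(1), where 'd='d] that(2)
    by (auto simp: Z_def attains_reduced_cost_def)
  have "v \<in> - Z" using top by (auto simp: Z_def attains_reduced_cost_def top_unique)
  then have pos: "emeasure \<gamma> (- Z) \<noteq> 0" using v oZ by (auto simp: measure_support_def)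
  have sub: "- Z \<subseteq> {w. \<exists>i. w $ i < a}"
  proof
    fix w assume w: "w \<in> - Z"
    show "w \<in> {w. \<exists>i. w $ i < a}"
    proof (rule ccontr)
      assume "w \<notin> {w. \<exists>i. w $ i < a}"
      then have big: "\<And>i. a \<le> w $ i" by (auto simp: not_less)
      then have nonneg: "\<And>i. 0 \<le> w $ i" using a(1) by (meson less_imp_le order_trans)
      have "?h w \<le> ennreal L" using C(2)[OF nonneg big] L by (meson ennreal_leI order_trans)
      with w nonneg Zle show False by blast
    qed
  qed
  let ?R = "\<integral>\<^sup>+w. ?h w * indicator (- (- Z)) w \<partial>\<gamma>"
  have "?R + emeasure \<gamma> (- Z) * ennreal L \<le> ?R + (\<integral>\<^sup>+w. ?h w * indicator (- Z) w \<partial>\<gamma>)"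
  proof (rule add_left_mono)
    have "emeasure \<gamma> (- Z) * ennreal L = (\<integral>\<^sup>+w. ennreal L * indicator (- Z) w \<partial>\<gamma>)"
      by (simp add: nn_integral_cmult_indicator s\<gamma> mult.commute)
    also have "\<dots> \<le> (\<integral>\<^sup>+w. ?h w * indicator (- Z) w \<partial>\<gamma>)"
      using nn
    proof (intro nn_integral_mono_AE, eventually_elim)
      fix w :: "real ^ 'n" assume "\<forall>i. 0 \<le> w $ i"
      with Zle[of w] have "w \<notin> Z \<Longrightarrow> ennreal L \<le> ?h w" by (meson linear)
      then show "ennreal L * indicator (- Z) w \<le> ?h w * indicator (- Z) w"
        by (simp split: split_indicator)
    qed
    finally show "emeasure \<gamma> (- Z) * ennreal L \<le> (\<integral>\<^sup>+w. ?h w * indicator (- Z) w \<partial>\<gamma>)" .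
  qed
  also have "\<dots> = (\<integral>\<^sup>+w. ?h w * indicator (- (- Z)) w + ?h w * indicator (- Z) w \<partial>\<gamma>)"
    using Zm by (intro nn_integral_add[symmetric]) auto
  also have "\<dots> = (\<integral>\<^sup>+w. ?h w \<partial>\<gamma>)"
    by (intro nn_integral_cong) (auto split: split_indicator)
  also have "\<dots> \<le> ?R + emeasure \<gamma> (- Z) * (of_nat N * ennreal C)"
    by (rule improve[OF Zm sub pos])
  finally have le: "?R + emeasure \<gamma> (- Z) * ennreal L \<le> ?R + emeasure \<gamma> (- Z) * (of_nat N * ennreal C)" .
  have "?R \<le> (\<integral>\<^sup>+w. ?h w \<partial>\<gamma>)" by (intro nn_integral_mono) (auto split: split_indicator)
  with finite have Rfin: "?R < top" by (rule le_less_trans[rotated])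
  have "emeasure \<gamma> (- Z) * ennreal L \<le> emeasure \<gamma> (- Z) * (of_nat N * ennreal C)"
    using le Rfin by (auto simp: ennreal_add_left_cancel_le)
  moreover have "of_nat N * ennreal C = ennreal (real N * C)"
    using C(1) by (simp add: ennreal_of_nat_eq_real_of_nat ennreal_mult')
  ultimately have "measure \<gamma> (- Z) * L \<le> measure \<gamma> (- Z) * (real N * C)"
    using C(1) L by (simp add: emeasure_eq_measure flip: ennreal_mult')
  moreover have "0 < measure \<gamma> (- Z)" using pos by (simp add: emeasure_eq_measure zero_less_measure_iff)
  ultimately show False by (simp add: L_def)
qed

theorem proposition3p2p1:
  fixes \<rho> :: "real \<Rightarrow> real"
    and \<gamma> :: "(real ^ 'n::finite) measure"
    and one :: 'n
    and I :: "real set"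
  assumes "CARD('n) \<ge> 3"
    and "CARD('d::finite) \<ge> 3"
    and "\<rho> \<in> borel_measurable borel"
    and "\<And>r. r \<ge> 0 \<Longrightarrow> \<rho> r \<ge> 0"
    and "prob_space (radial_measure \<rho> :: (real ^ 'd) measure)"
    and "is_arg_min (reduced_functional TYPE('d)) (\<lambda>\<gamma>. \<gamma> \<in> couplings (radial_marginal \<rho>)) \<gamma>"
    and "I \<subseteq> {0<..}" and "I \<in> sets lebesgue" and "emeasure lebesgue I > 0"
    and "\<And>r. r \<in> I \<Longrightarrow> \<exists>v \<in> measure_support \<gamma>. v $ one = r \<and>
           (\<exists>x :: (real ^ 'd) ^ 'n. attains_reduced_cost v x \<and>
              (\<exists>i. \<not> collinear {0, x $ one, x $ i}))"
  shows "\<exists>P :: ((real ^ 'd) ^ 'n) measure.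
           is_arg_min coulomb_functional (\<lambda>P. P \<in> couplings (radial_measure \<rho>)) P \<and>
           hausdorff_dim (measure_support P) \<ge> ereal (2 * real CARD('d) - 2)"
proof -
  have prob: "prob_space (radial_marginal \<rho>)"
    using assms(3,5) by (rule prob_space_radial_marginal)
  obtain P :: "((real ^ 'd) ^ 'n) measure"
    where P: "is_arg_min coulomb_functional (\<lambda>P. P \<in> couplings (radial_measure \<rho>)) P"
    and inv: "\<And>A x. orthogonal_matrix A \<Longrightarrow> x \<in> measure_support P \<Longrightarrow> (\<chi> i. A *v x $ i) \<in> measure_support P"
    and opt: "\<And>v. v \<in> measure_support \<gamma> \<Longrightarrow> \<exists>x\<in>measure_support P. attains_reduced_cost v x"
    using symmetric_optimal_plan[OF assms(3,6)] by blast
  have "ereal (2 * real CARD('d) - 2) \<le> hausdorff_dim (measure_support P)"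
  proof (rule hausdorff_dim_rotation_invariant[OF _ inv assms(7), of one])
    show "2 \<le> CARD('d)" using assms(2) by simp
    show "\<not> negligible I" using assms(8,9) by (simp add: negligible_iff_emeasure0)
    fix r assume r: "r \<in> I"
    then obtain v and x :: "(real ^ 'd) ^ 'n" and i where v: "v \<in> measure_support \<gamma>" "v $ one = r"
      and x: "attains_reduced_cost v x" "\<not> collinear {0, x $ one, x $ i}"
      using assms(10) by blast
    obtain y where y: "y \<in> measure_support P" "attains_reduced_cost v y" using opt[OF v(1)] by blast
    have "reduced_cost TYPE('d) v \<noteq> top"
      using reduced_cost_finite_on_support[OF assms(3) _ _ assms(6) prob v(1)] assms(1,2) by simp
    moreover have "0 < v $ one" using r v(2) assms(7) by auto
    \<comment> \<open>Rigidity is used with exchanged roles: if \<open>y\<close> were collinear, so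
      would be \<open>x\<close>.\<close>
    ultimately have "\<exists>i. \<not> collinear {0, y $ one, y $ i}"
      using collinear_optimizer_unique[of v one y x] assms(2) x y(2) by auto
    then show "\<exists>x\<in>measure_support P. norm (x $ one) = r \<and> (\<exists>i. \<not> collinear {0, x $ one, x $ i})"
      using y v(2) by (auto simp: attains_reduced_cost_def)
  qed
  with P show ?thesis by blast
qed

end
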